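(* Fix $\gamma>0$ and $\beta>0$, and let $k>\left|\dfrac{4\gamma}{\beta}\right|^{1/4}$. Then sufficiently small amplitude periodic traveling waves $\eta(\varepsilon;k)$ of the RMKP equation are transversely unstable with respect to non-periodic (localized or bounded) perturbations in the direction of propagation and periodic, finite wavelength perturbations in the transverse direction. That is: there are $\rho_0>0$ and $\varepsilon_0>0$ such that for every $\varepsilon$ with $0<|\varepsilon|<\varepsilon_0$ there is $\rho$ with $|\rho|\ge\rho_0$ at which the wave has a non-periodic instability.
   Context: Let $\mathbb T=\mathbb R/2\pi\mathbb Z$. The rotation-modified Kadomtsev-Petviashvili (RMKP) equation for $u=u(x,y,t)$ is $(u_t-\beta u_{xxx}+(u^2)_x)_x-\gamma u+u_{yy}=0$, with $\gamma>0$, $\beta\in\mathbb R$. Periodic traveling waves. For $\beta>0$ let $k>0$ with $k\ne(\gamma/(\beta n^2))^{1/4}$ for all integers $n\ge2$. There is a known one-parameter family of $y$-independent solutions $u(x,t)=\eta(\varepsilon;k)(k(x-c(\varepsilon;k)t))$, $|\varepsilon|$ small, where $\eta$ is $2\pi$-periodic, even and smooth in $z=k(x-ct)$, $c$ is even in $\varepsilon$, $\eta$ and $c$ depend analytically on $\varepsilon,k$, and as $\varepsilon\to0$ $\eta(z)=\varepsilon\cos z+\varepsilon^2\eta_2\cos2z+\varepsilon^3\eta_3\cos3z+O(\varepsilon^4)$, $c=c_0+\varepsilon^2c_2+O(\varepsilon^4)$, with $\eta_2=\frac{2k^2}{3\gamma-12\beta k^4}$, $\eta_3=\frac{9k^2\eta_2}{8\gamma-72\beta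 k^4}$, $c_0=\frac{\gamma}{k^2}+\beta k^2$, $c_2=\eta_2$. Spectral problem. Linearizing the RMKP equation about $\eta$ in the frame $z=k(x-ct)$ and taking perturbations $e^{\lambda t/k+i\rho y}\varphi(z)$, $\lambda\in\mathbb C$, $\rho\in\mathbb R$, gives $\mathcal G_\varepsilon(\lambda,\rho)\varphi=0$ with $\mathcal G_\varepsilon(\lambda,\rho)=\lambda\partial_z-k^2\partial_z^2(c+\beta k^2\partial_z^2-2\eta)-\rho^2-\gamma$. For localized or bounded perturbations this operator acts in $L^2(\mathbb R)$ or $C_b(\mathbb R)$ (domain $H^4(\mathbb R)$ or $C_b^4(\mathbb R)$); by Floquet theory its invertibility there is equivalent to invertibility in $L^2(\mathbb T)$, with domain $H^4(\mathbb T)$, of all operators $\mathcal G_{\varepsilon,\xi}(\lambda,\rho)$, $\xi\in(-\frac12,\frac12]$, obtained by replacing $\partial_z$ by $\partial_z+i\xi$. The value $\xi=0$ is the periodic case, and "non-periodic" refers to $\xi\neq0$. For $\rho\ne0$, the wave has a non-periodic instability at $\rho$ if there are $\xi\in(-\frac12,\frac12]\setminus\{0\}$ and $\lambda\in\mathbb C$ with $\operatorname{Re}\lambda>0$ such that $\mathcal G_{\varepsilon,\xi}(\lambda,\rho)$ is not invertible in $L^2(\mathbb T)$. "Finite wavelength" in $y$ means $|\rho|$ bounded away from $0$. *)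

theory Defs
  imports "HOL-Analysis.Analysis"
begin

section \<open>The RMKP equation and its periodic traveling waves\<close>

definition solves_RMKP :: "real \<Rightarrow> real \<Rightarrow> (real \<Rightarrow> real \<Rightarrow> real \<Rightarrow> real) \<Rightarrow> bool" where
  "solves_RMKP \<gamma> \<beta> u \<longleftrightarrow>
     (\<forall>x y t.
        deriv (\<lambda>x'. deriv (\<lambda>t'. u x' y t') t
                   - \<beta> * (deriv ^^ 3) (\<lambda>s. u s y t) x'
                   + deriv (\<lambda>s. (u s y t)\<^sup>2) x') x
        - \<gamma> * u x y t
        + (deriv ^^ 2) (\<lambda>y'. u x y' t) y = 0)"

definition smooth :: "(real \<Rightarrow> real) \<Rightarrow> bool" where
  "smooth f \<longleftrightarrow> (\<forall>m x. (deriv ^^ m) f field_differentiable at x)"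

definition periodic_2pi :: "(real \<Rightarrow> 'a) \<Rightarrow> bool" where
  "periodic_2pi f \<longleftrightarrow> (\<forall>z. f (z + 2 * pi) = f z)"

text \<open>Real analyticity near \<open>(a, b)\<close> of a vector-valued function of two real variables:
  unconditional convergence to a double power series on a neighbourhood.\<close>

definition analytic_near2 :: "(real \<Rightarrow> real \<Rightarrow> 'v::real_normed_vector) \<Rightarrow> real \<Rightarrow> real \<Rightarrow> bool" where
  "analytic_near2 F a b \<longleftrightarrow>
     (\<exists>r>0. \<exists>A :: nat \<Rightarrow> nat \<Rightarrow> 'v. \<forall>x y. \<bar>x - a\<bar> < r \<longrightarrow> \<bar>y - b\<bar> < r \<longrightarrow>
        ((\<lambda>(i, j). ((x - a) ^ i * (y - b) ^ j) *\<^sub>R A i j) has_sum F x y) UNIV)"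

definition nonresonant :: "real \<Rightarrow> real \<Rightarrow> real \<Rightarrow> bool" where
  "nonresonant \<gamma> \<beta> k \<longleftrightarrow> (\<forall>n::nat\<ge>2. k \<noteq> (\<gamma> / (\<beta> * (real n)\<^sup>2)) powr (1/4))"

definition eta2 :: "real \<Rightarrow> real \<Rightarrow> real \<Rightarrow> real" where
  "eta2 \<gamma> \<beta> k = 2 * k\<^sup>2 / (3 * \<gamma> - 12 * \<beta> * k ^ 4)"

definition eta3 :: "real \<Rightarrow> real \<Rightarrow> real \<Rightarrow> real" where
  "eta3 \<gamma> \<beta> k = 9 * k\<^sup>2 * eta2 \<gamma> \<beta> k / (8 * \<gamma> - 72 * \<beta> * k ^ 4)"

definition c0 :: "real \<Rightarrow> real \<Rightarrow> real \<Rightarrow> real" where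
  "c0 \<gamma> \<beta> k = \<gamma> / k\<^sup>2 + \<beta> * k\<^sup>2"

definition c2 :: "real \<Rightarrow> real \<Rightarrow> real \<Rightarrow> real" where
  "c2 \<gamma> \<beta> k = eta2 \<gamma> \<beta> k"

text \<open>The small-amplitude family: \<open>\<eta> \<epsilon> k z\<close> is the profile and \<open>c \<epsilon> k\<close> the speed; their values for
  \<open>\<epsilon>\<close> that are not small are irrelevant.  Analyticity of \<open>\<eta>\<close> in \<open>(\<epsilon>, k)\<close> is that of a map into the
  Banach space of bounded continuous functions of \<open>z\<close> (by the traveling wave equation, the norm of
  any \<open>C\<^sup>m\<close> would do as well), and the remainder in the expansion of \<open>\<eta>\<close> is uniform in \<open>z\<close>.\<close>

definition RMKP_wave_family ::
    "real \<Rightarrow> real \<Rightarrow> (real \<Rightarrow> real \<Rightarrow> real \<Rightarrow> real) \<Rightarrow> (real \<Rightarrow> real \<Rightarrow> real) \<Rightarrow> bool" where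
  "RMKP_wave_family \<gamma> \<beta> \<eta> c \<longleftrightarrow>
     (\<forall>k>0. nonresonant \<gamma> \<beta> k \<longrightarrow>
        (\<exists>\<delta>>0. \<forall>\<epsilon> \<kappa>. \<bar>\<epsilon>\<bar> < \<delta> \<longrightarrow> \<bar>\<kappa> - k\<bar> < \<delta> \<longrightarrow>
            periodic_2pi (\<eta> \<epsilon> \<kappa>) \<and> (\<forall>z. \<eta> \<epsilon> \<kappa> (- z) = \<eta> \<epsilon> \<kappa> z) \<and> smooth (\<eta> \<epsilon> \<kappa>) \<and>
            solves_RMKP \<gamma> \<beta> (\<lambda>x y t. \<eta> \<epsilon> \<kappa> (\<kappa> * (x - c \<epsilon> \<kappa> * t))) \<and>
            c (- \<epsilon>) \<kappa> = c \<epsilon> \<kappa>) \<and>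
        analytic_near2 (\<lambda>\<epsilon> \<kappa>. Bcontfun (\<eta> \<epsilon> \<kappa>)) 0 k \<and>
        analytic_near2 c 0 k \<and>
        (\<exists>C. \<exists>\<delta>>0. \<forall>\<epsilon>. \<bar>\<epsilon>\<bar> < \<delta> \<longrightarrow>
            (\<forall>z. \<bar>\<eta> \<epsilon> k z - (\<epsilon> * cos z + \<epsilon>\<^sup>2 * eta2 \<gamma> \<beta> k * cos (2 * z)
                              + \<epsilon> ^ 3 * eta3 \<gamma> \<beta> k * cos (3 * z))\<bar> \<le> C * \<epsilon> ^ 4) \<and>
            \<bar>c \<epsilon> k - (c0 \<gamma> \<beta> k + \<epsilon>\<^sup>2 * c2 \<gamma> \<beta> k)\<bar> \<le> C * \<epsilon> ^ 4))"

section \<open>The spaces \<open>L\<^sup>2\<close> and \<open>H\<^sup>m\<close> on the torus\<close>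

text \<open>Elements of \<open>L\<^sup>2(\<T>)\<close> are represented by \<open>2\<pi>\<close>-periodic Borel functions on the line, and equality in
  \<open>L\<^sup>2(\<T>)\<close> is equality almost everywhere.\<close>

definition L2T :: "(real \<Rightarrow> complex) set" where
  "L2T = {f \<in> borel_measurable borel. periodic_2pi f \<and>
            set_integrable lborel {0..2 * pi} (\<lambda>z. (cmod (f z))\<^sup>2)}"

definition L2T_norm :: "(real \<Rightarrow> complex) \<Rightarrow> real" where
  "L2T_norm f = sqrt (LINT z:{0..2 * pi}|lborel. (cmod (f z))\<^sup>2)"

definition ae_eq :: "(real \<Rightarrow> complex) \<Rightarrow> (real \<Rightarrow> complex) \<Rightarrow> bool" where
  "ae_eq f g \<longleftrightarrow> (AE z in lborel. f z = g z)"

text \<open>Real test functions suffice, by linearity.\<close>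

definition has_weak_deriv :: "(real \<Rightarrow> complex) \<Rightarrow> (real \<Rightarrow> complex) \<Rightarrow> bool" where
  "has_weak_deriv f g \<longleftrightarrow> f \<in> L2T \<and> g \<in> L2T \<and>
     (\<forall>\<psi>. smooth \<psi> \<longrightarrow> periodic_2pi \<psi> \<longrightarrow>
        (LINT z:{0..2 * pi}|lborel. f z * complex_of_real (deriv \<psi> z))
          = - (LINT z:{0..2 * pi}|lborel. g z * complex_of_real (\<psi> z)))"

primrec HT :: "nat \<Rightarrow> (real \<Rightarrow> complex) set" where
  "HT 0 = L2T"
| "HT (Suc m) = {f. \<exists>g \<in> HT m. has_weak_deriv f g}"

text \<open>For \<open>f\<close> in \<open>HT 1\<close>, a representative of its weak derivative, which is unique up to
  almost everywhere equality.\<close>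

definition weak_deriv :: "(real \<Rightarrow> complex) \<Rightarrow> real \<Rightarrow> complex" where
  "weak_deriv f = (SOME g. has_weak_deriv f g)"

section \<open>The Bloch operators and non-periodic instability\<close>

definition bloch_deriv :: "real \<Rightarrow> (real \<Rightarrow> complex) \<Rightarrow> real \<Rightarrow> complex" where
  "bloch_deriv \<xi> \<phi> z = weak_deriv \<phi> z + \<i> * complex_of_real \<xi> * \<phi> z"

text \<open>The operator \<open>\<lambda>D - k\<^sup>2D\<^sup>2(c + \<beta>k\<^sup>2D\<^sup>2 - 2\<eta>) - \<rho>\<^sup>2 - \<gamma>\<close> with \<open>D = \<partial>\<^sub>z + i\<xi>\<close>, for a wave with
  speed \<open>c\<close> and profile \<open>\<eta>\<close>, and \<open>\<mu>\<close> in the role of \<open>\<lambda>\<close>.\<close>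

definition bloch_op ::
    "real \<Rightarrow> real \<Rightarrow> real \<Rightarrow> real \<Rightarrow> (real \<Rightarrow> real) \<Rightarrow> real \<Rightarrow> complex \<Rightarrow> real
      \<Rightarrow> (real \<Rightarrow> complex) \<Rightarrow> real \<Rightarrow> complex" where
  "bloch_op \<gamma> \<beta> k c \<eta> \<xi> \<mu> \<rho> \<phi> z =
     \<mu> * bloch_deriv \<xi> \<phi> z
     - complex_of_real (k\<^sup>2)
         * bloch_deriv \<xi> (bloch_deriv \<xi> (\<lambda>s.
             complex_of_real c * \<phi> s
             + complex_of_real (\<beta> * k\<^sup>2) * bloch_deriv \<xi> (bloch_deriv \<xi> \<phi>) s
             - 2 * complex_of_real (\<eta> s) * \<phi> s)) z
     - complex_of_real (\<rho>\<^sup>2) * \<phi> z - complex_of_real \<gamma> * \<phi> z"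

text \<open>A linear operator with domain \<open>D\<close> is invertible in \<open>L\<^sup>2(\<T>)\<close> if it maps \<open>D\<close> bijectively onto
  \<open>L\<^sup>2(\<T>)\<close> with bounded inverse.\<close>

definition invertible_in_L2T ::
    "(real \<Rightarrow> complex) set \<Rightarrow> ((real \<Rightarrow> complex) \<Rightarrow> real \<Rightarrow> complex) \<Rightarrow> bool" where
  "invertible_in_L2T D T \<longleftrightarrow>
     (\<forall>f\<in>L2T. \<exists>\<phi>\<in>D. ae_eq (T \<phi>) f \<and> (\<forall>\<phi>'\<in>D. ae_eq (T \<phi>') f \<longrightarrow> ae_eq \<phi>' \<phi>)) \<and>
     (\<exists>C. \<forall>\<phi>\<in>D. L2T_norm \<phi> \<le> C * L2T_norm (T \<phi>))"

definition nonperiodic_instability ::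
    "real \<Rightarrow> real \<Rightarrow> real \<Rightarrow> real \<Rightarrow> (real \<Rightarrow> real) \<Rightarrow> real \<Rightarrow> bool" where
  "nonperiodic_instability \<gamma> \<beta> k c \<eta> \<rho> \<longleftrightarrow>
     \<rho> \<noteq> 0 \<and>
     (\<exists>\<xi> \<mu>. \<xi> \<in> {- 1/2 <.. 1/2} - {0} \<and> Re \<mu> > 0 \<and>
        \<not> invertible_in_L2T (HT 4) (bloch_op \<gamma> \<beta> k c \<eta> \<xi> \<mu> \<rho>))"

end

theory Submission
  imports Defs
begin

text \<open>Take \<open>\<xi> = 1/2\<close>, the modes \<open>e\<^sup>\<plusminus>\<^sup>i\<^sup>z\<^sup>/\<^sup>2\<close>, and the fixed transverse wave number with
  \<open>\<rho>\<^sup>2 = 3\<beta>k\<^sup>4/16 - 3\<gamma>/4\<close>, which is positive exactly when \<open>k\<^sup>4 > 4\<gamma>/\<beta>\<close>. At \<open>\<epsilon> = 0\<close> both modes are then in the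
  kernel at \<open>\<lambda> = 0\<close>, and all other modes stay away from resonance. Writing \<open>\<phi> = e\<^sup>-\<^sup>i\<^sup>z\<^sup>/\<^sup>2 w\<close>, a kernel element for real
  \<open>\<lambda>\<close> is a real antiperiodic solution \<open>w\<close> of a linear ODE. On antiperiodic functions the derivative is
  invertible, so that the ODE, integrated four times, becomes a small bounded perturbation (in the
  supremum norm) of a constant-coefficient operator with kernel spanned by \<open>cos (z/2)\<close> and \<open>sin (z/2)\<close>.
  A contraction solves for the remaining part of \<open>w\<close> and leaves a determinant of size two, which for
  \<open>\<lambda> = \<kappa>\<bar>\<epsilon>\<bar>\<close> equals \<open>\<pi>\<^sup>2\<epsilon>\<^sup>2(64\<kappa>\<^sup>2 - 16k\<^sup>4)\<close> up to a constant factor and relatively small terms. It changes sign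
  for \<open>\<kappa>\<close> between \<open>0\<close> and \<open>k\<^sup>2\<close>, and a zero is an eigenvalue \<open>\<lambda> > 0\<close>.\<close>

section \<open>Antiperiodic functions\<close>

text \<open>Multiplication by e^(-iz/2) turns d/dz + i/2 into d/dz, so \<xi> = 1/2 leads to a real
  problem. Put b = \<beta> k^4. As k^2 c0 = \<gamma> + b, at \<epsilon> = 0 and \<lambda> = 0 a mode
  e^(iqz) of w is in the kernel iff b q^4 - (\<gamma> + b) q^2 + \<rho>^2 + \<gamma> = 0. Imposing
  the root q^2 = 1/4 dictates \<rho>^2; the other root is q^2 = s^2 = 3/4 + \<gamma>/b. Since 4
  \<gamma> < b gives 1/2 < s < 1, s is not half an odd integer, hence no further antiperiodic mode
  is resonant. The factor cos z couples the two resonant modes at first order, while \<lambda>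
  enters them as i\<lambda>/2 and -i\<lambda>/2. This forces \<lambda> to have the size of
  |\<epsilon>| and makes both leading eigenvalues real, \<lambda> = k^2 |\<epsilon>| / 2 and its
  negative. The positive one is the zero that the intermediate value theorem captures, from
  continuity in \<kappa> alone. The other obstacle is that \<open>weak_deriv\<close> is an arbitrary
  representative, so \<open>bloch_op\<close> is controlled only almost everywhere, and only once
  weak derivatives are known to be unique.\<close>

definition prim :: "(real \<Rightarrow> real) \<Rightarrow> real \<Rightarrow> real" where
  "prim f = (SOME F. \<forall>x. (F has_real_derivative f x) (at x))"

text \<open>The integral of a continuous function, taken as an increment of a primitive: the
  endpoints may come in either order and no integrability conditions arise in the ODE part.\<close>

definition dint :: "(real \<Rightarrow> real) \<Rightarrow> real \<Rightarrow> real \<Rightarrow> real" where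
  "dint f a b = prim f b - prim f a"

lemma deriv_eq_const_diff:
  fixes F G f :: "real \<Rightarrow> real"
  assumes "\<And>x. (F has_real_derivative f x) (at x)" and "\<And>x. (G has_real_derivative f x) (at x)"
  shows "F a - G a = F b - G b"
proof -
  have "((\<lambda>x. F x - G x) has_real_derivative 0) (at x)" for x
    using DERIV_diff[OF assms(1)[of x] assms(2)[of x]] by simp
  then show ?thesis using DERIV_isconst_all[of "\<lambda>x. F x - G x" a b] by blast
qed

lemma prim_deriv_of:
  assumes "\<And>x. (F has_real_derivative f x) (at x)"
  shows "(prim f has_real_derivative f x) (at x)"
proof -
  have "\<exists>F. \<forall>x. (F has_real_derivative f x) (at x)" using assms by blast
  from someI_ex[OF this] show ?thesis unfolding prim_def by blast
qed

lemma dint_eq: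
  assumes "\<And>x. (F has_real_derivative f x) (at x)"
  shows "dint f a b = F b - F a"
  using deriv_eq_const_diff[OF prim_deriv_of[OF assms] assms, of a b] unfolding dint_def by simp

lemma prim_deriv:
  assumes "continuous_on UNIV f"
  shows "(prim f has_real_derivative f x) (at x)"
proof -
  have "\<exists>F. \<forall>x::real. -\<infinity> < ereal x \<longrightarrow> ereal x < \<infinity> \<longrightarrow> (F has_vector_derivative f x) (at x)"
    by (rule einterval_antiderivative) (use assms in \<open>auto simp: continuous_on_eq_continuous_at\<close>)
  then obtain F where "\<And>x. (F has_real_derivative f x) (at x)"
    by (auto simp: has_real_derivative_iff_has_vector_derivative)
  then show ?thesis by (rule prim_deriv_of)
qed

lemma prim_deriv_chain [derivative_intros]:
  assumes "continuous_on UNIV f" and "(g has_real_derivative g') (at x)"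
  shows "((\<lambda>x. prim f (g x)) has_real_derivative f (g x) * g') (at x)"
  using DERIV_chain2[OF prim_deriv[OF assms(1)] assms(2)] .

lemma dint_linear:
  assumes "continuous_on UNIV f" "continuous_on UNIV g"
  shows "dint (\<lambda>x. a * f x + b * g x) u v = a * dint f u v + b * dint g u v"
proof -
  have "((\<lambda>x. a * prim f x + b * prim g x) has_real_derivative a * f x + b * g x) (at x)" for x
    using assms by (auto intro!: derivative_eq_intros)
  from dint_eq[OF this] show ?thesis by (simp add: dint_def algebra_simps)
qed

lemma dint_bound:
  assumes "continuous_on UNIV f" "\<And>x. \<bar>f x\<bar> \<le> B"
  shows "\<bar>dint f a b\<bar> \<le> B * \<bar>b - a\<bar>"
proof -
  have le: "\<bar>dint f a b\<bar> \<le> B * \<bar>b - a\<bar>" if "a < b" for a b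
  proof -
    have "\<exists>z>a. z < b \<and> prim f b - prim f a = (b - a) * f z"
      by (rule MVT2[OF that]) (rule prim_deriv[OF assms(1)])
    then obtain z where "prim f b - prim f a = (b - a) * f z" by blast
    then have "\<bar>dint f a b\<bar> = \<bar>b - a\<bar> * \<bar>f z\<bar>" by (simp add: dint_def abs_mult)
    also have "\<dots> \<le> \<bar>b - a\<bar> * B" using assms(2) by (intro mult_left_mono) auto
    finally show ?thesis by (simp add: mult.commute)
  qed
  consider "a < b" | "a = b" | "b < a" by linarith
  then show ?thesis
  proof cases
    case 3
    then show ?thesis using le[of b a] by (simp add: dint_def abs_minus_commute)
  qed (use le in \<open>auto simp: dint_def\<close>)
qed

section \<open>Continuous antiperiodic functions and the inverse of differentiation\<close>

definition antiper :: "(real \<Rightarrow> real) \<Rightarrow> bool" where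
  "antiper f \<longleftrightarrow> continuous_on UNIV f \<and> (\<forall>z. f (z + 2 * pi) = - f z)"

lemma antiper_cont: "antiper f \<Longrightarrow> continuous_on UNIV f"
  by (simp add: antiper_def)

lemma antiper_shift: "antiper f \<Longrightarrow> f (z + 2 * pi) = - f z"
  by (simp add: antiper_def)

lemma antiper_lin: "antiper f \<Longrightarrow> antiper g \<Longrightarrow> antiper (\<lambda>z. a * f z + b * g z)"
  by (auto simp: antiper_def intro!: continuous_intros)

lemma antiper_scale: "antiper f \<Longrightarrow> antiper (\<lambda>z. a * f z)"
  by (auto simp: antiper_def intro!: continuous_intros)

lemma antiper_add: "antiper f \<Longrightarrow> antiper g \<Longrightarrow> antiper (\<lambda>z. f z + g z)"
  by (auto simp: antiper_def intro!: continuous_intros)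

lemma antiper_diff: "antiper f \<Longrightarrow> antiper g \<Longrightarrow> antiper (\<lambda>z. f z - g z)"
  by (auto simp: antiper_def intro!: continuous_intros)

lemma antiper_mult:
  "antiper f \<Longrightarrow> continuous_on UNIV p \<Longrightarrow> periodic_2pi p \<Longrightarrow> antiper (\<lambda>z. p z * f z)"
  by (auto simp: antiper_def periodic_2pi_def intro!: continuous_intros)

lemma antiper_cos: "antiper (\<lambda>z. cos (z / 2))" and antiper_sin: "antiper (\<lambda>z. sin (z / 2))"
  by (auto simp: antiper_def add_divide_distrib intro!: continuous_intros)

lemma antiper_cos3: "antiper (\<lambda>z. cos (3 * z / 2))" and antiper_sin3: "antiper (\<lambda>z. sin (3 * z / 2))"
proof -
  have "3 * (z + 2 * pi) / 2 = (3 * z / 2 + pi) + 2 * pi" for z by (simp add: field_simps)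
  then show "antiper (\<lambda>z. cos (3 * z / 2))" "antiper (\<lambda>z. sin (3 * z / 2))"
    unfolding antiper_def
    by (auto simp only: cos_periodic sin_periodic cos_periodic_pi sin_periodic_pi
        intro!: continuous_intros)
qed

lemma shift_to_period: "\<exists>n::int. z - 2 * pi * of_int n \<in> {0..2 * pi}"
proof (rule exI[of _ "\<lfloor>z / (2 * pi)\<rfloor>"])
  define x where "x = z / (2 * pi)"
  have "of_int \<lfloor>x\<rfloor> * (2 * pi) \<le> x * (2 * pi)" "x * (2 * pi) \<le> (of_int \<lfloor>x\<rfloor> + 1) * (2 * pi)"
    by (intro mult_right_mono; simp; linarith)+
  moreover have "x * (2 * pi) = z" by (simp add: x_def)
  ultimately have "of_int \<lfloor>z / (2 * pi)\<rfloor> * (2 * pi) \<le> z"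
      "z \<le> (of_int \<lfloor>z / (2 * pi)\<rfloor> + 1) * (2 * pi)"
    by (simp_all add: x_def)
  then show "z - 2 * pi * of_int \<lfloor>z / (2 * pi)\<rfloor> \<in> {0..2 * pi}"
    by (simp add: algebra_simps)
qed

lemma periodic_2pi_int:
  assumes "periodic_2pi f" shows "f (z + 2 * pi * of_int n) = f z"
proof -
  have nat: "f (z + 2 * pi * real m) = f z" for z m
  proof (induction m)
    case (Suc m)
    have "f (z + 2 * pi * real (Suc m)) = f ((z + 2 * pi * real m) + 2 * pi)"
      by (simp add: algebra_simps)
    also have "\<dots> = f z" using assms Suc by (simp add: periodic_2pi_def)
    finally show ?case .
  qed simp
  show ?thesis
  proof (cases "n \<ge> 0")
    case True then show ?thesis using nat[of z "nat n"] by simp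
  next
    case False then show ?thesis using nat[of "z + 2 * pi * of_int n" "nat (- n)"] by simp
  qed
qed

lemma antiper_abs_periodic: "antiper f \<Longrightarrow> periodic_2pi (\<lambda>z. \<bar>f z\<bar>)"
  by (simp add: antiper_def periodic_2pi_def)

lemma antiper_bound:
  assumes "antiper f" and "\<And>z. z \<in> {0..2 * pi} \<Longrightarrow> \<bar>f z\<bar> \<le> B"
  shows "\<bar>f z\<bar> \<le> B"
proof -
  obtain n where n: "z - 2 * pi * of_int n \<in> {0..2 * pi}" using shift_to_period by blast
  have "\<bar>f z\<bar> = \<bar>f (z - 2 * pi * of_int n)\<bar>"
    using periodic_2pi_int[OF antiper_abs_periodic[OF assms(1)], of "z - 2 * pi * of_int n" n] by simp
  then show ?thesis using assms(2)[OF n] by simp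
qed

lemma antiper_max:
  assumes "antiper f" obtains y where "\<And>z. \<bar>f z\<bar> \<le> \<bar>f y\<bar>"
proof -
  have "continuous_on {0..2 * pi} (\<lambda>z. \<bar>f z\<bar>)"
    by (intro continuous_intros) (use assms in \<open>auto simp: antiper_def intro: continuous_on_subset\<close>)
  from continuous_attains_sup[OF compact_Icc _ this]
  obtain y where "\<forall>z\<in>{0..2 * pi}. \<bar>f z\<bar> \<le> \<bar>f y\<bar>" by auto
  then show ?thesis using that antiper_bound[OF assms] by blast
qed

text \<open>The maximum of |d| is attained, and the hypothesis for this maximum D reads D <= D/2 +
  e. Contraction estimates become a priori bounds in this way.\<close>

lemma antiper_absorb_bound:
  assumes "antiper d" and "\<And>D. (\<And>z. \<bar>d z\<bar> \<le> D) \<Longrightarrow> (\<And>z. \<bar>d z\<bar> \<le> D / 2 + e)"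
  shows "\<bar>d z\<bar> \<le> 2 * e"
proof -
  obtain y where y: "\<And>z. \<bar>d z\<bar> \<le> \<bar>d y\<bar>" using antiper_max[OF assms(1)] by blast
  show ?thesis using assms(2)[OF y, of y] y[of z] by simp
qed

text \<open>The constant of integration is the only one that makes the primitive antiperiodic: on
  antiperiodic functions \<open>\<partial>\<^sub>z\<close> is invertible, with this inverse.\<close>

definition anti_int :: "(real \<Rightarrow> real) \<Rightarrow> real \<Rightarrow> real" where
  "anti_int f z = prim f z - (prim f 0 + prim f (2 * pi)) / 2"

lemma anti_int_deriv: "antiper f \<Longrightarrow> (anti_int f has_real_derivative f z) (at z)"
  unfolding anti_int_def by (auto intro!: derivative_eq_intros dest: antiper_cont)

lemma anti_int_antiper:
  assumes "antiper f" shows "antiper (anti_int f)"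
proof -
  have "((\<lambda>z. - prim f (z + 2 * pi)) has_real_derivative f x) (at x)" for x
    using assms by (auto intro!: derivative_eq_intros simp: antiper_def)
  from deriv_eq_const_diff[OF prim_deriv[OF antiper_cont[OF assms]] this, of _ 0]
  have *: "prim f z + prim f (z + 2 * pi) = prim f 0 + prim f (2 * pi)" for z by simp
  have "anti_int f (z + 2 * pi) = - anti_int f z" for z
  proof -
    have "x - (p + q) / 2 = - (y - (p + q) / 2)" if "y + x = p + q" for x y p q :: real
      using that by (simp add: field_simps)
    from this[OF *[of z]] show ?thesis unfolding anti_int_def .
  qed
  moreover have "continuous_on UNIV (anti_int f)"
    using anti_int_deriv[OF assms] by (meson DERIV_continuous_on has_field_derivative_at_within)
  ultimately show ?thesis by (simp add: antiper_def)
qed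

text \<open>Two primitives differ by a constant; if both are antiperiodic, the constant equals its
  own negative.\<close>

lemma anti_int_unique:
  assumes "antiper F" and "\<And>x. (F has_real_derivative f x) (at x)" and "antiper f"
  shows "anti_int f = F"
proof
  fix z
  have "anti_int f z - F z = anti_int f (z + 2 * pi) - F (z + 2 * pi)"
    by (rule deriv_eq_const_diff[OF anti_int_deriv[OF assms(3)] assms(2)])
  also have "\<dots> = - (anti_int f z - F z)"
    using antiper_shift[OF assms(1)] antiper_shift[OF anti_int_antiper[OF assms(3)]] by simp
  finally show "anti_int f z = F z" by simp
qed

text \<open>Bounded linear operators on the Banach space of continuous antiperiodic functions, with
  \<open>M\<close> a bound for the operator norm in the supremum norm. Plain functions are used, so
  that operators compose without coercions.\<close>

definition antiper_op :: "((real \<Rightarrow> real) \<Rightarrow> real \<Rightarrow> real) \<Rightarrow> real \<Rightarrow> bool" where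
  "antiper_op T M \<longleftrightarrow> 0 \<le> M \<and> (\<forall>f. antiper f \<longrightarrow> antiper (T f)) \<and>
     (\<forall>f B. antiper f \<longrightarrow> (\<forall>z. \<bar>f z\<bar> \<le> B) \<longrightarrow> (\<forall>z. \<bar>T f z\<bar> \<le> M * B)) \<and>
     (\<forall>f g a b. antiper f \<longrightarrow> antiper g \<longrightarrow>
        T (\<lambda>z. a * f z + b * g z) = (\<lambda>z. a * T f z + b * T g z))"

lemma antiper_opI:
  assumes "0 \<le> M" "\<And>f. antiper f \<Longrightarrow> antiper (T f)"
    "\<And>f B z. antiper f \<Longrightarrow> (\<And>z. \<bar>f z\<bar> \<le> B) \<Longrightarrow> \<bar>T f z\<bar> \<le> M * B"
    "\<And>f g a b z. antiper f \<Longrightarrow> antiper g \<Longrightarrow> T (\<lambda>z. a * f z + b * g z) z = a * T f z + b * T g z"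
  shows "antiper_op T M"
  using assms unfolding antiper_op_def by (simp add: fun_eq_iff)

lemma antiper_opD:
  assumes "antiper_op T M"
  shows "0 \<le> M" "antiper f \<Longrightarrow> antiper (T f)"
    "antiper f \<Longrightarrow> (\<And>z. \<bar>f z\<bar> \<le> B) \<Longrightarrow> \<bar>T f z\<bar> \<le> M * B"
    "antiper f \<Longrightarrow> antiper g \<Longrightarrow> T (\<lambda>z. a * f z + b * g z) = (\<lambda>z. a * T f z + b * T g z)"
  using assms unfolding antiper_op_def by simp_all

lemma antiper_op_diff:
  assumes "antiper_op T M" "antiper f" "antiper g"
  shows "T (\<lambda>z. f z - g z) = (\<lambda>z. T f z - T g z)"
  using antiper_opD(4)[OF assms, of 1 "-1"] by simp

lemma antiper_op_scaled:
  assumes "antiper_op T M" "antiper f"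
  shows "T (\<lambda>z. a * f z) = (\<lambda>z. a * T f z)"
  using antiper_opD(4)[OF assms assms(2), of a 0] by simp

lemma antiper_op_comp:
  assumes S: "antiper_op S M" and T: "antiper_op T L" shows "antiper_op (\<lambda>f. S (T f)) (M * L)"
proof (rule antiper_opI)
  show "0 \<le> M * L" using antiper_opD(1)[OF S] antiper_opD(1)[OF T] by simp
  show "antiper (S (T f))" if "antiper f" for f using that antiper_opD(2)[OF S] antiper_opD(2)[OF T] by simp
  show "\<bar>S (T f) z\<bar> \<le> M * L * B" if "antiper f" "\<And>z. \<bar>f z\<bar> \<le> B" for f B z
    using antiper_opD(3)[OF S antiper_opD(2)[OF T that(1)] antiper_opD(3)[OF T that]] by (simp add: mult.assoc)
  show "S (T (\<lambda>z. a * f z + b * g z)) z = a * S (T f) z + b * S (T g) z"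
    if "antiper f" "antiper g" for f g a b z
    using antiper_opD(4)[OF T that] antiper_opD(4)[OF S antiper_opD(2)[OF T that(1)] antiper_opD(2)[OF T that(2)]] by simp
qed

lemma antiper_op_lin:
  assumes S: "antiper_op S M" and T: "antiper_op T L"
  shows "antiper_op (\<lambda>f z. a * S f z + b * T f z) (\<bar>a\<bar> * M + \<bar>b\<bar> * L)"
proof (rule antiper_opI)
  show "0 \<le> \<bar>a\<bar> * M + \<bar>b\<bar> * L" using antiper_opD(1)[OF S] antiper_opD(1)[OF T] by simp
  show "antiper (\<lambda>z. a * S f z + b * T f z)" if "antiper f" for f
    using that antiper_opD(2)[OF S] antiper_opD(2)[OF T] by (intro antiper_lin) auto
  show "\<bar>a * S f z + b * T f z\<bar> \<le> (\<bar>a\<bar> * M + \<bar>b\<bar> * L) * B"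
    if "antiper f" "\<And>z. \<bar>f z\<bar> \<le> B" for f B z
  proof -
    have "\<bar>a * S f z + b * T f z\<bar> \<le> \<bar>a\<bar> * \<bar>S f z\<bar> + \<bar>b\<bar> * \<bar>T f z\<bar>"
      using abs_triangle_ineq[of "a * S f z" "b * T f z"] by (simp add: abs_mult)
    also have "\<dots> \<le> \<bar>a\<bar> * (M * B) + \<bar>b\<bar> * (L * B)"
      using antiper_opD(3)[OF S that] antiper_opD(3)[OF T that] by (intro add_mono mult_left_mono) auto
    finally show ?thesis by (simp add: algebra_simps)
  qed
  show "a * S (\<lambda>z. a' * f z + b' * g z) z + b * T (\<lambda>z. a' * f z + b' * g z) z =
      a' * (a * S f z + b * T f z) + b' * (a * S g z + b * T g z)"
    if "antiper f" "antiper g" for f g a' b' z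
    using antiper_opD(4)[OF T that] antiper_opD(4)[OF S that] by (simp add: algebra_simps)
qed

lemma antiper_op_id: "antiper_op (\<lambda>f. f) 1"
  by (rule antiper_opI) auto

lemma antiper_op_mono: "antiper_op T M \<Longrightarrow> M \<le> L \<Longrightarrow> antiper_op T L"
proof -
  assume T: "antiper_op T M" and le: "M \<le> L"
  show "antiper_op T L"
  proof (rule antiper_opI)
    show "\<bar>T f z\<bar> \<le> L * B" if "antiper f" "\<And>z. \<bar>f z\<bar> \<le> B" for f B z
    proof -
      have "0 \<le> B" using that(2)[of 0] by linarith
      then show ?thesis
        using antiper_opD(3)[OF T that, of z] mult_right_mono[OF le] by (meson order_trans)
    qed
  qed (use antiper_opD[OF T] le in auto)
qed

lemma antiper_op_mult:
  assumes "continuous_on UNIV p" "periodic_2pi p" "\<And>z. \<bar>p z\<bar> \<le> M"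
  shows "antiper_op (\<lambda>f z. p z * f z) M"
proof (rule antiper_opI)
  show "0 \<le> M" using assms(3)[of 0] by linarith
  show "antiper (\<lambda>z. p z * f z)" if "antiper f" for f
    using antiper_mult that assms by blast
  show "\<bar>p z * f z\<bar> \<le> M * B" if "antiper f" "\<And>z. \<bar>f z\<bar> \<le> B" for f B z
    unfolding abs_mult using assms(3)[of z] that(2)[of z] by (intro mult_mono) auto
qed (simp add: algebra_simps)

lemma antiper_op_anti_int: "antiper_op anti_int pi"
proof (rule antiper_opI)
  show "\<bar>anti_int f z\<bar> \<le> pi * B" if f: "antiper f" "\<And>z. \<bar>f z\<bar> \<le> B" for f B z
  proof -
    \<comment> \<open>An antiperiodic primitive F has increment F (z + 2 pi) - F z = - 2 F z over a
      period; hence the norm bound pi.\<close>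
    have "anti_int f z = - (dint f z (z + 2 * pi)) / 2"
      using antiper_shift[OF anti_int_antiper[OF f(1)], of z] by (simp add: anti_int_def dint_def)
    then show ?thesis
      using dint_bound[OF antiper_cont[OF f(1)] f(2), of z "z + 2 * pi"] by (simp add: mult_ac)
  qed
  show "anti_int (\<lambda>z. a * f z + b * g z) z = a * anti_int f z + b * anti_int g z"
    if "antiper f" "antiper g" for f g a b z
  proof -
    have "anti_int (\<lambda>z. a * f z + b * g z) = (\<lambda>z. a * anti_int f z + b * anti_int g z)"
      by (rule anti_int_unique) (use that in \<open>auto intro!: antiper_lin anti_int_antiper derivative_eq_intros anti_int_deriv\<close>)
    then show ?thesis by simp
  qed
qed (use anti_int_antiper in auto)

text \<open>Banach's fixed point theorem in the closed subspace of antiperiodic functions among the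
  bounded continuous ones.\<close>

lemma antiper_fixed_point:
  assumes T: "antiper_op T M" "M \<le> 1 / 2" and f: "antiper f" "\<And>z. \<bar>f z\<bar> \<le> B"
  obtains w where "antiper w" "\<And>z. w z = f z + T w z" "\<And>z. \<bar>w z\<bar> \<le> 2 * B"
proof -
  let ?S = "{g :: real \<Rightarrow>\<^sub>C real. antiper (apply_bcontfun g)}"
  define \<Phi> where "\<Phi> g = Bcontfun (\<lambda>z. f z + T (apply_bcontfun g) z)" for g
  have bcont: "h \<in> bcontfun" if h: "antiper h" for h
  proof -
    obtain y where "\<And>z. \<bar>h z\<bar> \<le> \<bar>h y\<bar>" using antiper_max[OF h] by blast
    then show ?thesis using antiper_cont[OF h] by (intro bcontfun_normI[of h "\<bar>h y\<bar>"]) auto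
  qed
  have step: "antiper (\<lambda>z. f z + T (apply_bcontfun g) z)" if "g \<in> ?S" for g
    using that f(1) antiper_opD(2)[OF T(1)] by (intro antiper_add) auto
  have app: "apply_bcontfun (\<Phi> g) = (\<lambda>z. f z + T (apply_bcontfun g) z)" if "g \<in> ?S" for g
    unfolding \<Phi>_def by (rule Bcontfun_inverse[OF bcont[OF step[OF that]]])
  have "closed ?S"
  proof -
    have "?S = (\<Inter>z. {g. apply_bcontfun g (z + 2 * pi) = - apply_bcontfun g z})"
      by (auto simp: antiper_def)
    moreover have "closed {g :: real \<Rightarrow>\<^sub>C real. apply_bcontfun g (z + 2 * pi) = - apply_bcontfun g z}" for z
    proof -
      have c: "continuous_on UNIV (\<lambda>g :: real \<Rightarrow>\<^sub>C real. apply_bcontfun g y)" for y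
        unfolding continuous_on_iff using dist_bounded le_less_trans by blast
      show ?thesis by (intro closed_Collect_eq continuous_intros c)
    qed
    ultimately show ?thesis by (simp add: closed_INT)
  qed
  then have complete: "complete ?S" by (simp add: complete_eq_closed)
  have "\<exists>!g\<in>?S. \<Phi> g = g"
  proof (rule Banach_fix[OF complete])
    show "?S \<noteq> {}" by (auto intro!: exI[of _ 0] simp: antiper_def)
    show "\<Phi> ` ?S \<subseteq> ?S" using app step by auto
    show "dist (\<Phi> g) (\<Phi> h) \<le> (1 / 2) * dist g h" if "g \<in> ?S" "h \<in> ?S" for g h
    proof (rule dist_bound)
      fix z
      have gh: "antiper (\<lambda>z. g z - h z)" using that by (intro antiper_diff) auto
      have "\<bar>g y - h y\<bar> \<le> dist g h" for y
        using dist_bounded[of g y h] by (simp add: dist_real_def)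
      from antiper_opD(3)[OF T(1) gh this, of z]
      have "\<bar>T (\<lambda>y. g y - h y) z\<bar> \<le> M * dist g h" .
      also have "\<dots> \<le> (1 / 2) * dist g h" using T(2) by (intro mult_right_mono) auto
      finally show "dist (\<Phi> g z) (\<Phi> h z) \<le> (1 / 2) * dist g h"
        using that antiper_op_diff[OF T(1), of g h] by (simp add: app dist_real_def)
    qed
  qed auto
  then obtain g where g: "g \<in> ?S" "\<Phi> g = g" by blast
  define w where "w = apply_bcontfun g"
  have w: "antiper w" using g by (simp add: w_def)
  have eq: "w z = f z + T w z" for z using app[OF g(1)] g(2) unfolding w_def by metis
  have "\<bar>w z\<bar> \<le> D / 2 + B" if "\<And>z. \<bar>w z\<bar> \<le> D" for D z
  proof -
    have "0 \<le> D" using that[of 0] by linarith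
    have "\<bar>T w z\<bar> \<le> M * D" by (rule antiper_opD(3)[OF T(1) w that])
    also have "\<dots> \<le> (1 / 2) * D" using T(2) \<open>0 \<le> D\<close> by (intro mult_right_mono) auto
    finally show ?thesis using eq[of z] f(2)[of z] by linarith
  qed
  from antiper_absorb_bound[OF w this] that[OF w eq] show thesis by blast
qed

text \<open>Supplies the two quantitative facts needed later: \<open>w \<kappa>\<close> stays close
  to the mode \<open>f\<close>, and it is Lipschitz in \<kappa>, from which continuity of the
  determinant follows.\<close>

lemma fixed_point_family:
  assumes A: "antiper_op A m" and B: "antiper_op B n" and K: "0 \<le> K" "m + K * n \<le> 1 / 2"
    and f: "antiper f" "\<And>z. \<bar>f z\<bar> \<le> 1"
  obtains w where "\<And>\<kappa>. \<kappa> \<in> {0..K} \<Longrightarrow> antiper (w \<kappa>)"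
    "\<And>\<kappa> z. \<kappa> \<in> {0..K} \<Longrightarrow> w \<kappa> z = f z + (A (w \<kappa>) z + \<kappa> * B (w \<kappa>) z)"
    "\<And>\<kappa> z. \<kappa> \<in> {0..K} \<Longrightarrow> \<bar>w \<kappa> z\<bar> \<le> 2"
    "\<And>\<kappa> z. \<kappa> \<in> {0..K} \<Longrightarrow> \<bar>w \<kappa> z - f z\<bar> \<le> 2 * (m + K * n)"
    "\<And>\<kappa> \<kappa>' z. \<kappa> \<in> {0..K} \<Longrightarrow> \<kappa>' \<in> {0..K} \<Longrightarrow> \<bar>w \<kappa> z - w \<kappa>' z\<bar> \<le> 4 * n * \<bar>\<kappa> - \<kappa>'\<bar>"
proof -
  have n0: "0 \<le> n" using antiper_opD(1)[OF B] .
  have T: "antiper_op (\<lambda>f z. A f z + \<kappa> * B f z) (m + K * n)" if "\<kappa> \<in> {0..K}" for \<kappa>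
  proof -
    have "\<bar>1\<bar> * m + \<bar>\<kappa>\<bar> * n \<le> m + K * n" using that n0 by (auto intro: mult_right_mono)
    from antiper_op_mono[OF antiper_op_lin[OF A B] this] show ?thesis by simp
  qed
  have "\<exists>w. antiper w \<and> (\<forall>z. w z = f z + (A w z + \<kappa> * B w z)) \<and> (\<forall>z. \<bar>w z\<bar> \<le> 2)"
    if "\<kappa> \<in> {0..K}" for \<kappa>
    using antiper_fixed_point[OF T[OF that] K(2) f] by (metis mult.right_neutral)
  then obtain w where w: "\<And>\<kappa>. \<kappa> \<in> {0..K} \<Longrightarrow> antiper (w \<kappa>)"
    "\<And>\<kappa> z. \<kappa> \<in> {0..K} \<Longrightarrow> w \<kappa> z = f z + (A (w \<kappa>) z + \<kappa> * B (w \<kappa>) z)"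
    "\<And>\<kappa> z. \<kappa> \<in> {0..K} \<Longrightarrow> \<bar>w \<kappa> z\<bar> \<le> 2" by metis
  have "\<bar>w \<kappa> z - f z\<bar> \<le> 2 * (m + K * n)" if \<kappa>: "\<kappa> \<in> {0..K}" for \<kappa> z
    using antiper_opD(3)[OF T[OF \<kappa>] w(1)[OF \<kappa>] w(3)[OF \<kappa>], of z] w(2)[OF \<kappa>, of z]
    by (simp add: mult.commute)
  moreover have "\<bar>w \<kappa> z - w \<kappa>' z\<bar> \<le> 4 * n * \<bar>\<kappa> - \<kappa>'\<bar>"
    if \<kappa>: "\<kappa> \<in> {0..K}" and \<kappa>': "\<kappa>' \<in> {0..K}" for \<kappa> \<kappa>' z
  proof -
    let ?d = "\<lambda>z. w \<kappa> z - w \<kappa>' z"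
    have d: "antiper ?d" using w(1) \<kappa> \<kappa>' by (intro antiper_diff)
    have "\<bar>?d z\<bar> \<le> D / 2 + 2 * n * \<bar>\<kappa> - \<kappa>'\<bar>" if D: "\<And>z. \<bar>?d z\<bar> \<le> D" for D z
    proof -
      have "0 \<le> D" using D[of 0] by linarith
      \<comment> \<open>The difference solves the same fixed point equation with source (\<kappa> -
        \<kappa>') B (w \<kappa>'), which is at most 2 n |\<kappa> - \<kappa>'|; absorbing the
        contraction doubles this.\<close>
      have "?d z = (A (w \<kappa>) z - A (w \<kappa>') z) + \<kappa> * (B (w \<kappa>) z - B (w \<kappa>') z) + (\<kappa> - \<kappa>') * B (w \<kappa>') z"
        by (subst w(2)[OF \<kappa>], subst w(2)[OF \<kappa>']) (simp add: algebra_simps)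
      also have "\<dots> = (A ?d z + \<kappa> * B ?d z) + (\<kappa> - \<kappa>') * B (w \<kappa>') z"
        using antiper_op_diff[OF A w(1)[OF \<kappa>] w(1)[OF \<kappa>']] antiper_op_diff[OF B w(1)[OF \<kappa>] w(1)[OF \<kappa>']] by simp
      finally have "\<bar>?d z\<bar> \<le> \<bar>A ?d z + \<kappa> * B ?d z\<bar> + \<bar>\<kappa> - \<kappa>'\<bar> * \<bar>B (w \<kappa>') z\<bar>"
        by (metis abs_mult abs_triangle_ineq)
      moreover have "\<bar>A ?d z + \<kappa> * B ?d z\<bar> \<le> D / 2"
        using antiper_opD(3)[OF T[OF \<kappa>] d D, of z] mult_right_mono[OF K(2) \<open>0 \<le> D\<close>] by linarith
      moreover have "\<bar>\<kappa> - \<kappa>'\<bar> * \<bar>B (w \<kappa>') z\<bar> \<le> \<bar>\<kappa> - \<kappa>'\<bar> * (n * 2)"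
        using antiper_opD(3)[OF B w(1)[OF \<kappa>'] w(3)[OF \<kappa>']] by (intro mult_left_mono) auto
      ultimately show ?thesis by (simp add: mult_ac)
    qed
    from antiper_absorb_bound[OF d this, of z] show ?thesis by (simp add: mult_ac)
  qed
  ultimately show thesis using that w by blast
qed

text \<open>Unnormalised: cos (z/2)^2 has integral pi over a period, so the Fourier coefficient of
  the mode is \<open>cos_coeff f / pi\<close>.\<close>

definition cos_coeff :: "(real \<Rightarrow> real) \<Rightarrow> real" where
  "cos_coeff f = dint (\<lambda>t. f t * cos (t / 2)) 0 (2 * pi)"

definition sin_coeff :: "(real \<Rightarrow> real) \<Rightarrow> real" where
  "sin_coeff f = dint (\<lambda>t. f t * sin (t / 2)) 0 (2 * pi)"

lemma cos_coeff_lin: "antiper f \<Longrightarrow> antiper g \<Longrightarrow> cos_coeff (\<lambda>z. a * f z + b * g z) = a * cos_coeff f + b * cos_coeff g"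
  unfolding cos_coeff_def
  by (subst dint_linear[symmetric]) (auto simp: algebra_simps antiper_def intro!: continuous_intros)

lemma sin_coeff_lin: "antiper f \<Longrightarrow> antiper g \<Longrightarrow> sin_coeff (\<lambda>z. a * f z + b * g z) = a * sin_coeff f + b * sin_coeff g"
  unfolding sin_coeff_def
  by (subst dint_linear[symmetric]) (auto simp: algebra_simps antiper_def intro!: continuous_intros)

lemma abs_mult_le_one: "\<bar>x\<bar> \<le> B \<Longrightarrow> \<bar>y\<bar> \<le> 1 \<Longrightarrow> \<bar>x * y\<bar> \<le> (B::real)"
  using mult_mono[of "\<bar>x\<bar>" B "\<bar>y\<bar>" 1] by (simp add: abs_mult)

lemma abs_mult_le_one': "\<bar>x\<bar> \<le> 1 \<Longrightarrow> \<bar>y\<bar> \<le> B \<Longrightarrow> \<bar>x * y\<bar> \<le> (B::real)"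
  using abs_mult_le_one[of y B x] by (simp add: mult.commute)

lemma cos_coeff_bound: "antiper f \<Longrightarrow> (\<And>z. \<bar>f z\<bar> \<le> B) \<Longrightarrow> \<bar>cos_coeff f\<bar> \<le> 2 * pi * B"
proof -
  assume f: "antiper f" "\<And>z. \<bar>f z\<bar> \<le> B"
  have "continuous_on UNIV (\<lambda>t. f t * cos (t / 2))"
    using f(1) by (auto simp: antiper_def intro!: continuous_intros)
  moreover have "\<bar>f t * cos (t / 2)\<bar> \<le> B" for t using f(2) by (intro abs_mult_le_one) auto
  ultimately show "\<bar>cos_coeff f\<bar> \<le> 2 * pi * B"
    unfolding cos_coeff_def using dint_bound[of "\<lambda>t. f t * cos (t / 2)" B 0 "2 * pi"] by (simp add: mult.commute)
qed

lemma sin_coeff_bound: "antiper f \<Longrightarrow> (\<And>z. \<bar>f z\<bar> \<le> B) \<Longrightarrow> \<bar>sin_coeff f\<bar> \<le> 2 * pi * B"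
proof -
  assume f: "antiper f" "\<And>z. \<bar>f z\<bar> \<le> B"
  have "continuous_on UNIV (\<lambda>t. f t * sin (t / 2))"
    using f(1) by (auto simp: antiper_def intro!: continuous_intros)
  moreover have "\<bar>f t * sin (t / 2)\<bar> \<le> B" for t using f(2) by (intro abs_mult_le_one) auto
  ultimately show "\<bar>sin_coeff f\<bar> \<le> 2 * pi * B"
    unfolding sin_coeff_def using dint_bound[of "\<lambda>t. f t * sin (t / 2)" B 0 "2 * pi"] by (simp add: mult.commute)
qed

lemma dint_trig:
  "dint (\<lambda>t. cos (t / 2) * cos (t / 2)) 0 (2 * pi) = pi"
  "dint (\<lambda>t. sin (t / 2) * sin (t / 2)) 0 (2 * pi) = pi"
  "dint (\<lambda>t. sin (t / 2) * cos (t / 2)) 0 (2 * pi) = 0"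
  "dint (\<lambda>t. cos (t / 2) * sin (t / 2)) 0 (2 * pi) = 0"
  "dint (\<lambda>t. cos (3 * t / 2) * cos (t / 2)) 0 (2 * pi) = 0"
  "dint (\<lambda>t. cos (3 * t / 2) * sin (t / 2)) 0 (2 * pi) = 0"
  "dint (\<lambda>t. sin (3 * t / 2) * cos (t / 2)) 0 (2 * pi) = 0"
  "dint (\<lambda>t. sin (3 * t / 2) * sin (t / 2)) 0 (2 * pi) = 0"
proof -
  have e: "3 * t / 2 - t / 2 = t" "3 * t / 2 + t / 2 = 2 * t" "t / 2 + t / 2 = t" for t :: real by simp_all
  note ts = cos_times_cos sin_times_sin sin_times_cos cos_times_sin
  have D: "dint f 0 (2 * pi) = F (2 * pi) - F 0" if "\<And>x. (F has_real_derivative f x) (at x)" for F f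
    using dint_eq[OF that] .
  show "dint (\<lambda>t. cos (t / 2) * cos (t / 2)) 0 (2 * pi) = pi"
    by (subst D[of "\<lambda>t. t / 2 + sin t / 2"]) (auto simp: ts e intro!: derivative_eq_intros)
  show "dint (\<lambda>t. sin (t / 2) * sin (t / 2)) 0 (2 * pi) = pi"
    by (subst D[of "\<lambda>t. t / 2 - sin t / 2"]) (auto simp: ts e intro!: derivative_eq_intros)
  show "dint (\<lambda>t. sin (t / 2) * cos (t / 2)) 0 (2 * pi) = 0"
    by (subst D[of "\<lambda>t. - cos t / 2"]) (auto simp: ts e intro!: derivative_eq_intros)
  show "dint (\<lambda>t. cos (t / 2) * sin (t / 2)) 0 (2 * pi) = 0"
    by (subst D[of "\<lambda>t. - cos t / 2"]) (auto simp: ts e intro!: derivative_eq_intros)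
  have p: "sin (4 * pi) = 0" "cos (4 * pi) = 1" using sin_npi[of 4] cos_npi[of 4] by simp_all
  show "dint (\<lambda>t. cos (3 * t / 2) * cos (t / 2)) 0 (2 * pi) = 0"
    by (subst D[of "\<lambda>t. sin t / 2 + sin (2 * t) / 4"]) (auto simp: ts e p intro!: derivative_eq_intros)
  show "dint (\<lambda>t. cos (3 * t / 2) * sin (t / 2)) 0 (2 * pi) = 0"
    by (subst D[of "\<lambda>t. cos t / 2 - cos (2 * t) / 4"]) (auto simp: ts e p intro!: derivative_eq_intros)
  show "dint (\<lambda>t. sin (3 * t / 2) * cos (t / 2)) 0 (2 * pi) = 0"
    by (subst D[of "\<lambda>t. - cos t / 2 - cos (2 * t) / 4"]) (auto simp: ts e p intro!: derivative_eq_intros)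
  show "dint (\<lambda>t. sin (3 * t / 2) * sin (t / 2)) 0 (2 * pi) = 0"
    by (subst D[of "\<lambda>t. sin t / 2 - sin (2 * t) / 4"]) (auto simp: ts e p intro!: derivative_eq_intros)
qed

lemma cos_coeff_trig [simp]:
  "cos_coeff (\<lambda>t. cos (t / 2)) = pi" "cos_coeff (\<lambda>t. sin (t / 2)) = 0"
  "cos_coeff (\<lambda>t. cos (3 * t / 2)) = 0" "cos_coeff (\<lambda>t. sin (3 * t / 2)) = 0"
  by (simp_all add: cos_coeff_def dint_trig)

lemma sin_coeff_trig [simp]:
  "sin_coeff (\<lambda>t. sin (t / 2)) = pi" "sin_coeff (\<lambda>t. cos (t / 2)) = 0"
  "sin_coeff (\<lambda>t. cos (3 * t / 2)) = 0" "sin_coeff (\<lambda>t. sin (3 * t / 2)) = 0"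
  by (simp_all add: sin_coeff_def dint_trig)

text \<open>The identity minus the L^2-orthogonal projection onto the two resonant modes.\<close>

definition nonresonant_part :: "(real \<Rightarrow> real) \<Rightarrow> real \<Rightarrow> real" where
  "nonresonant_part f z = f z - (cos_coeff f / pi * cos (z / 2) + sin_coeff f / pi * sin (z / 2))"

lemma nonresonant_part_antiper: "antiper f \<Longrightarrow> antiper (nonresonant_part f)"
  unfolding nonresonant_part_def by (intro antiper_diff antiper_lin antiper_cos antiper_sin)

text \<open>The bound is 1 + 2 + 2: each coefficient is at most 2 pi B and is divided by pi.\<close>

lemma antiper_op_nonresonant_part: "antiper_op nonresonant_part 5"
proof (rule antiper_opI)
  show "\<bar>nonresonant_part f z\<bar> \<le> 5 * B" if f: "antiper f" "\<And>z. \<bar>f z\<bar> \<le> B" for f B z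
  proof -
    have "\<bar>cos_coeff f / pi * cos (z / 2)\<bar> \<le> 2 * B" "\<bar>sin_coeff f / pi * sin (z / 2)\<bar> \<le> 2 * B"
      using cos_coeff_bound[OF f] sin_coeff_bound[OF f]
      by (intro abs_mult_le_one; simp add: abs_mult divide_le_eq mult_ac)+
    then show ?thesis using f(2)[of z] unfolding nonresonant_part_def by linarith
  qed
  show "nonresonant_part (\<lambda>z. a * f z + b * g z) z = a * nonresonant_part f z + b * nonresonant_part g z" if "antiper f" "antiper g" for f g a b z
    using that by (simp add: nonresonant_part_def cos_coeff_lin sin_coeff_lin field_simps)
qed (auto intro: nonresonant_part_antiper)

lemma nonresonant_part_orth: assumes "antiper f" shows "cos_coeff (nonresonant_part f) = 0" "sin_coeff (nonresonant_part f) = 0"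
proof -
  let ?g = "\<lambda>z. cos_coeff f / pi * cos (z / 2) + sin_coeff f / pi * sin (z / 2)"
  have g: "antiper ?g" by (intro antiper_lin antiper_cos antiper_sin)
  have Q: "nonresonant_part f = (\<lambda>z. 1 * f z + (-1) * ?g z)" by (simp add: nonresonant_part_def fun_eq_iff)
  have "cos_coeff ?g = cos_coeff f" "sin_coeff ?g = sin_coeff f"
    unfolding cos_coeff_lin[OF antiper_cos antiper_sin] sin_coeff_lin[OF antiper_cos antiper_sin] by simp_all
  then show "cos_coeff (nonresonant_part f) = 0" "sin_coeff (nonresonant_part f) = 0"
    unfolding Q cos_coeff_lin[OF assms g] sin_coeff_lin[OF assms g] by simp_all
qed

section \<open>Green's functions\<close>

text \<open>The antiperiodic solution of \<open>u'' + s\<^sup>2 u = f\<close>, namely the integral over \<open>t \<in> [z, z + 2\<pi>]\<close> of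
  \<open>sin (s (t - z - \<pi>)) f t / (2 s cos (s \<pi>))\<close> with the sine expanded.\<close>

definition green :: "real \<Rightarrow> (real \<Rightarrow> real) \<Rightarrow> real \<Rightarrow> real" where
  "green s f z = (cos (s * (z + pi)) * dint (\<lambda>t. sin (s * t) * f t) z (z + 2 * pi)
      - sin (s * (z + pi)) * dint (\<lambda>t. cos (s * t) * f t) z (z + 2 * pi)) / (2 * s * cos (s * pi))"

text \<open>The z-derivative of \<open>green s f\<close> with the window integrals held fixed; the
  contributions of the moving endpoints cancel by \<open>endpoint_identities\<close>.\<close>

definition green' :: "real \<Rightarrow> (real \<Rightarrow> real) \<Rightarrow> real \<Rightarrow> real" where
  "green' s f z = - s * (sin (s * (z + pi)) * dint (\<lambda>t. sin (s * t) * f t) z (z + 2 * pi)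
      + cos (s * (z + pi)) * dint (\<lambda>t. cos (s * t) * f t) z (z + 2 * pi)) / (2 * s * cos (s * pi))"

lemma dint_shift:
  assumes "continuous_on UNIV g" shows "dint g (a + p) (b + p) = dint (\<lambda>t. g (t + p)) a b"
proof -
  have "((\<lambda>z. prim g (z + p)) has_real_derivative g (x + p)) (at x)" for x
    using assms by (auto intro!: derivative_eq_intros)
  from dint_eq[OF this] show ?thesis by (simp add: dint_def)
qed

context
  fixes s :: real and f :: "real \<Rightarrow> real"
  assumes s: "s \<noteq> 0" "cos (s * pi) \<noteq> 0" and f: "antiper f"
begin

lemma cont_trig_mult:
  "continuous_on UNIV (\<lambda>t. sin (s * t) * f t)" "continuous_on UNIV (\<lambda>t. cos (s * t) * f t)"
  using f by (auto simp: antiper_def intro!: continuous_intros)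

text \<open>By the addition formulas, moving the window by one period rotates the pair of integrals
  by the angle 2 pi s; the minus sign is the antiperiodicity of \<open>f\<close>.\<close>

lemma dint_period_shift:
  "dint (\<lambda>t. sin (s * t) * f t) (z + 2 * pi) (z + 2 * pi + 2 * pi) =
    - (cos (2 * pi * s) * dint (\<lambda>t. sin (s * t) * f t) z (z + 2 * pi)
       + sin (2 * pi * s) * dint (\<lambda>t. cos (s * t) * f t) z (z + 2 * pi))"
  "dint (\<lambda>t. cos (s * t) * f t) (z + 2 * pi) (z + 2 * pi + 2 * pi) =
    - (cos (2 * pi * s) * dint (\<lambda>t. cos (s * t) * f t) z (z + 2 * pi)
       - sin (2 * pi * s) * dint (\<lambda>t. sin (s * t) * f t) z (z + 2 * pi))"
proof -
  have 1: "(\<lambda>t. sin (s * (t + 2 * pi)) * f (t + 2 * pi)) =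
     (\<lambda>t. (- cos (2 * pi * s)) * (sin (s * t) * f t) + (- sin (2 * pi * s)) * (cos (s * t) * f t))"
    using antiper_shift[OF f] by (simp add: fun_eq_iff sin_add algebra_simps)
  have 2: "(\<lambda>t. cos (s * (t + 2 * pi)) * f (t + 2 * pi)) =
     (\<lambda>t. (- cos (2 * pi * s)) * (cos (s * t) * f t) + sin (2 * pi * s) * (sin (s * t) * f t))"
    using antiper_shift[OF f] by (simp add: fun_eq_iff cos_add algebra_simps)
  show "dint (\<lambda>t. sin (s * t) * f t) (z + 2 * pi) (z + 2 * pi + 2 * pi) =
    - (cos (2 * pi * s) * dint (\<lambda>t. sin (s * t) * f t) z (z + 2 * pi)
       + sin (2 * pi * s) * dint (\<lambda>t. cos (s * t) * f t) z (z + 2 * pi))"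
    unfolding dint_shift[OF cont_trig_mult(1)] 1 dint_linear[OF cont_trig_mult] by simp
  show "dint (\<lambda>t. cos (s * t) * f t) (z + 2 * pi) (z + 2 * pi + 2 * pi) =
    - (cos (2 * pi * s) * dint (\<lambda>t. cos (s * t) * f t) z (z + 2 * pi)
       - sin (2 * pi * s) * dint (\<lambda>t. sin (s * t) * f t) z (z + 2 * pi))"
    unfolding dint_shift[OF cont_trig_mult(2)] 2 dint_linear[OF cont_trig_mult(2,1)] by simp
qed

text \<open>The outer factors cos, sin of s (z + pi) rotate by the same angle as the pair of
  integrals, so the two combinations in \<open>green\<close> and \<open>green'\<close> are preserved
  up to the sign.\<close>

lemma rotation_algebra:
  fixes C S c s' X Y :: real
  assumes "c * c + s' * s' = 1"
  shows "(C * c - S * s') * - (c * X + s' * Y) - (S * c + C * s') * - (c * Y - s' * X) = - (C * X - S * Y)"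
    "(S * c + C * s') * - (c * X + s' * Y) + (C * c - S * s') * - (c * Y - s' * X) = - (S * X + C * Y)"
  using assms by algebra+

lemma green_shift: "green s f (z + 2 * pi) = - green s f z" "green' s f (z + 2 * pi) = - green' s f z"
proof -
  have a: "s * (z + 2 * pi + pi) = s * (z + pi) + 2 * pi * s" by (simp add: algebra_simps)
  have one: "cos (2 * pi * s) * cos (2 * pi * s) + sin (2 * pi * s) * sin (2 * pi * s) = 1"
    using sin_cos_squared_add3 by blast
  show "green s f (z + 2 * pi) = - green s f z"
    unfolding green_def dint_period_shift a cos_add[of "s * (z + pi)"] sin_add[of "s * (z + pi)"]
      rotation_algebra(1)[OF one] by (rule minus_divide_left[symmetric])
  show "green' s f (z + 2 * pi) = - green' s f z"
    unfolding green'_def dint_period_shift a cos_add[of "s * (z + pi)"] sin_add[of "s * (z + pi)"]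
      rotation_algebra(2)[OF one] by (simp only: mult_minus_right minus_divide_left)
qed

text \<open>With a = s (z + pi), the endpoints correspond to a - s pi and a + s pi, so the sums in
  brackets are 2 cos (s pi) sin a and 2 cos (s pi) cos a. Hence the endpoint terms cancel in the
  derivative of \<open>green\<close>, and in that of \<open>green'\<close> they leave exactly
  \<open>f\<close> after division by the denominator.\<close>

lemma endpoint_identities:
  "cos (s * (z + pi)) * (sin (s * (z + 2 * pi)) + sin (s * z))
     - sin (s * (z + pi)) * (cos (s * (z + 2 * pi)) + cos (s * z)) = 0"
  "sin (s * (z + pi)) * (sin (s * (z + 2 * pi)) + sin (s * z))
     + cos (s * (z + pi)) * (cos (s * (z + 2 * pi)) + cos (s * z)) = 2 * cos (s * pi)"
proof -
  have e: "s * (z + 2 * pi) = s * (z + pi) + s * pi" "s * z = s * (z + pi) - s * pi"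
    by (simp_all add: algebra_simps)
  have "sin (s * (z + pi)) * sin (s * (z + pi)) + cos (s * (z + pi)) * cos (s * (z + pi)) = 1"
    by (metis add.commute sin_cos_squared_add3)
  then have "x * (sin (s * (z + pi)) * sin (s * (z + pi))) + x * (cos (s * (z + pi)) * cos (s * (z + pi))) = x" for x
    by (metis distrib_left mult.right_neutral)
  from this[of "2 * cos (s * pi)"]
  show "cos (s * (z + pi)) * (sin (s * (z + 2 * pi)) + sin (s * z))
     - sin (s * (z + pi)) * (cos (s * (z + 2 * pi)) + cos (s * z)) = 0"
  "sin (s * (z + pi)) * (sin (s * (z + 2 * pi)) + sin (s * z))
     + cos (s * (z + pi)) * (cos (s * (z + 2 * pi)) + cos (s * z)) = 2 * cos (s * pi)"
    unfolding e(1) unfolding e(2) sin_add sin_diff cos_add[of "s * (z + pi)"] cos_diff[of "s * (z + pi)"]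
    by (simp_all add: algebra_simps)
qed

lemma dint_window_deriv:
  "((\<lambda>z. dint (\<lambda>t. sin (s * t) * f t) z (z + 2 * pi)) has_real_derivative
      - f z * (sin (s * (z + 2 * pi)) + sin (s * z))) (at z)"
  "((\<lambda>z. dint (\<lambda>t. cos (s * t) * f t) z (z + 2 * pi)) has_real_derivative
      - f z * (cos (s * (z + 2 * pi)) + cos (s * z))) (at z)"
proof -
  have deriv: "((\<lambda>z. dint g z (z + 2 * pi)) has_real_derivative g (z + 2 * pi) * 1 - g z * 1) (at z)"
    if "continuous_on UNIV g" for g
    unfolding dint_def using that by (auto intro!: derivative_eq_intros)
  have e: "x * - f z * 1 - y * f z * 1 = - f z * (x + y)" for x y by algebra
  from deriv[OF cont_trig_mult(1)] deriv[OF cont_trig_mult(2)] show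
    "((\<lambda>z. dint (\<lambda>t. sin (s * t) * f t) z (z + 2 * pi)) has_real_derivative
        - f z * (sin (s * (z + 2 * pi)) + sin (s * z))) (at z)"
    "((\<lambda>z. dint (\<lambda>t. cos (s * t) * f t) z (z + 2 * pi)) has_real_derivative
        - f z * (cos (s * (z + 2 * pi)) + cos (s * z))) (at z)"
    unfolding antiper_shift[OF f] e .
qed

lemma green_deriv: "(green s f has_real_derivative green' s f z) (at z)"
proof -
  have "(green s f has_real_derivative
     ((- s * sin (s * (z + pi))) * dint (\<lambda>t. sin (s * t) * f t) z (z + 2 * pi)
       + cos (s * (z + pi)) * (- f z * (sin (s * (z + 2 * pi)) + sin (s * z)))
      - ((s * cos (s * (z + pi))) * dint (\<lambda>t. cos (s * t) * f t) z (z + 2 * pi)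
       + sin (s * (z + pi)) * (- f z * (cos (s * (z + 2 * pi)) + cos (s * z)))))
        / (2 * s * cos (s * pi))) (at z)" (is "(_ has_real_derivative ?D) _")
    unfolding green_def
    by (rule DERIV_cdivide) (rule derivative_eq_intros dint_window_deriv refl | simp)+
  also have "?D = green' s f z"
  proof -
    have "(- s * S) * X + C * (- F * P) - ((s * C) * Y + S * (- F * Q)) = - s * (S * X + C * Y)"
      if "C * P - S * Q = 0" for S C X Y F P Q :: real
      using that by algebra
    from this[OF endpoint_identities(1)[of z]] show ?thesis unfolding green'_def by simp
  qed
  finally show ?thesis .
qed

lemma green'_deriv: "(green' s f has_real_derivative f z - s\<^sup>2 * green s f z) (at z)"
proof -
  have "(green' s f has_real_derivative
     - s * ((s * cos (s * (z + pi))) * dint (\<lambda>t. sin (s * t) * f t) z (z + 2 * pi)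
       + sin (s * (z + pi)) * (- f z * (sin (s * (z + 2 * pi)) + sin (s * z)))
      + ((- s * sin (s * (z + pi))) * dint (\<lambda>t. cos (s * t) * f t) z (z + 2 * pi)
       + cos (s * (z + pi)) * (- f z * (cos (s * (z + 2 * pi)) + cos (s * z)))))
        / (2 * s * cos (s * pi))) (at z)" (is "(_ has_real_derivative ?D) _")
    unfolding green'_def
    by (rule DERIV_cdivide, rule DERIV_cmult) (rule derivative_eq_intros dint_window_deriv refl | simp)+
  also have "?D = f z - s\<^sup>2 * green s f z"
  proof -
    have "- s * ((s * C) * X + S * (- F * P) + ((- s * S) * Y + C * (- F * Q)))
        = F * (2 * s * cos (s * pi)) - s\<^sup>2 * (C * X - S * Y)"
      if "S * P + C * Q = 2 * cos (s * pi)" for S C X Y F P Q :: real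
      using that by algebra
    note num = this[OF endpoint_identities(2)[of z]]
    have "(F * d - a * W) / d = F - a * (W / d)" if "d \<noteq> 0" for F d a W :: real
      using that by (simp add: field_simps)
    then show ?thesis unfolding green_def num using s by simp
  qed
  finally show ?thesis .
qed

lemma green_antiper: "antiper (green s f)" "antiper (green' s f)"
  unfolding antiper_def using green_shift
    DERIV_continuous_on[OF has_field_derivative_at_within[OF green_deriv], of UNIV]
    DERIV_continuous_on[OF has_field_derivative_at_within[OF green'_deriv], of UNIV]
  by blast+

text \<open>For u = \<open>green s f\<close> one has u'' = f - s^2 u, so two antiderivatives of v =
  f - s^2 u return u. Thus v solves (1 + s^2 J) v = f, where J = \<open>anti_int\<close> applied
  twice.\<close>

lemma green_inverse: "f z - s\<^sup>2 * green s f z + s\<^sup>2 * anti_int (anti_int (\<lambda>z. f z - s\<^sup>2 * green s f z)) z = f z"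
proof -
  have "antiper (\<lambda>z. f z - s\<^sup>2 * green s f z)" by (intro antiper_diff antiper_scale f green_antiper)
  from anti_int_unique[OF green_antiper(2) green'_deriv this] anti_int_unique[OF green_antiper(1) green_deriv green_antiper(2)]
  show ?thesis by simp
qed

end

lemma antiper_op_green:
  assumes s: "s \<noteq> 0" "cos (s * pi) \<noteq> 0"
  shows "antiper_op (green s) (2 * pi / \<bar>s * cos (s * pi)\<bar>)"
proof (rule antiper_opI)
  show "\<bar>green s f z\<bar> \<le> 2 * pi / \<bar>s * cos (s * pi)\<bar> * B" if f: "antiper f" "\<And>z. \<bar>f z\<bar> \<le> B" for f B z
  proof -
    have "\<bar>sin (s * t) * f t\<bar> \<le> B" "\<bar>cos (s * t) * f t\<bar> \<le> B" for t
      using f(2) by (auto intro!: abs_mult_le_one')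
    then have "\<bar>dint (\<lambda>t. sin (s * t) * f t) z (z + 2 * pi)\<bar> \<le> 2 * pi * B"
       "\<bar>dint (\<lambda>t. cos (s * t) * f t) z (z + 2 * pi)\<bar> \<le> 2 * pi * B"
      using dint_bound[OF cont_trig_mult(1)[OF s f(1)], of B z "z + 2 * pi"]
        dint_bound[OF cont_trig_mult(2)[OF s f(1)], of B z "z + 2 * pi"] by (simp_all add: mult.commute)
    then have "\<bar>cos (s * (z + pi)) * dint (\<lambda>t. sin (s * t) * f t) z (z + 2 * pi)\<bar> \<le> 2 * pi * B"
      "\<bar>sin (s * (z + pi)) * dint (\<lambda>t. cos (s * t) * f t) z (z + 2 * pi)\<bar> \<le> 2 * pi * B"
      by (intro abs_mult_le_one'; simp)+
    then have "\<bar>cos (s * (z + pi)) * dint (\<lambda>t. sin (s * t) * f t) z (z + 2 * pi)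
       - sin (s * (z + pi)) * dint (\<lambda>t. cos (s * t) * f t) z (z + 2 * pi)\<bar> \<le> 4 * pi * B" by linarith
    then have "\<bar>green s f z\<bar> \<le> 4 * pi * B / \<bar>2 * s * cos (s * pi)\<bar>"
      unfolding green_def abs_divide by (intro divide_right_mono) auto
    then show ?thesis by (simp add: abs_mult mult_ac)
  qed
  show "green s (\<lambda>z. a * f z + b * g z) z = a * green s f z + b * green s g z"
    if f: "antiper f" and g: "antiper g" for f g a b z
  proof -
    have e: "(\<lambda>t. sin (s * t) * (a * f t + b * g t)) = (\<lambda>t. a * (sin (s * t) * f t) + b * (sin (s * t) * g t))"
      "(\<lambda>t. cos (s * t) * (a * f t + b * g t)) = (\<lambda>t. a * (cos (s * t) * f t) + b * (cos (s * t) * g t))"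
      by (simp_all add: fun_eq_iff algebra_simps)
    show ?thesis
      unfolding green_def e dint_linear[OF cont_trig_mult(1)[OF s f] cont_trig_mult(1)[OF s g]]
        dint_linear[OF cont_trig_mult(2)[OF s f] cont_trig_mult(2)[OF s g]]
      using s by (simp add: field_simps)
  qed
qed (use green_antiper[OF s] in auto)

text \<open>The resonant case \<open>s = 1/2\<close>: variation of constants is antiperiodic when \<open>f\<close> is orthogonal to
  \<open>cos (z / 2)\<close> and \<open>sin (z / 2)\<close>.\<close>

definition green0 :: "(real \<Rightarrow> real) \<Rightarrow> real \<Rightarrow> real" where
  "green0 f z = 2 * (sin (z / 2) * dint (\<lambda>t. f t * cos (t / 2)) 0 z
      - cos (z / 2) * dint (\<lambda>t. f t * sin (t / 2)) 0 z)"

definition green0' :: "(real \<Rightarrow> real) \<Rightarrow> real \<Rightarrow> real" where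
  "green0' f z = cos (z / 2) * dint (\<lambda>t. f t * cos (t / 2)) 0 z
      + sin (z / 2) * dint (\<lambda>t. f t * sin (t / 2)) 0 z"

context
  fixes f :: "real \<Rightarrow> real"
  assumes f: "antiper f"
begin

lemma cont_half_mult:
  "continuous_on UNIV (\<lambda>t. f t * sin (t / 2))" "continuous_on UNIV (\<lambda>t. f t * cos (t / 2))"
  using f by (auto simp: antiper_def intro!: continuous_intros)

lemma dint_half_deriv:
  "((\<lambda>z. dint (\<lambda>t. f t * cos (t / 2)) 0 z) has_real_derivative f z * cos (z / 2)) (at z)"
  "((\<lambda>z. dint (\<lambda>t. f t * sin (t / 2)) 0 z) has_real_derivative f z * sin (z / 2)) (at z)"
  unfolding dint_def by (auto intro!: derivative_eq_intros cont_half_mult)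

lemma half_angle_deriv:
  "((\<lambda>z::real. sin (z / 2)) has_real_derivative cos (z / 2) / 2) (at z)"
  "((\<lambda>z::real. cos (z / 2)) has_real_derivative - sin (z / 2) / 2) (at z)"
  by (auto intro!: derivative_eq_intros)

lemma green0_deriv: "(green0 f has_real_derivative green0' f z) (at z)"
  unfolding green0_def
  by (rule DERIV_cong[OF DERIV_cmult[OF DERIV_diff[OF DERIV_mult[OF half_angle_deriv(1) dint_half_deriv(1)]
          DERIV_mult[OF half_angle_deriv(2) dint_half_deriv(2)]]]])
    (simp add: green0'_def algebra_simps)

lemma green0'_deriv: "(green0' f has_real_derivative f z - 1 / 4 * green0 f z) (at z)"
proof -
  have *: "f z * (cos (z / 2) * cos (z / 2)) + f z * (sin (z / 2) * sin (z / 2)) = f z"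
    by (metis distrib_left mult.right_neutral sin_cos_squared_add3)
  show ?thesis
    unfolding green0'_def
    by (intro DERIV_cong[OF DERIV_add[OF DERIV_mult[OF half_angle_deriv(2) dint_half_deriv(1)]
            DERIV_mult[OF half_angle_deriv(1) dint_half_deriv(2)]]])
      (simp add: green0_def algebra_simps *)
qed

text \<open>The integrands are products of two antiperiodic functions, hence periodic, and the
  vanishing coefficients make their integrals from 0 to z periodic in z. The outer factors then
  carry the antiperiodicity.\<close>

lemma green0_antiper:
  assumes "cos_coeff f = 0" "sin_coeff f = 0" shows "antiper (green0 f)" "antiper (green0' f)"
proof -
  have per: "dint g 0 (z + 2 * pi) = dint g 0 z"
    if "continuous_on UNIV g" "\<And>t. g (t + 2 * pi) = g t" "dint g 0 (2 * pi) = 0" for g z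
    using dint_shift[OF that(1), of 0 "2 * pi" z] that(2,3) by (simp add: dint_def)
  have "dint (\<lambda>t. f t * cos (t / 2)) 0 (z + 2 * pi) = dint (\<lambda>t. f t * cos (t / 2)) 0 z"
    "dint (\<lambda>t. f t * sin (t / 2)) 0 (z + 2 * pi) = dint (\<lambda>t. f t * sin (t / 2)) 0 z" for z
    using antiper_shift[OF f] antiper_shift[OF antiper_cos] antiper_shift[OF antiper_sin] assms
    by (auto intro!: per cont_half_mult simp: cos_coeff_def sin_coeff_def)
  then have "green0 f (z + 2 * pi) = - green0 f z" "green0' f (z + 2 * pi) = - green0' f z" for z
    unfolding green0_def green0'_def antiper_shift[OF antiper_cos] antiper_shift[OF antiper_sin]
    by (simp_all add: algebra_simps)
  then show "antiper (green0 f)" "antiper (green0' f)"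
    unfolding antiper_def using
      DERIV_continuous_on[OF has_field_derivative_at_within[OF green0_deriv], of UNIV]
      DERIV_continuous_on[OF has_field_derivative_at_within[OF green0'_deriv], of UNIV]
    by blast+
qed

lemma green0_inverse:
  assumes "cos_coeff f = 0" "sin_coeff f = 0"
  shows "f z - 1 / 4 * green0 f z + 1 / 4 * anti_int (anti_int (\<lambda>z. f z - 1 / 4 * green0 f z)) z = f z"
proof -
  note ap = green0_antiper[OF assms]
  have "antiper (\<lambda>z. f z - 1 / 4 * green0 f z)" by (intro antiper_diff antiper_scale f ap)
  from anti_int_unique[OF ap(2) green0'_deriv this] anti_int_unique[OF ap(1) green0_deriv ap(2)]
  show ?thesis by simp
qed

text \<open>The elementary estimate of an integral from 0 to z grows with |z|; it is applied on one
  period and extended by antiperiodicity.\<close>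

lemma green0_bound:
  assumes "cos_coeff f = 0" "sin_coeff f = 0" "\<And>z. \<bar>f z\<bar> \<le> B" shows "\<bar>green0 f z\<bar> \<le> 8 * pi * B"
proof (rule antiper_bound[OF green0_antiper(1)[OF assms(1,2)]])
  fix z assume z: "z \<in> {0..2 * pi}"
  have "0 \<le> B" using assms(3)[of 0] by linarith
  have "\<bar>f t * cos (t / 2)\<bar> \<le> B" "\<bar>f t * sin (t / 2)\<bar> \<le> B" for t
    using assms(3) by (auto intro!: abs_mult_le_one)
  then have "\<bar>dint (\<lambda>t. f t * cos (t / 2)) 0 z\<bar> \<le> B * \<bar>z - 0\<bar>" "\<bar>dint (\<lambda>t. f t * sin (t / 2)) 0 z\<bar> \<le> B * \<bar>z - 0\<bar>"
    by (intro dint_bound cont_half_mult; simp)+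
  moreover have "B * \<bar>z - 0\<bar> \<le> B * (2 * pi)" using z \<open>0 \<le> B\<close> by (intro mult_left_mono) auto
  ultimately have "\<bar>sin (z / 2) * dint (\<lambda>t. f t * cos (t / 2)) 0 z\<bar> \<le> B * (2 * pi)"
    "\<bar>cos (z / 2) * dint (\<lambda>t. f t * sin (t / 2)) 0 z\<bar> \<le> B * (2 * pi)"
    by (intro abs_mult_le_one'; simp)+
  moreover have "\<bar>2 * (x - y)\<bar> \<le> 4 * m" if "\<bar>x\<bar> \<le> m" "\<bar>y\<bar> \<le> m" for x y m :: real
  proof -
    have "\<bar>x - y\<bar> \<le> 2 * m" using that by linarith
    then show ?thesis by (simp add: abs_mult)
  qed
  ultimately have "\<bar>green0 f z\<bar> \<le> 4 * (B * (2 * pi))"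
    unfolding green0_def by blast
  then show "\<bar>green0 f z\<bar> \<le> 8 * pi * B" by (simp add: mult_ac)
qed

end

lemma green0_linear:
  assumes "antiper f" "antiper g"
  shows "green0 (\<lambda>z. a * f z + b * g z) z = a * green0 f z + b * green0 g z"
proof -
  have e: "(\<lambda>t. (a * f t + b * g t) * sin (t / 2)) = (\<lambda>t. a * (f t * sin (t / 2)) + b * (g t * sin (t / 2)))"
    "(\<lambda>t. (a * f t + b * g t) * cos (t / 2)) = (\<lambda>t. a * (f t * cos (t / 2)) + b * (g t * cos (t / 2)))"
    by (simp_all add: fun_eq_iff algebra_simps)
  show ?thesis
    unfolding green0_def e dint_linear[OF cont_half_mult(1)[OF assms(1)] cont_half_mult(1)[OF assms(2)]]
      dint_linear[OF cont_half_mult(2)[OF assms(1)] cont_half_mult(2)[OF assms(2)]]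
    by (simp add: algebra_simps)
qed

lemma antiper_op_green0_nonresonant_part: "antiper_op (\<lambda>f. green0 (nonresonant_part f)) (40 * pi)"
proof (rule antiper_opI)
  show "\<bar>green0 (nonresonant_part f) z\<bar> \<le> 40 * pi * B" if f: "antiper f" "\<And>z. \<bar>f z\<bar> \<le> B" for f B z
    using green0_bound[OF nonresonant_part_antiper[OF f(1)] nonresonant_part_orth[OF f(1)] antiper_opD(3)[OF antiper_op_nonresonant_part f], of z] by simp
  show "green0 (nonresonant_part (\<lambda>z. a * f z + b * g z)) z = a * green0 (nonresonant_part f) z + b * green0 (nonresonant_part g) z"
    if "antiper f" "antiper g" for f g a b z
    unfolding antiper_opD(4)[OF antiper_op_nonresonant_part that] by (rule green0_linear[OF that[THEN nonresonant_part_antiper]])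
qed (auto intro: green0_antiper nonresonant_part_antiper nonresonant_part_orth)

text \<open>The left side is (1 + J/4) (1 + s^2 J) applied to \<open>N f\<close>. \<open>V0\<close>
  inverts the first factor after projection, \<open>V1\<close> inverts the second, both in the form
  f minus a multiple of a Green's function, and \<open>N\<close> is their composition.\<close>

lemma reduced_inverse:
  assumes s: "s \<noteq> 0" "cos (s * pi) \<noteq> 0"
  obtains N M where "antiper_op N M"
    "\<And>f z. antiper f \<Longrightarrow> N f z + (1 / 4 + s\<^sup>2) * anti_int (anti_int (N f)) z + s\<^sup>2 / 4 * anti_int (anti_int (anti_int (anti_int (N f)))) z = nonresonant_part f z"
proof -
  define V0 where "V0 f z = 1 * nonresonant_part f z + (- 1 / 4) * green0 (nonresonant_part f) z" for f z
  define V1 where "V1 f z = 1 * f z + (- s\<^sup>2) * green s f z" for f z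
  have V0: "antiper_op V0 (\<bar>1\<bar> * 5 + \<bar>- 1 / 4\<bar> * (40 * pi))"
    using antiper_op_lin[OF antiper_op_nonresonant_part antiper_op_green0_nonresonant_part, of 1 "- 1 / 4"] unfolding V0_def[abs_def] .
  have V1: "antiper_op V1 (\<bar>1\<bar> * 1 + \<bar>- s\<^sup>2\<bar> * (2 * pi / \<bar>s * cos (s * pi)\<bar>))"
    using antiper_op_lin[OF antiper_op_id antiper_op_green[OF s], of 1 "- s\<^sup>2"] unfolding V1_def[abs_def] .
  have J: "antiper_op (\<lambda>f. anti_int (anti_int f)) (pi * pi)" by (rule antiper_op_comp[OF antiper_op_anti_int antiper_op_anti_int])
  have eq: "V1 (V0 f) z + (1 / 4 + s\<^sup>2) * anti_int (anti_int (V1 (V0 f))) z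
      + s\<^sup>2 / 4 * anti_int (anti_int (anti_int (anti_int (V1 (V0 f))))) z = nonresonant_part f z" if f: "antiper f" for f z
  proof -
    define g where "g = V0 f"
    define w where "w = V1 g"
    have ap: "antiper g" "antiper w" using antiper_opD(2)[OF V0 f] antiper_opD(2)[OF V1] by (auto simp: g_def w_def)
    have g: "g z + 1 / 4 * anti_int (anti_int g) z = nonresonant_part f z" for z
      using green0_inverse[OF nonresonant_part_antiper[OF f] nonresonant_part_orth[OF f], of z] by (simp add: g_def V0_def[abs_def])
    have w: "1 * w z + s\<^sup>2 * anti_int (anti_int w) z = g z" for z
      using green_inverse[OF s ap(1), of z] by (simp add: w_def V1_def[abs_def])
    have "anti_int (anti_int g) = (\<lambda>z. 1 * anti_int (anti_int w) z + s\<^sup>2 * anti_int (anti_int (anti_int (anti_int w))) z)"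
      unfolding w[symmetric] by (rule antiper_opD(4)[OF J ap(2) antiper_opD(2)[OF J ap(2)]])
    then have "anti_int (anti_int g) z = 1 * anti_int (anti_int w) z + s\<^sup>2 * anti_int (anti_int (anti_int (anti_int w))) z" by metis
    with g[of z] w[of z]
    have "w z + (1 / 4 + s\<^sup>2) * anti_int (anti_int w) z + s\<^sup>2 / 4 * anti_int (anti_int (anti_int (anti_int w))) z = nonresonant_part f z"
      by (simp add: distrib_right add_divide_distrib)
    then show ?thesis unfolding w_def g_def .
  qed
  show thesis by (rule that[OF antiper_op_comp[OF V1 V0] eq])
qed

section \<open>The two bifurcation equations\<close>

lemma antiper_op_scale_op: "antiper_op T M \<Longrightarrow> antiper_op (\<lambda>f z. a * T f z) (\<bar>a\<bar> * M)"
  using antiper_op_lin[of T M T M a 0] by simp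

lemma anti_int_trig:
  "anti_int (\<lambda>z. cos (z / 2)) = (\<lambda>z. 2 * sin (z / 2))" "anti_int (\<lambda>z. sin (z / 2)) = (\<lambda>z. - 2 * cos (z / 2))"
  "anti_int (\<lambda>z. cos (3 * z / 2)) = (\<lambda>z. 2 / 3 * sin (3 * z / 2))"
  "anti_int (\<lambda>z. sin (3 * z / 2)) = (\<lambda>z. - 2 / 3 * cos (3 * z / 2))"
  by (rule anti_int_unique; (intro antiper_scale antiper_cos antiper_sin antiper_cos3 antiper_sin3)?;
      auto intro!: derivative_eq_intros)+

lemma anti_int2_trig:
  "anti_int (anti_int (\<lambda>z. cos (z / 2))) = (\<lambda>z. - 4 * cos (z / 2))" "anti_int (anti_int (\<lambda>z. sin (z / 2))) = (\<lambda>z. - 4 * sin (z / 2))"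
  "anti_int (anti_int (\<lambda>z. cos (3 * z / 2))) = (\<lambda>z. - 4 / 9 * cos (3 * z / 2))"
  "anti_int (anti_int (\<lambda>z. sin (3 * z / 2))) = (\<lambda>z. - 4 / 9 * sin (3 * z / 2))"
  unfolding anti_int_trig antiper_op_scaled[OF antiper_op_anti_int antiper_cos] antiper_op_scaled[OF antiper_op_anti_int antiper_sin]
      antiper_op_scaled[OF antiper_op_anti_int antiper_cos3] antiper_op_scaled[OF antiper_op_anti_int antiper_sin3]
  by simp_all

lemma antiper_op_anti_int2: "antiper_op (\<lambda>f. anti_int (anti_int f)) (pi\<^sup>2)"
  using antiper_op_comp[OF antiper_op_anti_int antiper_op_anti_int] by (simp add: power2_eq_square)

lemma antiper_op_anti_int3: "antiper_op (\<lambda>f. anti_int (anti_int (anti_int f))) (pi ^ 3)"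
  using antiper_op_comp[OF antiper_op_anti_int antiper_op_anti_int2] by (simp add: power3_eq_cube power2_eq_square mult_ac)

text \<open>Multiplication by cos z returns half of each resonant mode, with sign + for the cosine
  and - for the sine, plus a third harmonic orthogonal to both. The opposite signs make the part of
  the determinant without \<kappa> negative.\<close>

lemma anti_int2_cos_mult:
  "anti_int (anti_int (\<lambda>t. cos t * cos (t / 2))) = (\<lambda>z. - 2 / 9 * cos (3 * z / 2) + - 2 * cos (z / 2))"
  "anti_int (anti_int (\<lambda>t. cos t * sin (t / 2))) = (\<lambda>z. - 2 / 9 * sin (3 * z / 2) + 2 * sin (z / 2))"
proof -
  have e: "t - t / 2 = t / 2" "t + t / 2 = 3 * t / 2" for t :: real by simp_all
  have c: "(\<lambda>t. cos t * cos (t / 2)) = (\<lambda>t::real. 1 / 2 * cos (3 * t / 2) + 1 / 2 * cos (t / 2))"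
    "(\<lambda>t. cos t * sin (t / 2)) = (\<lambda>t::real. 1 / 2 * sin (3 * t / 2) + - 1 / 2 * sin (t / 2))"
    by (simp_all add: fun_eq_iff cos_times_cos cos_times_sin e field_simps)
  show "anti_int (anti_int (\<lambda>t. cos t * cos (t / 2))) = (\<lambda>z. - 2 / 9 * cos (3 * z / 2) + - 2 * cos (z / 2))"
    unfolding c antiper_opD(4)[OF antiper_op_anti_int2 antiper_cos3 antiper_cos] anti_int2_trig by simp
  show "anti_int (anti_int (\<lambda>t. cos t * sin (t / 2))) = (\<lambda>z. - 2 / 9 * sin (3 * z / 2) + 2 * sin (z / 2))"
    unfolding c antiper_opD(4)[OF antiper_op_anti_int2 antiper_sin3 antiper_sin] anti_int2_trig by simp
qed

lemma anti_int3_trig: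
  "anti_int (anti_int (anti_int (\<lambda>z. cos (z / 2)))) = (\<lambda>z. - 8 * sin (z / 2))"
  "anti_int (anti_int (anti_int (\<lambda>z. sin (z / 2)))) = (\<lambda>z. 8 * cos (z / 2))"
  unfolding anti_int2_trig
  unfolding antiper_op_scaled[OF antiper_op_anti_int antiper_cos] antiper_op_scaled[OF antiper_op_anti_int antiper_sin] anti_int_trig
  by simp_all

text \<open>Common setting for \<open>cos_coeff\<close> and \<open>sin_coeff\<close>, so that
  continuity and error estimates are made only once.\<close>

definition antiper_functional :: "((real \<Rightarrow> real) \<Rightarrow> real) \<Rightarrow> bool" where
  "antiper_functional \<phi> \<longleftrightarrow> (\<forall>f g a b. antiper f \<longrightarrow> antiper g \<longrightarrow> \<phi> (\<lambda>z. a * f z + b * g z) = a * \<phi> f + b * \<phi> g) \<and>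
     (\<forall>f B. antiper f \<longrightarrow> (\<forall>z. \<bar>f z\<bar> \<le> B) \<longrightarrow> \<bar>\<phi> f\<bar> \<le> 2 * pi * B)"

lemma antiper_functional_cos_coeff: "antiper_functional cos_coeff" and antiper_functional_sin_coeff: "antiper_functional sin_coeff"
  unfolding antiper_functional_def using cos_coeff_lin cos_coeff_bound sin_coeff_lin sin_coeff_bound by blast+

lemma antiper_functionalD:
  assumes "antiper_functional \<phi>" "antiper f" "antiper g"
  shows "\<phi> (\<lambda>z. a * f z + b * g z) = a * \<phi> f + b * \<phi> g"
    "(\<And>z. \<bar>f z - g z\<bar> \<le> B) \<Longrightarrow> \<bar>\<phi> f - \<phi> g\<bar> \<le> 2 * pi * B"
proof -
  show l: "\<phi> (\<lambda>z. a * f z + b * g z) = a * \<phi> f + b * \<phi> g" for a b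
    using assms unfolding antiper_functional_def by blast
  show "\<bar>\<phi> f - \<phi> g\<bar> \<le> 2 * pi * B" if "\<And>z. \<bar>f z - g z\<bar> \<le> B"
  proof -
    have "\<bar>\<phi> (\<lambda>z. f z - g z)\<bar> \<le> 2 * pi * B"
      using assms(1) antiper_diff[OF assms(2,3)] that unfolding antiper_functional_def by blast
    then show ?thesis using l[of 1 "-1"] by simp
  qed
qed

lemma lipschitz_functional_continuous:
  assumes \<phi>: "antiper_functional \<phi>" and L: "antiper_op L m" and w: "\<And>\<kappa>. \<kappa> \<in> I \<Longrightarrow> antiper (w \<kappa>)"
    "\<And>\<kappa> \<kappa>' z. \<kappa> \<in> I \<Longrightarrow> \<kappa>' \<in> I \<Longrightarrow> \<bar>w \<kappa> z - w \<kappa>' z\<bar> \<le> C * \<bar>\<kappa> - \<kappa>'\<bar>"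
  shows "continuous_on I (\<lambda>\<kappa>::real. \<phi> (L (w \<kappa>)))"
proof (rule continuous_onI)
  fix \<kappa> e :: real assume \<kappa>: "\<kappa> \<in> I" and e: "0 < e"
  define A where "A = \<bar>2 * pi * (m * C)\<bar> + 1"
  have "dist (\<phi> (L (w \<kappa>'))) (\<phi> (L (w \<kappa>))) \<le> e" if \<kappa>': "\<kappa>' \<in> I" and lt: "dist \<kappa>' \<kappa> < e / A" for \<kappa>'
  proof -
    have "\<bar>L (w \<kappa>') z - L (w \<kappa>) z\<bar> \<le> m * (C * \<bar>\<kappa>' - \<kappa>\<bar>)" for z
      using antiper_opD(3)[OF L antiper_diff[OF w(1)[OF \<kappa>'] w(1)[OF \<kappa>]] w(2)[OF \<kappa>' \<kappa>]]
      by (simp add: antiper_op_diff[OF L w(1)[OF \<kappa>'] w(1)[OF \<kappa>]])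
    from antiper_functionalD(2)[OF \<phi> antiper_opD(2)[OF L w(1)[OF \<kappa>']] antiper_opD(2)[OF L w(1)[OF \<kappa>]] this]
    have "\<bar>\<phi> (L (w \<kappa>')) - \<phi> (L (w \<kappa>))\<bar> \<le> (2 * pi * (m * C)) * \<bar>\<kappa>' - \<kappa>\<bar>" by (simp add: mult_ac)
    also have "\<dots> \<le> A * \<bar>\<kappa>' - \<kappa>\<bar>" by (intro mult_right_mono) (auto simp: A_def)
    also have "\<dots> \<le> A * (e / A)" using lt by (intro mult_left_mono) (auto simp: A_def dist_real_def)
    also have "\<dots> = e" by (simp add: A_def)
    finally show ?thesis by (simp add: dist_real_def)
  qed
  moreover have "0 < e / A" using e by (simp add: A_def)
  ultimately show "\<exists>d>0. \<forall>x'\<in>I. dist x' \<kappa> < d \<longrightarrow> dist (\<phi> (L (w x'))) (\<phi> (L (w \<kappa>))) \<le> e" by blast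
qed

text \<open>Each product moves by at most \<tau>^2 + 2 L \<tau>, which is at most \<tau> (2 L + 1)
  as \<tau> <= 1.\<close>

lemma det_perturbation:
  fixes x1 x2 x3 x4 p1 p2 p3 p4 \<tau> L :: real
  assumes "\<bar>x1 - p1\<bar> \<le> \<tau>" "\<bar>x2 - p2\<bar> \<le> \<tau>" "\<bar>x3 - p3\<bar> \<le> \<tau>" "\<bar>x4 - p4\<bar> \<le> \<tau>"
    "\<bar>p1\<bar> \<le> L" "\<bar>p2\<bar> \<le> L" "\<bar>p3\<bar> \<le> L" "\<bar>p4\<bar> \<le> L" "\<tau> \<le> 1"
  shows "\<bar>(x1 * x4 - x2 * x3) - (p1 * p4 - p2 * p3)\<bar> \<le> 2 * (\<tau> * (2 * L + 1))"
proof -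
  have pr: "\<bar>x * y - p * q\<bar> \<le> \<tau> * (2 * L + 1)"
    if "\<bar>x - p\<bar> \<le> \<tau>" "\<bar>y - q\<bar> \<le> \<tau>" "\<bar>p\<bar> \<le> L" "\<bar>q\<bar> \<le> L" for x y p q :: real
  proof -
    have "x * y - p * q = (x - p) * (y - q) + p * (y - q) + (x - p) * q" by (simp add: algebra_simps)
    also have "\<bar>\<dots>\<bar> \<le> \<bar>(x - p) * (y - q)\<bar> + \<bar>p * (y - q)\<bar> + \<bar>(x - p) * q\<bar>" by linarith
    also have "\<dots> = \<bar>x - p\<bar> * \<bar>y - q\<bar> + \<bar>p\<bar> * \<bar>y - q\<bar> + \<bar>x - p\<bar> * \<bar>q\<bar>" by (simp add: abs_mult)
    also have "\<dots> \<le> \<tau> * 1 + L * \<tau> + \<tau> * L"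
      using that assms(9) by (intro add_mono mult_mono) auto
    finally show ?thesis by (simp add: algebra_simps)
  qed
  show ?thesis using pr[OF assms(1,4,5,8)] pr[OF assms(2,3,6,7)] by linarith
qed

lemma singular_2x2:
  fixes p q r t :: real
  assumes "p * t - q * r = 0"
  obtains a b where "(a, b) \<noteq> (0, 0)" "a * p + b * r = 0" "a * q + b * t = 0"
proof (cases "p = 0 \<and> r = 0")
  case True
  show ?thesis
  proof (cases "q = 0 \<and> t = 0")
    case True then show ?thesis using \<open>p = 0 \<and> r = 0\<close> that[of 1 0] by simp
  next
    case False then show ?thesis using \<open>p = 0 \<and> r = 0\<close> that[of t "- q"] by auto
  qed
next
  case False
  have "r * p + - p * r = 0" "r * q + - p * t = 0" using assms by (simp_all add: mult.commute)
  then show ?thesis using False that[of r "- p"] by auto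
qed

text \<open>With \<open>b = \<beta> k\<^sup>4\<close>, \<open>d = c - c\<^sub>0\<close>, \<open>J = anti_int\<^sup>2\<close> and \<open>\<lambda> = \<kappa> e\<close>, the kernel equation, integrated four times, is
  \<open>(1 + J/4) (1 + s\<^sup>2 J) w = wave_op w + \<kappa> growth_op w\<close>.\<close>

definition wave_op :: "real \<Rightarrow> real \<Rightarrow> real \<Rightarrow> (real \<Rightarrow> real) \<Rightarrow> (real \<Rightarrow> real) \<Rightarrow> real \<Rightarrow> real" where
  "wave_op b k d \<eta> f z = (- k\<^sup>2 * d / b) * anti_int (anti_int f) z + (2 * k\<^sup>2 / b) * anti_int (anti_int (\<lambda>t. \<eta> t * f t)) z"

definition growth_op :: "real \<Rightarrow> real \<Rightarrow> (real \<Rightarrow> real) \<Rightarrow> real \<Rightarrow> real" where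
  "growth_op b e f z = (e / b) * anti_int (anti_int (anti_int f)) z"

context
  fixes b k d e \<epsilon> C\<^sub>1 :: real and \<eta> :: "real \<Rightarrow> real"
  assumes pos: "0 < b" "0 < k" "0 < e" "e \<le> 1" "0 \<le> C\<^sub>1" and e: "e = \<bar>\<epsilon>\<bar>"
    and \<eta>: "continuous_on UNIV \<eta>" "periodic_2pi \<eta>" "\<And>z. \<bar>\<eta> z - \<epsilon> * cos z\<bar> \<le> C\<^sub>1 * e\<^sup>2"
    and d: "\<bar>d\<bar> \<le> C\<^sub>1 * e\<^sup>2"
begin

lemma e_sq: "C\<^sub>1 * e\<^sup>2 \<le> C\<^sub>1 * e"
proof (rule mult_left_mono)
  show "e\<^sup>2 \<le> e" using mult_right_mono[of e 1 e] pos by (simp add: power2_eq_square)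
qed (use pos in simp)

text \<open>The speed correction contributes \<open>C\<^sub>1\<close> and the profile 2 (1 +
  \<open>C\<^sub>1\<close>) to the bracket; e <= 1 is used to weaken e^2 to e.\<close>

lemma antiper_op_wave_op: "antiper_op (wave_op b k d \<eta>) (k\<^sup>2 * pi\<^sup>2 * (2 + 3 * C\<^sub>1) / b * e)"
proof -
  have "\<bar>\<eta> z\<bar> \<le> (1 + C\<^sub>1) * e" for z
  proof -
    have "\<bar>\<epsilon> * cos z\<bar> \<le> e" using e by (intro abs_mult_le_one) auto
    then have "\<bar>\<eta> z\<bar> \<le> e + C\<^sub>1 * e" using \<eta>(3)[of z] e_sq by linarith
    then show ?thesis by (simp add: distrib_right)
  qed
  from antiper_op_comp[OF antiper_op_anti_int2 antiper_op_mult[OF \<eta>(1,2) this]]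
  have A: "antiper_op (\<lambda>f. anti_int (anti_int (\<lambda>t. \<eta> t * f t))) (pi\<^sup>2 * ((1 + C\<^sub>1) * e))" .
  have "\<bar>d\<bar> \<le> C\<^sub>1 * e" using d e_sq by linarith
  then have "k\<^sup>2 * \<bar>d\<bar> / b \<le> k\<^sup>2 * (C\<^sub>1 * e) / b"
    using pos by (intro divide_right_mono mult_left_mono) auto
  then have "\<bar>- k\<^sup>2 * d / b\<bar> \<le> k\<^sup>2 * (C\<^sub>1 * e) / b"
    using pos(1) by (simp add: abs_mult)
  then have "\<bar>- k\<^sup>2 * d / b\<bar> * pi\<^sup>2 + \<bar>2 * k\<^sup>2 / b\<bar> * (pi\<^sup>2 * ((1 + C\<^sub>1) * e))
      \<le> k\<^sup>2 * (C\<^sub>1 * e) / b * pi\<^sup>2 + 2 * k\<^sup>2 / b * (pi\<^sup>2 * ((1 + C\<^sub>1) * e))"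
    using pos by (intro add_mono mult_right_mono) auto
  also have "\<dots> = k\<^sup>2 * pi\<^sup>2 * (2 + 3 * C\<^sub>1) / b * e"
    using pos(1) by (simp add: divide_simps) (simp add: algebra_simps)
  finally show ?thesis
    using antiper_op_mono[OF antiper_op_lin[OF antiper_op_anti_int2 A, of "- k\<^sup>2 * d / b" "2 * k\<^sup>2 / b"]]
    unfolding wave_op_def[abs_def] by simp
qed

lemma antiper_op_growth_op: "antiper_op (growth_op b e) (pi ^ 3 / b * e)"
  using antiper_op_scale_op[OF antiper_op_anti_int3, of "e / b"] pos unfolding growth_op_def[abs_def] by (simp add: mult_ac)

text \<open>To first order only \<epsilon> cos z acts: the speed correction and the rest of the
  profile are both of order e^2, with shares \<open>C\<^sub>1\<close> and 2 \<open>C\<^sub>1\<close>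
  of the constant.\<close>

lemma wave_op_leading:
  assumes f: "antiper f" "\<And>z. \<bar>f z\<bar> \<le> 1"
  shows "\<bar>wave_op b k d \<eta> f z - (2 * k\<^sup>2 / b) * (\<epsilon> * anti_int (anti_int (\<lambda>t. cos t * f t)) z)\<bar> \<le> 3 * k\<^sup>2 * pi\<^sup>2 * C\<^sub>1 / b * e\<^sup>2"
proof -
  have cont: "continuous_on UNIV (\<lambda>t. \<eta> t - \<epsilon> * cos t)" "continuous_on UNIV (\<lambda>t::real. cos t)"
    by (intro continuous_intros \<eta>(1))+
  have per: "periodic_2pi (\<lambda>t. \<eta> t - \<epsilon> * cos t)" "periodic_2pi (\<lambda>t. cos t)"
    using \<eta>(2) unfolding periodic_2pi_def by simp_all
  have h: "antiper (\<lambda>t. (\<eta> t - \<epsilon> * cos t) * f t)" "antiper (\<lambda>t. cos t * f t)"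
    by (rule antiper_mult[OF f(1) cont(1) per(1)], rule antiper_mult[OF f(1) cont(2) per(2)])
  have "\<bar>(\<eta> t - \<epsilon> * cos t) * f t\<bar> \<le> C\<^sub>1 * e\<^sup>2" for t
    by (rule abs_mult_le_one[OF \<eta>(3) f(2)])
  from antiper_opD(3)[OF antiper_op_anti_int2 h(1) this]
  have 1: "\<bar>anti_int (anti_int (\<lambda>t. (\<eta> t - \<epsilon> * cos t) * f t)) z\<bar> \<le> pi\<^sup>2 * (C\<^sub>1 * e\<^sup>2)" .
  have 2: "\<bar>anti_int (anti_int f) z\<bar> \<le> pi\<^sup>2 * 1" by (rule antiper_opD(3)[OF antiper_op_anti_int2 f])
  have split: "(\<lambda>t. \<eta> t * f t) = (\<lambda>t. 1 * ((\<eta> t - \<epsilon> * cos t) * f t) + \<epsilon> * (cos t * f t))"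
    by (simp add: fun_eq_iff algebra_simps)
  have "anti_int (anti_int (\<lambda>t. \<eta> t * f t)) z =
      1 * anti_int (anti_int (\<lambda>t. (\<eta> t - \<epsilon> * cos t) * f t)) z + \<epsilon> * anti_int (anti_int (\<lambda>t. cos t * f t)) z"
    unfolding split antiper_opD(4)[OF antiper_op_anti_int2 h] ..
  then have "wave_op b k d \<eta> f z - (2 * k\<^sup>2 / b) * (\<epsilon> * anti_int (anti_int (\<lambda>t. cos t * f t)) z)
     = (- k\<^sup>2 * d / b) * anti_int (anti_int f) z + (2 * k\<^sup>2 / b) * anti_int (anti_int (\<lambda>t. (\<eta> t - \<epsilon> * cos t) * f t)) z"
    unfolding wave_op_def by algebra
  also have "\<bar>\<dots>\<bar> \<le> \<bar>- k\<^sup>2 * d / b\<bar> * \<bar>anti_int (anti_int f) z\<bar> + \<bar>2 * k\<^sup>2 / b\<bar> * \<bar>anti_int (anti_int (\<lambda>t. (\<eta> t - \<epsilon> * cos t) * f t)) z\<bar>"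
    unfolding abs_mult[symmetric] by (rule abs_triangle_ineq)
  also have "\<dots> \<le> (k\<^sup>2 * (C\<^sub>1 * e\<^sup>2) / b) * (pi\<^sup>2 * 1) + (2 * k\<^sup>2 / b) * (pi\<^sup>2 * (C\<^sub>1 * e\<^sup>2))"
  proof (intro add_mono mult_mono)
    have "k\<^sup>2 * \<bar>d\<bar> / b \<le> k\<^sup>2 * (C\<^sub>1 * e\<^sup>2) / b"
      using d pos by (intro divide_right_mono mult_left_mono) auto
    then show "\<bar>- k\<^sup>2 * d / b\<bar> \<le> k\<^sup>2 * (C\<^sub>1 * e\<^sup>2) / b"
      using pos(1) by (simp add: abs_mult)
  qed (use 1 2 pos in auto)
  also have "\<dots> = 3 * k\<^sup>2 * pi\<^sup>2 * C\<^sub>1 / b * e\<^sup>2"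
    using pos(1) by (simp add: divide_simps) (simp add: algebra_simps)?
  finally show ?thesis .
qed

end

lemma antiper_op_zero: "antiper_op T M \<Longrightarrow> T (\<lambda>z. 0) = (\<lambda>z. 0)"
  using antiper_op_scaled[OF _ antiper_cos, of T M 0] by simp

text \<open>J acts as -4 on both resonant modes, and 1 - 4 (1/4 + q) + 16 q/4 = 0.\<close>

lemma leading_kernel:
  "antiper (\<lambda>z. a * cos (z / 2) + a' * sin (z / 2))"
  "(a * cos (z / 2) + a' * sin (z / 2)) + (1 / 4 + q) * anti_int (anti_int (\<lambda>z. a * cos (z / 2) + a' * sin (z / 2))) z
     + q / 4 * anti_int (anti_int (anti_int (anti_int (\<lambda>z. a * cos (z / 2) + a' * sin (z / 2))))) z = 0"
proof -
  have J: "anti_int (anti_int (\<lambda>z. a * cos (z / 2) + a' * sin (z / 2))) = (\<lambda>z. - 4 * (a * cos (z / 2) + a' * sin (z / 2)))" for a a'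
    unfolding antiper_opD(4)[OF antiper_op_anti_int2 antiper_cos antiper_sin] anti_int2_trig by (simp add: algebra_simps)
  show ap: "antiper (\<lambda>z. a * cos (z / 2) + a' * sin (z / 2))"
    by (intro antiper_lin antiper_cos antiper_sin)
  show "(a * cos (z / 2) + a' * sin (z / 2)) + (1 / 4 + q) * anti_int (anti_int (\<lambda>z. a * cos (z / 2) + a' * sin (z / 2))) z
     + q / 4 * anti_int (anti_int (anti_int (anti_int (\<lambda>z. a * cos (z / 2) + a' * sin (z / 2))))) z = 0"
    unfolding J antiper_op_scaled[OF antiper_op_anti_int2 ap] by (simp add: algebra_simps)
qed

text \<open>S has size e and w - f has size e, so replacing w by the bare mode f changes
  \<open>S w\<close> only at order e^2. The correction w - f therefore never has to be
  computed.\<close>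

lemma functional_error:
  assumes \<phi>: "antiper_functional \<phi>" and S: "antiper_op S (H * e)" and w: "antiper w" "\<And>z. \<bar>w z - f z\<bar> \<le> G * e"
    and f: "antiper f" and g: "antiper g" "\<And>z. \<bar>S f z - g z\<bar> \<le> E * e\<^sup>2"
  shows "\<bar>\<phi> (S w) - \<phi> g\<bar> \<le> 2 * pi * ((H * G + E) * e\<^sup>2)"
proof (rule antiper_functionalD(2)[OF \<phi> antiper_opD(2)[OF S w(1)] g(1)])
  fix z
  have "\<bar>S w z - S f z\<bar> \<le> (H * e) * (G * e)"
    using antiper_opD(3)[OF S antiper_diff[OF w(1) f] w(2)] by (simp add: antiper_op_diff[OF S w(1) f])
  then have "\<bar>S w z - g z\<bar> \<le> (H * e) * (G * e) + E * e\<^sup>2" using g(2)[of z] by linarith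
  then show "\<bar>S w z - g z\<bar> \<le> (H * G + E) * e\<^sup>2" by (simp add: power2_eq_square algebra_simps)
qed

text \<open>The factor b/e makes the leading terms independent of the size of \<epsilon> and turns
  the error of order e^2 into one of order e.\<close>

lemma rescale_error:
  fixes X P R :: real
  assumes "0 < b" "0 < e" "\<bar>X - ((2 * k\<^sup>2 / b * \<epsilon>) * P + (\<kappa> * e / b) * R)\<bar> \<le> 2 * pi * (F * e\<^sup>2)" "2 * pi * F * b * e \<le> \<tau>"
  shows "\<bar>b / e * X - (2 * k\<^sup>2 * (\<epsilon> / e) * P + \<kappa> * R)\<bar> \<le> \<tau>"
proof -
  define Y where "Y = (2 * k\<^sup>2 / b * \<epsilon>) * P + (\<kappa> * e / b) * R"
  have "2 * k\<^sup>2 * (\<epsilon> / e) * P + \<kappa> * R = b / e * Y"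
    using assms(1,2) by (simp add: Y_def divide_simps) (simp add: algebra_simps)?
  then have "b / e * X - (2 * k\<^sup>2 * (\<epsilon> / e) * P + \<kappa> * R) = b / e * (X - Y)"
    by (simp add: right_diff_distrib)
  then have "\<bar>b / e * X - (2 * k\<^sup>2 * (\<epsilon> / e) * P + \<kappa> * R)\<bar> = b / e * \<bar>X - Y\<bar>"
    using assms(1,2) by (simp add: abs_mult)
  also have "\<dots> \<le> b / e * (2 * pi * (F * e\<^sup>2))"
    using assms(1,2,3) unfolding Y_def by (intro mult_left_mono) auto
  also have "\<dots> = 2 * pi * F * b * e" using assms(2) by (simp add: power2_eq_square)
  finally show ?thesis using assms(4) by linarith
qed

text \<open>A Lyapunov-Schmidt reduction. If f is a combination of resonant modes and w = f + N (S
  w), then (1 + J/4) (1 + s^2 J) w is the nonresonant part of S w, because f is annihilated. It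
  equals S w itself as soon as both resonant coefficients of S w vanish: two linear conditions on
  the two coefficients of f.\<close>

lemma bifurcating_kernel:
  fixes b k s C\<^sub>1 :: real
  assumes pos: "0 < b" "0 < k" "0 \<le> C\<^sub>1" and s: "s \<noteq> 0" "cos (s * pi) \<noteq> 0"
  obtains \<epsilon>\<^sub>0 where "0 < \<epsilon>\<^sub>0"
    "\<And>\<epsilon> d \<eta>. 0 < \<bar>\<epsilon>\<bar> \<Longrightarrow> \<bar>\<epsilon>\<bar> < \<epsilon>\<^sub>0 \<Longrightarrow> continuous_on UNIV \<eta> \<Longrightarrow> periodic_2pi \<eta> \<Longrightarrow>
       (\<And>z. \<bar>\<eta> z - \<epsilon> * cos z\<bar> \<le> C\<^sub>1 * \<epsilon>\<^sup>2) \<Longrightarrow> \<bar>d\<bar> \<le> C\<^sub>1 * \<epsilon>\<^sup>2 \<Longrightarrow>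
       \<exists>\<mu>>0. \<exists>w. antiper w \<and> (\<exists>z. w z \<noteq> 0) \<and>
         (\<forall>z. b * (w z + (1 / 4 + s\<^sup>2) * anti_int (anti_int w) z + s\<^sup>2 / 4 * anti_int (anti_int (anti_int (anti_int w))) z)
            = - k\<^sup>2 * d * anti_int (anti_int w) z + 2 * k\<^sup>2 * anti_int (anti_int (\<lambda>t. \<eta> t * w t)) z + \<mu> * anti_int (anti_int (anti_int w)) z)"
proof -
  obtain N M where N: "antiper_op N M" and inv: "\<And>f z. antiper f \<Longrightarrow>
      N f z + (1 / 4 + s\<^sup>2) * anti_int (anti_int (N f)) z + s\<^sup>2 / 4 * anti_int (anti_int (anti_int (anti_int (N f)))) z = nonresonant_part f z"
    using reduced_inverse[OF s] by blast
  \<comment> \<open>Twice the critical value: 64 \<kappa>^2 = 16 k^4 holds at \<kappa> = k^2 /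
    2.\<close>
  define K where "K = k\<^sup>2"
  define m where "m = k\<^sup>2 * pi\<^sup>2 * (2 + 3 * C\<^sub>1) / b"
  define n where "n = pi ^ 3 / b"
  \<comment> \<open>After multiplication by e, \<open>H\<close> bounds S, \<open>G\<close> the
    distance of a corrected mode from the mode itself, and \<open>E\<close> the error in the
    rescaled matrix entries. \<open>L\<close> bounds their leading parts 4 pi k^2 and 8 pi
    \<kappa>.\<close>
  define H where "H = m + K * n"
  define G where "G = 2 * M * H"
  define E where "E = 2 * pi * (H * G + 3 * k\<^sup>2 * pi\<^sup>2 * C\<^sub>1 / b) * b"
  define L where "L = 8 * pi * k\<^sup>2"
  have K: "0 < K" using pos by (simp add: K_def)
  have M0: "0 \<le> M" using antiper_opD(1)[OF N] .
  have mn: "0 \<le> m" "0 \<le> n" using pos by (simp_all add: m_def n_def)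
  have H0: "0 \<le> H" unfolding H_def using mn K by simp
  have E0: "0 \<le> E" unfolding E_def G_def using pos M0 H0 by simp
  have L0: "0 \<le> L" by (simp add: L_def)
  \<comment> \<open>Chosen so that the determinant is off by at most 2 pi^2 k^4, well below its
    leading endpoint values of size 16 and 48 times pi^2 k^4.\<close>
  define \<tau> where "\<tau> = min 1 (pi\<^sup>2 * k ^ 4 / (2 * L + 1))"
  have \<tau>: "0 < \<tau>" "\<tau> \<le> 1" "\<tau> * (2 * L + 1) \<le> pi\<^sup>2 * k ^ 4"
  proof -
    have "0 < pi\<^sup>2 * k ^ 4 / (2 * L + 1)" using pos L0 by simp
    then show "0 < \<tau>" "\<tau> \<le> 1" by (simp_all add: \<tau>_def)
    have "\<tau> * (2 * L + 1) \<le> (pi\<^sup>2 * k ^ 4 / (2 * L + 1)) * (2 * L + 1)"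
      using L0 by (intro mult_right_mono) (auto simp: \<tau>_def)
    also have "\<dots> = pi\<^sup>2 * k ^ 4" using L0 by simp
    finally show "\<tau> * (2 * L + 1) \<le> pi\<^sup>2 * k ^ 4" .
  qed
  \<comment> \<open>In this order: e <= 1, matrix errors at most \<tau>, and contraction constant at
    most 1/2.\<close>
  define \<epsilon>\<^sub>0 where "\<epsilon>\<^sub>0 = min 1 (min (\<tau> / (E + 1)) (1 / (2 * (M * H + 1))))"
  have MH0: "0 \<le> M * H" using M0 H0 by simp
  have \<epsilon>0_pos: "0 < \<epsilon>\<^sub>0" using \<tau>(1) E0 MH0 unfolding \<epsilon>\<^sub>0_def by (auto intro!: divide_pos_pos)
  have main: "\<exists>\<mu>>0. \<exists>w. antiper w \<and> (\<exists>z. w z \<noteq> 0) \<and>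
         (\<forall>z. b * (w z + (1 / 4 + s\<^sup>2) * anti_int (anti_int w) z + s\<^sup>2 / 4 * anti_int (anti_int (anti_int (anti_int w))) z)
            = - k\<^sup>2 * d * anti_int (anti_int w) z + 2 * k\<^sup>2 * anti_int (anti_int (\<lambda>t. \<eta> t * w t)) z + \<mu> * anti_int (anti_int (anti_int w)) z)"
    if e_pos: "0 < \<bar>\<epsilon>\<bar>" and small: "\<bar>\<epsilon>\<bar> < \<epsilon>\<^sub>0" and cont: "continuous_on UNIV \<eta>" and per: "periodic_2pi \<eta>"
      and \<eta>: "\<And>z. \<bar>\<eta> z - \<epsilon> * cos z\<bar> \<le> C\<^sub>1 * \<epsilon>\<^sup>2" and d: "\<bar>d\<bar> \<le> C\<^sub>1 * \<epsilon>\<^sup>2" for \<epsilon> d \<eta>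
  proof -
    define e where "e = \<bar>\<epsilon>\<bar>"
    have e: "0 < e" "e \<le> 1" "e * E \<le> \<tau>" "e * (M * H) \<le> 1 / 2"
    proof -
      show "0 < e" using e_pos by (simp add: e_def)
      have lt: "e < 1" "e < \<tau> / (E + 1)" "e < 1 / (2 * (M * H + 1))"
        using small by (simp_all add: e_def \<epsilon>\<^sub>0_def)
      show "e \<le> 1" using lt by simp
      have "e * (E + 1) < \<tau>" using lt(2) E0 by (simp add: less_divide_eq)
      then show "e * E \<le> \<tau>" using \<open>0 < e\<close> by (simp add: distrib_left)
      have "e * (2 * (M * H + 1)) < 1" using lt(3) MH0 by (simp add: less_divide_eq)
      then show "e * (M * H) \<le> 1 / 2" using \<open>0 < e\<close> by (simp add: distrib_left)
    qed
    have sq: "e\<^sup>2 = \<epsilon>\<^sup>2" by (simp add: e_def)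
    note prem = pos(1,2) e(1,2) pos(3) e_def cont per \<eta>[folded sq] d[folded sq]
    have A1: "antiper_op (wave_op b k d \<eta>) (m * e)" using antiper_op_wave_op[OF prem] unfolding m_def .
    have A2: "antiper_op (growth_op b e) (n * e)" using antiper_op_growth_op[OF prem] unfolding n_def .
    have NA: "antiper_op (\<lambda>f. N (wave_op b k d \<eta> f)) (M * (m * e))" "antiper_op (\<lambda>f. N (growth_op b e f)) (M * (n * e))"
      by (rule antiper_op_comp[OF N A1], rule antiper_op_comp[OF N A2])
    have sum: "M * (m * e) + K * (M * (n * e)) = e * (M * H)" by (simp add: H_def algebra_simps)
    have half: "M * (m * e) + K * (M * (n * e)) \<le> 1 / 2" unfolding sum by (rule e(4))
    obtain wc where wc: "\<And>\<kappa>. \<kappa> \<in> {0..K} \<Longrightarrow> antiper (wc \<kappa>)"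
      "\<And>\<kappa> z. \<kappa> \<in> {0..K} \<Longrightarrow> wc \<kappa> z = cos (z / 2) + (N (wave_op b k d \<eta> (wc \<kappa>)) z + \<kappa> * N (growth_op b e (wc \<kappa>)) z)"
      "\<And>\<kappa> z. \<kappa> \<in> {0..K} \<Longrightarrow> \<bar>wc \<kappa> z - cos (z / 2)\<bar> \<le> 2 * (e * (M * H))"
      "\<And>\<kappa> \<kappa>' z. \<kappa> \<in> {0..K} \<Longrightarrow> \<kappa>' \<in> {0..K} \<Longrightarrow> \<bar>wc \<kappa> z - wc \<kappa>' z\<bar> \<le> 4 * (M * (n * e)) * \<bar>\<kappa> - \<kappa>'\<bar>"
      using fixed_point_family[OF NA less_imp_le[OF K] half antiper_cos] unfolding sum by (metis abs_cos_le_one)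
    obtain ws where ws: "\<And>\<kappa>. \<kappa> \<in> {0..K} \<Longrightarrow> antiper (ws \<kappa>)"
      "\<And>\<kappa> z. \<kappa> \<in> {0..K} \<Longrightarrow> ws \<kappa> z = sin (z / 2) + (N (wave_op b k d \<eta> (ws \<kappa>)) z + \<kappa> * N (growth_op b e (ws \<kappa>)) z)"
      "\<And>\<kappa> z. \<kappa> \<in> {0..K} \<Longrightarrow> \<bar>ws \<kappa> z - sin (z / 2)\<bar> \<le> 2 * (e * (M * H))"
      "\<And>\<kappa> \<kappa>' z. \<kappa> \<in> {0..K} \<Longrightarrow> \<kappa>' \<in> {0..K} \<Longrightarrow> \<bar>ws \<kappa> z - ws \<kappa>' z\<bar> \<le> 4 * (M * (n * e)) * \<bar>\<kappa> - \<kappa>'\<bar>"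
      using fixed_point_family[OF NA less_imp_le[OF K] half antiper_sin] unfolding sum by (metis abs_sin_le_one)
    define S where "S \<kappa> f z = wave_op b k d \<eta> f z + \<kappa> * growth_op b e f z" for \<kappa> f z
    have S: "antiper_op (S \<kappa>) (H * e)" if "\<kappa> \<in> {0..K}" for \<kappa>
    proof -
      have "\<bar>1\<bar> * (m * e) + \<bar>\<kappa>\<bar> * (n * e) \<le> (m * e) + K * (n * e)"
        using that mn e by (auto intro!: mult_right_mono)
      also have "\<dots> = H * e" by (simp add: H_def algebra_simps)
      finally show ?thesis
        using antiper_op_mono[OF antiper_op_lin[OF A1 A2, of 1 \<kappa>]] unfolding S_def[abs_def] by simp
    qed
    have cont_S: "continuous_on {0..K} (\<lambda>\<kappa>. \<phi> (S \<kappa> (w \<kappa>)))"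
      if \<phi>: "antiper_functional \<phi>" and w: "\<And>\<kappa>. \<kappa> \<in> {0..K} \<Longrightarrow> antiper (w \<kappa>)"
      "\<And>\<kappa> \<kappa>' z. \<kappa> \<in> {0..K} \<Longrightarrow> \<kappa>' \<in> {0..K} \<Longrightarrow> \<bar>w \<kappa> z - w \<kappa>' z\<bar> \<le> 4 * (M * (n * e)) * \<bar>\<kappa> - \<kappa>'\<bar>" for \<phi> w
    proof -
      have c1: "continuous_on {0..K} (\<lambda>\<kappa>. \<phi> (wave_op b k d \<eta> (w \<kappa>)) + \<kappa> * \<phi> (growth_op b e (w \<kappa>)))"
        by (intro continuous_intros lipschitz_functional_continuous[OF \<phi> A1 w] lipschitz_functional_continuous[OF \<phi> A2 w])
      have c2: "\<phi> (S \<kappa> (w \<kappa>)) = \<phi> (wave_op b k d \<eta> (w \<kappa>)) + \<kappa> * \<phi> (growth_op b e (w \<kappa>))" if "\<kappa> \<in> {0..K}" for \<kappa>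
        using antiper_functionalD(1)[OF \<phi> antiper_opD(2)[OF A1 w(1)[OF that]] antiper_opD(2)[OF A2 w(1)[OF that]], of 1 \<kappa>]
        unfolding S_def[abs_def] by simp
      show ?thesis by (rule continuous_on_eq[OF c1]) (rule c2[symmetric])
    qed
    have err: "\<bar>b / e * \<phi> (S \<kappa> w) - (2 * k\<^sup>2 * (\<epsilon> / e) * \<phi> (anti_int (anti_int (\<lambda>t. cos t * f t))) + \<kappa> * \<phi> (anti_int (anti_int (anti_int f))))\<bar> \<le> \<tau>"
      if \<phi>: "antiper_functional \<phi>" and \<kappa>: "\<kappa> \<in> {0..K}" and w: "antiper w" "\<And>z. \<bar>w z - f z\<bar> \<le> 2 * (e * (M * H))"
        and f: "antiper f" "\<And>z. \<bar>f z\<bar> \<le> 1" for \<phi> \<kappa> w f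
    proof -
      let ?P = "anti_int (anti_int (\<lambda>t. cos t * f t))" and ?R = "anti_int (anti_int (anti_int f))"
      have cf: "antiper (\<lambda>t. cos t * f t)"
        by (rule antiper_mult[OF f(1)]) (auto simp: periodic_2pi_def intro!: continuous_intros)
      have PR: "antiper ?P" "antiper ?R" by (intro anti_int_antiper cf f)+
      have g: "antiper (\<lambda>z. (2 * k\<^sup>2 / b * \<epsilon>) * ?P z + (\<kappa> * e / b) * ?R z)" by (intro antiper_lin PR)
      have "S \<kappa> f z - ((2 * k\<^sup>2 / b * \<epsilon>) * ?P z + (\<kappa> * e / b) * ?R z) = wave_op b k d \<eta> f z - (2 * k\<^sup>2 / b) * (\<epsilon> * ?P z)" for z
        by (simp add: S_def growth_op_def)
      then have le: "\<bar>S \<kappa> f z - ((2 * k\<^sup>2 / b * \<epsilon>) * ?P z + (\<kappa> * e / b) * ?R z)\<bar> \<le> 3 * k\<^sup>2 * pi\<^sup>2 * C\<^sub>1 / b * e\<^sup>2" for z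
        using wave_op_leading[OF prem f] by simp
      have wG: "\<bar>w z - f z\<bar> \<le> G * e" for z proof -
        have "G * e = 2 * (e * (M * H))" by (simp add: G_def)
        then show ?thesis using w(2)[of z] by (simp only:)
      qed
      have "\<bar>\<phi> (S \<kappa> w) - \<phi> (\<lambda>z. (2 * k\<^sup>2 / b * \<epsilon>) * ?P z + (\<kappa> * e / b) * ?R z)\<bar>
          \<le> 2 * pi * ((H * G + 3 * k\<^sup>2 * pi\<^sup>2 * C\<^sub>1 / b) * e\<^sup>2)"
        by (rule functional_error[where f = f and G = G and E = "3 * k\<^sup>2 * pi\<^sup>2 * C\<^sub>1 / b", OF \<phi> S[OF \<kappa>] w(1) wG f(1) g le])
      then have "\<bar>\<phi> (S \<kappa> w) - ((2 * k\<^sup>2 / b * \<epsilon>) * \<phi> ?P + (\<kappa> * e / b) * \<phi> ?R)\<bar>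
          \<le> 2 * pi * ((H * G + 3 * k\<^sup>2 * pi\<^sup>2 * C\<^sub>1 / b) * e\<^sup>2)"
        unfolding antiper_functionalD(1)[OF \<phi> PR] .
      moreover have "2 * pi * (H * G + 3 * k\<^sup>2 * pi\<^sup>2 * C\<^sub>1 / b) * b * e \<le> \<tau>"
        using e(3) unfolding E_def by (subst mult.commute)
      ultimately show ?thesis by (rule rescale_error[OF pos(1) e(1)])
    qed
    \<comment> \<open>The matrix of the two solvability conditions in the basis of corrected modes;
      a zero of \<open>D\<close> gives a nontrivial solution.\<close>
    define D where "D \<kappa> = cos_coeff (S \<kappa> (wc \<kappa>)) * sin_coeff (S \<kappa> (ws \<kappa>)) - sin_coeff (S \<kappa> (wc \<kappa>)) * cos_coeff (S \<kappa> (ws \<kappa>))" for \<kappa>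
    have contD: "continuous_on {0..K} D"
      unfolding D_def[abs_def]
      by (intro continuous_intros cont_S[OF antiper_functional_cos_coeff wc(1,4)] cont_S[OF antiper_functional_cos_coeff ws(1,4)]
          cont_S[OF antiper_functional_sin_coeff wc(1,4)] cont_S[OF antiper_functional_sin_coeff ws(1,4)])
    have det: "\<bar>(b / e)\<^sup>2 * D \<kappa> - (- 16 * pi\<^sup>2 * k ^ 4 + 64 * pi\<^sup>2 * \<kappa>\<^sup>2)\<bar> \<le> 2 * (pi\<^sup>2 * k ^ 4)"
      if \<kappa>: "\<kappa> \<in> {0..K}" for \<kappa>
    proof -
      \<comment> \<open>The sign of \<epsilon>. Only its square enters the determinant, so crests
        and troughs behave alike.\<close>
      define \<sigma> where "\<sigma> = \<epsilon> / e"
      have \<sigma>: "\<bar>\<sigma>\<bar> = 1" "\<sigma> * \<sigma> = 1" using e_pos by (auto simp: \<sigma>_def e_def abs_if)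
      have P: "cos_coeff (anti_int (anti_int (\<lambda>t. cos t * cos (t / 2)))) = - 2 * pi" "sin_coeff (anti_int (anti_int (\<lambda>t. cos t * cos (t / 2)))) = 0"
        "cos_coeff (anti_int (anti_int (\<lambda>t. cos t * sin (t / 2)))) = 0" "sin_coeff (anti_int (anti_int (\<lambda>t. cos t * sin (t / 2)))) = 2 * pi"
        unfolding anti_int2_cos_mult cos_coeff_lin[OF antiper_cos3 antiper_cos] sin_coeff_lin[OF antiper_cos3 antiper_cos]
          cos_coeff_lin[OF antiper_sin3 antiper_sin] sin_coeff_lin[OF antiper_sin3 antiper_sin] by simp_all
      have scal: "\<phi> (\<lambda>z. a * f z) = a * \<phi> f" if "antiper_functional \<phi>" "antiper f" for \<phi> f a
        using antiper_functionalD(1)[OF that that(2), of a 0] by simp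
      have R: "cos_coeff (anti_int (anti_int (anti_int (\<lambda>t. cos (t / 2))))) = 0" "sin_coeff (anti_int (anti_int (anti_int (\<lambda>t. cos (t / 2))))) = - 8 * pi"
        "cos_coeff (anti_int (anti_int (anti_int (\<lambda>t. sin (t / 2))))) = 8 * pi" "sin_coeff (anti_int (anti_int (anti_int (\<lambda>t. sin (t / 2))))) = 0"
        unfolding anti_int3_trig scal[OF antiper_functional_cos_coeff antiper_cos] scal[OF antiper_functional_cos_coeff antiper_sin]
          scal[OF antiper_functional_sin_coeff antiper_cos] scal[OF antiper_functional_sin_coeff antiper_sin] by simp_all
      let ?C = "b / e * cos_coeff (S \<kappa> (wc \<kappa>))" and ?C' = "b / e * sin_coeff (S \<kappa> (wc \<kappa>))"
        and ?S = "b / e * cos_coeff (S \<kappa> (ws \<kappa>))" and ?S' = "b / e * sin_coeff (S \<kappa> (ws \<kappa>))"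
      have c: "\<bar>?C - - 4 * pi * k\<^sup>2 * \<sigma>\<bar> \<le> \<tau>" "\<bar>?C' - - 8 * pi * \<kappa>\<bar> \<le> \<tau>"
        using err[OF antiper_functional_cos_coeff \<kappa> wc(1)[OF \<kappa>] wc(3)[OF \<kappa>] antiper_cos abs_cos_le_one]
          err[OF antiper_functional_sin_coeff \<kappa> wc(1)[OF \<kappa>] wc(3)[OF \<kappa>] antiper_cos abs_cos_le_one]
        unfolding P R \<sigma>_def[symmetric] by (simp_all add: mult_ac)
      have c': "\<bar>?S - 8 * pi * \<kappa>\<bar> \<le> \<tau>" "\<bar>?S' - 4 * pi * k\<^sup>2 * \<sigma>\<bar> \<le> \<tau>"
        using err[OF antiper_functional_cos_coeff \<kappa> ws(1)[OF \<kappa>] ws(3)[OF \<kappa>] antiper_sin abs_sin_le_one]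
          err[OF antiper_functional_sin_coeff \<kappa> ws(1)[OF \<kappa>] ws(3)[OF \<kappa>] antiper_sin abs_sin_le_one]
        unfolding P R \<sigma>_def[symmetric] by (simp_all add: mult_ac)
      have "4 * pi * k\<^sup>2 \<le> L" "8 * pi * \<kappa> \<le> L" "0 \<le> \<kappa>" using \<kappa> by (simp_all add: L_def K_def)
      then have bd: "\<bar>- 4 * pi * k\<^sup>2 * \<sigma>\<bar> \<le> L" "\<bar>- 8 * pi * \<kappa>\<bar> \<le> L" "\<bar>8 * pi * \<kappa>\<bar> \<le> L" "\<bar>4 * pi * k\<^sup>2 * \<sigma>\<bar> \<le> L"
        by (simp_all add: abs_mult \<sigma>(1))
      from det_perturbation[OF c c' bd \<tau>(2)]
      have "\<bar>(?C * ?S' - ?C' * ?S) - ((- 4 * pi * k\<^sup>2 * \<sigma>) * (4 * pi * k\<^sup>2 * \<sigma>) - (- 8 * pi * \<kappa>) * (8 * pi * \<kappa>))\<bar>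
         \<le> 2 * (\<tau> * (2 * L + 1))" .
      moreover have "?C * ?S' - ?C' * ?S = (b / e)\<^sup>2 * D \<kappa>"
        by (simp add: D_def power2_eq_square right_diff_distrib mult_ac)
      moreover have "(- 4 * pi * k\<^sup>2 * \<sigma>) * (4 * pi * k\<^sup>2 * \<sigma>) - (- 8 * pi * \<kappa>) * (8 * pi * \<kappa>)
          = - 16 * pi\<^sup>2 * k ^ 4 + 64 * pi\<^sup>2 * \<kappa>\<^sup>2"
      proof -
        have "(- 4 * pi * k\<^sup>2 * \<sigma>) * (4 * pi * k\<^sup>2 * \<sigma>) - (- 8 * pi * \<kappa>) * (8 * pi * \<kappa>)
          = - 16 * pi\<^sup>2 * k ^ 4 * (\<sigma> * \<sigma>) + 64 * pi\<^sup>2 * \<kappa>\<^sup>2" by algebra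
        then show ?thesis by (simp add: \<sigma>(2))
      qed
      ultimately show ?thesis using \<tau>(3) by simp
    qed
    have pk: "0 < pi\<^sup>2 * k ^ 4" using pos by simp
    have be: "0 < (b / e)\<^sup>2" using pos e by simp
    \<comment> \<open>The leading determinant is -16 pi^2 k^4 at \<kappa> = 0 and (64 - 16) pi^2 k^4
      at \<kappa> = k^2; the error cannot change either sign.\<close>
    have "\<bar>(b / e)\<^sup>2 * D 0 - - 16 * (pi\<^sup>2 * k ^ 4)\<bar> \<le> 2 * (pi\<^sup>2 * k ^ 4)" using det[of 0] K by simp
    then have "(b / e)\<^sup>2 * D 0 < 0" using pk by linarith
    then have D0: "D 0 < 0" using be by (simp add: mult_less_0_iff)
    have "\<bar>(b / e)\<^sup>2 * D K - 48 * (pi\<^sup>2 * k ^ 4)\<bar> \<le> 2 * (pi\<^sup>2 * k ^ 4)"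
      using det[of K] K by (simp add: K_def)
    then have "0 < (b / e)\<^sup>2 * D K" using pk by linarith
    then have DK: "0 < D K" using be by (simp add: zero_less_mult_iff)
    obtain \<kappa> where \<kappa>: "0 \<le> \<kappa>" "\<kappa> \<le> K" "D \<kappa> = 0"
      using IVT'[of D 0 0 K] D0 DK K contD by auto
    then have \<kappa>K: "\<kappa> \<in> {0..K}" by simp
    have "\<kappa> \<noteq> 0" using \<kappa>(3) D0 by auto
    then have \<kappa>_pos: "0 < \<kappa>" using \<kappa>(1) by simp
    obtain a a' where aa: "(a, a') \<noteq> (0, 0)" "a * cos_coeff (S \<kappa> (wc \<kappa>)) + a' * cos_coeff (S \<kappa> (ws \<kappa>)) = 0"
      "a * sin_coeff (S \<kappa> (wc \<kappa>)) + a' * sin_coeff (S \<kappa> (ws \<kappa>)) = 0"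
      using singular_2x2[OF \<kappa>(3)[unfolded D_def]] by blast
    define w where "w z = a * wc \<kappa> z + a' * ws \<kappa> z" for z
    define f where "f z = a * cos (z / 2) + a' * sin (z / 2)" for z
    have ap: "antiper w" "antiper f"
      unfolding w_def f_def by (intro antiper_lin wc(1) ws(1) \<kappa>K antiper_cos antiper_sin)+
    have Sw: "S \<kappa> w = (\<lambda>z. a * S \<kappa> (wc \<kappa>) z + a' * S \<kappa> (ws \<kappa>) z)"
      unfolding w_def[abs_def] by (rule antiper_opD(4)[OF S wc(1) ws(1)]) (use \<kappa>K in auto)
    have apS: "antiper (S \<kappa> w)" "antiper (S \<kappa> (wc \<kappa>))" "antiper (S \<kappa> (ws \<kappa>))"
      using antiper_opD(2)[OF S[OF \<kappa>K]] ap wc(1)[OF \<kappa>K] ws(1)[OF \<kappa>K] by auto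
    have "cos_coeff (S \<kappa> w) = 0" "sin_coeff (S \<kappa> w) = 0"
      unfolding Sw cos_coeff_lin[OF apS(2,3)] sin_coeff_lin[OF apS(2,3)] by (rule aa)+
    \<comment> \<open>On this combination the projection acts as the identity, so the projected
      equation is the full one.\<close>
    then have Q: "nonresonant_part (S \<kappa> w) = S \<kappa> w" by (simp add: nonresonant_part_def fun_eq_iff)
    have NS: "N (S \<kappa> v) z = N (wave_op b k d \<eta> v) z + \<kappa> * N (growth_op b e v) z" if "antiper v" for v z
      using antiper_opD(4)[OF N antiper_opD(2)[OF A1 that] antiper_opD(2)[OF A2 that], of 1 \<kappa>] unfolding S_def[abs_def] by simp
    have "N (S \<kappa> w) z = a * N (S \<kappa> (wc \<kappa>)) z + a' * N (S \<kappa> (ws \<kappa>)) z" for z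
      unfolding Sw antiper_opD(4)[OF N apS(2,3)] ..
    note NSw = this
    have weq: "w = (\<lambda>z. 1 * f z + 1 * N (S \<kappa> w) z)"
    proof
      fix z
      have comb: "a * x + a' * y = 1 * (a * p + a' * q) + 1 * (a * p' + a' * q')"
        if "x = p + p'" "y = q + q'" for x y p q p' q' :: real
        using that by (simp add: distrib_left)
      have "wc \<kappa> z = cos (z / 2) + N (S \<kappa> (wc \<kappa>)) z" "ws \<kappa> z = sin (z / 2) + N (S \<kappa> (ws \<kappa>)) z"
        unfolding NS[OF wc(1)[OF \<kappa>K]] NS[OF ws(1)[OF \<kappa>K]] by (rule wc(2)[OF \<kappa>K], rule ws(2)[OF \<kappa>K])
      from comb[OF this] show "w z = 1 * f z + 1 * N (S \<kappa> w) z"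
        unfolding NSw unfolding w_def f_def .
    qed
    have apN: "antiper (N (S \<kappa> w))" by (rule antiper_opD(2)[OF N apS(1)])
    have J: "anti_int (anti_int w) = (\<lambda>z. 1 * anti_int (anti_int f) z + 1 * anti_int (anti_int (N (S \<kappa> w))) z)"
      by (subst weq) (rule antiper_opD(4)[OF antiper_op_anti_int2 ap(2) apN])
    have JJ: "anti_int (anti_int (anti_int (anti_int w))) = (\<lambda>z. 1 * anti_int (anti_int (anti_int (anti_int f))) z + 1 * anti_int (anti_int (anti_int (anti_int (N (S \<kappa> w))))) z)"
      by (subst J) (rule antiper_opD(4)[OF antiper_op_anti_int2 antiper_opD(2)[OF antiper_op_anti_int2 ap(2)] antiper_opD(2)[OF antiper_op_anti_int2 apN]])
    have "w z + (1 / 4 + s\<^sup>2) * anti_int (anti_int w) z + s\<^sup>2 / 4 * anti_int (anti_int (anti_int (anti_int w))) z = S \<kappa> w z" for z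
    proof -
      have f0: "f z + (1 / 4 + s\<^sup>2) * anti_int (anti_int f) z + s\<^sup>2 / 4 * anti_int (anti_int (anti_int (anti_int f))) z = 0"
        using leading_kernel(2)[of a z a' "s\<^sup>2"] unfolding f_def[abs_def] .
      have n0: "N (S \<kappa> w) z + (1 / 4 + s\<^sup>2) * anti_int (anti_int (N (S \<kappa> w))) z + s\<^sup>2 / 4 * anti_int (anti_int (anti_int (anti_int (N (S \<kappa> w))))) z = S \<kappa> w z"
        using inv[OF apS(1), of z] unfolding Q .
      have "(f' + n') + p * (jf + jn) + q * (jjf + jjn) = r"
        if "f' + p * jf + q * jjf = 0" "n' + p * jn + q * jjn = r" for f' n' p jf jn q jjf jjn r :: real
        using that by (simp add: algebra_simps)
      from this[OF f0 n0] show ?thesis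
        using fun_cong[OF weq, of z] fun_cong[OF J, of z] fun_cong[OF JJ, of z] by simp
    qed
    then have eq: "b * (w z + (1 / 4 + s\<^sup>2) * anti_int (anti_int w) z + s\<^sup>2 / 4 * anti_int (anti_int (anti_int (anti_int w))) z)
            = - k\<^sup>2 * d * anti_int (anti_int w) z + 2 * k\<^sup>2 * anti_int (anti_int (\<lambda>t. \<eta> t * w t)) z + (\<kappa> * e) * anti_int (anti_int (anti_int w)) z" for z
      using pos(1) by (simp add: S_def wave_op_def growth_op_def distrib_left right_diff_distrib)
    have "\<exists>z. w z \<noteq> 0"
    proof (rule ccontr)
      assume "\<not> (\<exists>z. w z \<noteq> 0)"
      then have "w = (\<lambda>z. 0)" by (simp add: fun_eq_iff)
      then have "N (S \<kappa> w) = (\<lambda>z. 0)" using antiper_op_zero[OF S[OF \<kappa>K]] antiper_op_zero[OF N] by simp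
      then have "f z = 0" for z using weq \<open>w = (\<lambda>z. 0)\<close> by (simp add: fun_eq_iff)
      \<comment> \<open>The point 0 isolates the cosine coefficient, the point pi the sine
        coefficient.\<close>
      from this[of 0] this[of pi] have "a = 0" "a' = 0" by (simp_all add: f_def)
      then show False using aa(1) by simp
    qed
    moreover have "0 < \<kappa> * e" using \<kappa>_pos e(1) by simp
    ultimately show ?thesis using eq ap(1) by blast
  qed
  show thesis by (rule that[OF \<epsilon>0_pos main])
qed

section \<open>Regularity of the kernel element\<close>

text \<open>The recursion runs parallel to that of \<open>HT\<close>, so that membership in
  \<open>HT 4\<close> follows by induction.\<close>

primrec antiper_class :: "nat \<Rightarrow> (real \<Rightarrow> real) \<Rightarrow> bool" where
  "antiper_class 0 f \<longleftrightarrow> antiper f"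
| "antiper_class (Suc m) f \<longleftrightarrow>
     antiper f \<and> (\<exists>g. (\<forall>x. (f has_real_derivative g x) (at x)) \<and> antiper_class m g)"

lemma diff_class_antiper: "antiper_class m f \<Longrightarrow> antiper f"
  by (cases m) auto

lemma diff_class_Suc_le: "antiper_class (Suc m) f \<Longrightarrow> antiper_class m f"
proof (induction m arbitrary: f)
  case (Suc m)
  then obtain g where "antiper f" "\<forall>x. (f has_real_derivative g x) (at x)" "antiper_class (Suc m) g"
    by auto
  then show ?case using Suc.IH[of g] by auto
qed simp

lemma diff_class_anti_int: "antiper_class m f \<Longrightarrow> antiper_class (Suc m) (anti_int f)"
  unfolding antiper_class.simps(2)
  by (intro conjI exI[of _ f] allI anti_int_antiper anti_int_deriv diff_class_antiper)

lemma diff_class_lin: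
  "antiper_class m f \<Longrightarrow> antiper_class m g \<Longrightarrow> antiper_class m (\<lambda>z. a * f z + b * g z)"
proof (induction m arbitrary: f g)
  case 0 then show ?case by (simp add: antiper_lin)
next
  case (Suc m)
  then obtain f' g' where "\<forall>x. (f has_real_derivative f' x) (at x)" "antiper_class m f'"
    "\<forall>x. (g has_real_derivative g' x) (at x)" "antiper_class m g'" by auto
  moreover from this have "antiper_class m (\<lambda>z. a * f' z + b * g' z)" using Suc.IH by blast
  ultimately show ?case using Suc.prems
    by (auto intro!: antiper_lin exI[of _ "\<lambda>z. a * f' z + b * g' z"] derivative_eq_intros)
qed

lemma smooth_has_deriv: "smooth p \<Longrightarrow> (p has_real_derivative deriv p x) (at x)"
proof -
  assume "smooth p"
  then have "(deriv ^^ 0) p field_differentiable at x" unfolding smooth_def by blast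
  then show ?thesis by (simp add: DERIV_deriv_iff_field_differentiable)
qed

lemma smooth_deriv: "smooth p \<Longrightarrow> smooth (deriv p)"
proof -
  assume "smooth p"
  then have "(deriv ^^ Suc m) p field_differentiable at x" for m x unfolding smooth_def by blast
  then show ?thesis unfolding smooth_def funpow_Suc_right o_apply by blast
qed

lemma smooth_continuous: "smooth p \<Longrightarrow> continuous_on UNIV p"
  by (rule DERIV_continuous_on[OF has_field_derivative_at_within[OF smooth_has_deriv]])

lemma periodic_deriv:
  assumes "smooth p" "periodic_2pi p" shows "periodic_2pi (deriv p)"
proof -
  have "deriv p (z + 2 * pi) = deriv p z" for z
  proof -
    have "((\<lambda>z. p (z + 2 * pi)) has_real_derivative deriv p (z + 2 * pi) * 1) (at z)"
      by (rule DERIV_chain2[OF smooth_has_deriv[OF assms(1)]]) (auto intro!: derivative_eq_intros)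
    moreover have "(\<lambda>z. p (z + 2 * pi)) = p" using assms(2) unfolding periodic_2pi_def by blast
    ultimately have "(p has_real_derivative deriv p (z + 2 * pi)) (at z)" by simp
    then show ?thesis by (rule DERIV_unique[OF _ smooth_has_deriv[OF assms(1)]])
  qed
  then show ?thesis by (simp add: periodic_2pi_def)
qed

lemma diff_class_mult:
  "smooth p \<Longrightarrow> periodic_2pi p \<Longrightarrow> antiper_class m f \<Longrightarrow> antiper_class m (\<lambda>z. p z * f z)"
proof (induction m arbitrary: f p)
  case 0 then show ?case by (simp add: antiper_mult smooth_continuous)
next
  case (Suc m)
  then obtain f' where f': "\<forall>x. (f has_real_derivative f' x) (at x)" "antiper_class m f'" by auto
  have 1: "antiper_class m (\<lambda>z. deriv p z * f z)"
    by (rule Suc.IH[OF smooth_deriv[OF Suc.prems(1)] periodic_deriv[OF Suc.prems(1,2)] diff_class_Suc_le[OF Suc.prems(3)]])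
  have 2: "antiper_class m (\<lambda>z. p z * f' z)" by (rule Suc.IH[OF Suc.prems(1,2) f'(2)])
  have "antiper_class m (\<lambda>z. 1 * (deriv p z * f z) + 1 * (p z * f' z))" by (rule diff_class_lin[OF 1 2])
  moreover have "((\<lambda>z. p z * f z) has_real_derivative 1 * (deriv p x * f x) + 1 * (p x * f' x)) (at x)" for x
    using DERIV_mult[OF smooth_has_deriv[OF Suc.prems(1)] f'(1)[rule_format], of x] by (simp add: mult_ac)
  moreover have "antiper (\<lambda>z. p z * f z)"
    using Suc.prems antiper_mult smooth_continuous diff_class_antiper by blast
  ultimately show ?case unfolding antiper_class.simps(2)
    by (intro conjI exI[of _ "\<lambda>z. 1 * (deriv p z * f z) + 1 * (p z * f' z)"] allI)
qed

lemma divide_leading_coefficient: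
  fixes b :: real
  assumes "b \<noteq> 0"
  shows "b * (w + p * J + r * J') = A * J + B * E + m * I \<Longrightarrow>
      1 * ((A / b - p) * J + (B / b) * E) + 1 * ((m / b) * I + (- r) * J') = w"
    "b * (1 * ((A / b - p) * J + (B / b) * E) + 1 * ((m / b) * I + (- r) * J') + p * J + r * J') = A * J + B * E + m * I"
proof -
  have e: "b * (1 * ((A / b - p) * J + (B / b) * E) + 1 * ((m / b) * I + (- r) * J')) = A * J + B * E + m * I - b * (p * J + r * J')"
    for p J E m I r J'
    using assms by (simp add: distrib_left right_diff_distrib left_diff_distrib)
  show "b * (1 * ((A / b - p) * J + (B / b) * E) + 1 * ((m / b) * I + (- r) * J') + p * J + r * J') = A * J + B * E + m * I"
  proof -
    have "b * (X + y + z) = R" if "b * X = R - b * (y + z)" for X y z R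
      using that by (simp add: distrib_left)
    then show ?thesis using e .
  qed
  assume "b * (w + p * J + r * J') = A * J + B * E + m * I"
  then have "b * (1 * ((A / b - p) * J + (B / b) * E) + 1 * ((m / b) * I + (- r) * J')) = b * w"
    unfolding e by (simp add: distrib_left)
  then show "1 * ((A / b - p) * J + (B / b) * E) + 1 * ((m / b) * I + (- r) * J') = w"
    using mult_left_cancel[OF assms] by blast
qed

text \<open>A bootstrap: solved for w, the equation says w = J h, where h is built from w by
  operations that lose no derivative. Each pass therefore gains two derivatives, and h is
  w''.\<close>

lemma integrated_equation_regularity:
  assumes w: "antiper w" and \<eta>: "smooth \<eta>" "periodic_2pi \<eta>" and b: "b \<noteq> 0"
    and eq: "\<And>z. b * (w z + (1 / 4 + q) * anti_int (anti_int w) z + q / 4 * anti_int (anti_int (anti_int (anti_int w))) z)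
       = - k\<^sup>2 * d * anti_int (anti_int w) z + 2 * k\<^sup>2 * anti_int (anti_int (\<lambda>t. \<eta> t * w t)) z + \<mu> * anti_int (anti_int (anti_int w)) z"
  obtains w1 w2 where "antiper_class 4 w" "\<And>z. (w has_real_derivative w1 z) (at z)"
    "\<And>z. (w1 has_real_derivative w2 z) (at z)"
    "\<And>z. b * (w2 z + (1 / 4 + q) * w z + q / 4 * anti_int (anti_int w) z) = - k\<^sup>2 * d * w z + 2 * k\<^sup>2 * (\<eta> z * w z) + \<mu> * anti_int w z"
proof -
  \<comment> \<open>What w'' must be after two differentiations and division by b. The factors 1
    give it the nested shape a f + b g to which linearity of J applies.\<close>
  define h where "h z = 1 * ((- k\<^sup>2 * d / b - (1 / 4 + q)) * w z + (2 * k\<^sup>2 / b) * (\<eta> z * w z))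
      + 1 * ((\<mu> / b) * anti_int w z + (- (q / 4)) * anti_int (anti_int w) z)" for z
  have reg: "antiper_class m h" if "antiper_class m w" for m
    unfolding h_def[abs_def] using that
    by (intro diff_class_lin diff_class_mult[OF \<eta>] diff_class_Suc_le[OF diff_class_anti_int] diff_class_anti_int)
  have \<eta>w: "antiper (\<lambda>t. \<eta> t * w t)" by (rule antiper_mult[OF w smooth_continuous[OF \<eta>(1)] \<eta>(2)])
  have h: "antiper h" using reg[of 0] w by simp
  note ap = w \<eta>w anti_int_antiper[OF w] anti_int_antiper[OF anti_int_antiper[OF w]]
  have "anti_int (anti_int h) = (\<lambda>z. 1 * ((- k\<^sup>2 * d / b - (1 / 4 + q)) * anti_int (anti_int w) z + (2 * k\<^sup>2 / b) * anti_int (anti_int (\<lambda>t. \<eta> t * w t)) z)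
      + 1 * ((\<mu> / b) * anti_int (anti_int (anti_int w)) z + (- (q / 4)) * anti_int (anti_int (anti_int (anti_int w))) z))"
    unfolding h_def[abs_def] antiper_opD(4)[OF antiper_op_anti_int2 antiper_lin[OF ap(1,2)] antiper_lin[OF ap(3,4)]]
      antiper_opD(4)[OF antiper_op_anti_int2 ap(1,2)] antiper_opD(4)[OF antiper_op_anti_int2 ap(3,4)] ..
  moreover have "\<dots> = w"
  proof
    fix z
    show "1 * ((- k\<^sup>2 * d / b - (1 / 4 + q)) * anti_int (anti_int w) z + (2 * k\<^sup>2 / b) * anti_int (anti_int (\<lambda>t. \<eta> t * w t)) z)
      + 1 * ((\<mu> / b) * anti_int (anti_int (anti_int w)) z + (- (q / 4)) * anti_int (anti_int (anti_int (anti_int w))) z) = w z"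
      by (rule divide_leading_coefficient(1)[OF b eq])
  qed
  ultimately have wh: "anti_int (anti_int h) = w" by simp
  have "antiper_class (Suc (Suc m)) w" if "antiper_class m h" for m
    using diff_class_anti_int[OF diff_class_anti_int[OF that]] unfolding wh .
  \<comment> \<open>Two passes lead from class 0 to class 4.\<close>
  from this[OF reg[OF this[OF reg[of 0]]]] have "antiper_class 4 w"
    using w by (simp add: numeral_eq_Suc)
  moreover have "(w has_real_derivative anti_int h z) (at z)" for z
    using anti_int_deriv[OF anti_int_antiper[OF h]] unfolding wh .
  moreover have "b * (h z + (1 / 4 + q) * w z + q / 4 * anti_int (anti_int w) z)
      = - k\<^sup>2 * d * w z + 2 * k\<^sup>2 * (\<eta> z * w z) + \<mu> * anti_int w z" for z
    unfolding h_def by (rule divide_leading_coefficient(2)[OF b])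
  ultimately show thesis using that anti_int_deriv[OF h] by blast
qed

section \<open>Uniqueness of weak derivatives\<close>

text \<open>A supply of smooth periodic test functions. The sine is included to make the algebra
  closed under differentiation; the shift \<open>t\<close> is the centre of an arc later on.\<close>

inductive trig_poly :: "real \<Rightarrow> (real \<Rightarrow> real) \<Rightarrow> bool" for t where
  trig_const: "trig_poly t (\<lambda>z. a)"
| trig_cos: "trig_poly t (\<lambda>z. cos (z - t))"
| trig_sin: "trig_poly t (\<lambda>z. sin (z - t))"
| trig_add: "trig_poly t f \<Longrightarrow> trig_poly t g \<Longrightarrow> trig_poly t (\<lambda>z. f z + g z)"
| trig_mult: "trig_poly t f \<Longrightarrow> trig_poly t g \<Longrightarrow> trig_poly t (\<lambda>z. f z * g z)"

lemma trig_poly_deriv: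
  "trig_poly t f \<Longrightarrow> \<exists>g. trig_poly t g \<and> (\<forall>x. (f has_real_derivative g x) (at x))"
proof (induction rule: trig_poly.induct)
  case (trig_const a)
  show ?case by (rule exI[of _ "\<lambda>z. 0"]) (auto intro: trig_poly.intros)
next
  case trig_cos
  have "trig_poly t (\<lambda>z. (- 1) * sin (z - t))" by (intro trig_poly.intros)
  then show ?case by (intro exI[of _ "\<lambda>z. (- 1) * sin (z - t)"]) (auto intro!: derivative_eq_intros)
next
  case trig_sin
  show ?case by (rule exI[of _ "\<lambda>z. cos (z - t)"]) (auto intro!: derivative_eq_intros trig_poly.intros)
next
  case (trig_add f g)
  then obtain f' g' where "trig_poly t f'" "\<forall>x. (f has_real_derivative f' x) (at x)"
    "trig_poly t g'" "\<forall>x. (g has_real_derivative g' x) (at x)" by blast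
  then show ?case
    by (intro exI[of _ "\<lambda>z. f' z + g' z"]) (auto intro!: trig_poly.intros(4) DERIV_add)
next
  case (trig_mult f g)
  then obtain f' g' where "trig_poly t f'" "\<forall>x. (f has_real_derivative f' x) (at x)"
    "trig_poly t g'" "\<forall>x. (g has_real_derivative g' x) (at x)" by blast
  with trig_mult show ?case
    by (intro exI[of _ "\<lambda>z. f' z * g z + g' z * f z"]) (auto intro!: trig_poly.intros(4,5) DERIV_mult)
qed

lemma trig_poly_smooth: assumes "trig_poly t f" shows "smooth f"
proof -
  have "trig_poly t ((deriv ^^ m) f)" for m
  proof (induction m)
    case (Suc m)
    then obtain g where g: "trig_poly t g" "\<And>x. ((deriv ^^ m) f has_real_derivative g x) (at x)"
      using trig_poly_deriv by blast
    then have "deriv ((deriv ^^ m) f) = g" by (auto intro!: DERIV_imp_deriv)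
    then show ?case using g by simp
  qed (use assms in simp)
  then show ?thesis unfolding smooth_def using trig_poly_deriv field_differentiable_def by blast
qed

lemma trig_poly_periodic: "trig_poly t f \<Longrightarrow> periodic_2pi f"
proof (induction rule: trig_poly.induct)
  case trig_cos show ?case using cos_periodic[of "_ - t"] by (simp add: periodic_2pi_def diff_add_eq)
next
  case trig_sin show ?case using sin_periodic[of "_ - t"] by (simp add: periodic_2pi_def diff_add_eq)
qed (auto simp: periodic_2pi_def)

lemma trig_poly_of_polynomial: "real_polynomial_function p \<Longrightarrow> trig_poly t (\<lambda>z. p (cos (z - t)))"
proof (induction rule: real_polynomial_function.induct)
  case (linear f)
  have "f (cos (z - t)) = cos (z - t) * f 1" for z
    using linear_cmul[OF bounded_linear.linear[OF linear], of "cos (z - t)" 1] by simp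
  then have "(\<lambda>z. f (cos (z - t))) = (\<lambda>z. cos (z - t) * f 1)" by (simp add: fun_eq_iff)
  moreover have "trig_poly t (\<lambda>z. cos (z - t) * f 1)" by (intro trig_poly.intros)
  ultimately show ?case by (simp only:)
qed (auto intro: trig_poly.intros)

text \<open>On the circle, (0, x) is the arc with centre x/2 and half-width x/2 <= pi, and the
  cosine of the distance to the centre decreases with that distance. The indicator of an arc is thus
  a function of cos (z - x/2) alone.\<close>

lemma arc_iff:
  assumes "0 \<le> x" "x \<le> 2 * pi" "0 \<le> z" "z \<le> 2 * pi"
  shows "cos (x / 2) < cos (z - x / 2) \<longleftrightarrow> 0 < z \<and> z < x"
proof -
  consider "z = 0" | "0 < z" "z < x / 2" | "0 < z" "x / 2 \<le> z" "z < x" | "x \<le> z" "z - x / 2 \<le> pi" | "x \<le> z" "pi < z - x / 2"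
    using assms by linarith
  then show ?thesis
  proof cases
    case 2
    have "cos (x / 2) < cos (x / 2 - z)" using 2 assms by (intro cos_monotone_0_pi) auto
    then show ?thesis using 2 by (metis cos_minus minus_diff_eq order_less_trans field_sum_of_halves less_add_same_cancel1)
  next
    case 3
    have "cos (x / 2) < cos (z - x / 2)" using 3 assms by (intro cos_monotone_0_pi) auto
    then show ?thesis using 3 by simp
  next
    case 4
    have "cos (z - x / 2) \<le> cos (x / 2)" using 4 assms by (intro cos_monotone_0_pi_le) auto
    then show ?thesis using 4 by simp
  next
    case 5
    have "cos (2 * pi - (z - x / 2)) \<le> cos (x / 2)" using 5 assms by (intro cos_monotone_0_pi_le) auto
    moreover have "cos (2 * pi - (z - x / 2)) = cos (z - x / 2)" by (rule cos_2pi_minus)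
    ultimately show ?thesis using 5 by simp
  qed auto
qed

text \<open>Dynkin's argument: the half-lines are stable under intersection and generate the Borel
  sets; the total integral is what handles complements.\<close>

lemma AE_zero_of_atMost_integrals:
  fixes U :: "real \<Rightarrow> complex"
  assumes U: "integrable lborel U" and total: "integral\<^sup>L lborel U = 0"
    and zero: "\<And>x. set_lebesgue_integral lborel {..x} U = 0"
  shows "AE z in lborel. U z = 0"
proof (rule sigma_finite_measure.density_zero[OF sigma_finite_lborel U])
  fix A :: "real set" assume "A \<in> sets lborel"
  have subset_Pow_UNIV: "range (\<lambda>a::real. {..a}) \<subseteq> Pow UNIV" by simp
  from \<open>A \<in> sets lborel\<close> have A: "A \<in> sigma_sets UNIV (range (\<lambda>a::real. {..a}))"
    by (simp add: borel_eq_atMost)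
  have "Int_stable (range (\<lambda>a::real. {..a}))"
    by (auto simp: Int_stable_def intro!: image_eqI)
  from this subset_Pow_UNIV A show "set_lebesgue_integral lborel A U = 0"
  proof (induction rule: sigma_sets_induct_disjoint)
    case (basic A) then show ?case using zero by auto
  next
    case empty show ?case by (simp add: set_lebesgue_integral_def)
  next
    case (compl A)
    have "A \<in> sets borel" using compl by (simp add: borel_eq_atMost)
    then have m: "A \<in> sets borel" "- A \<in> sets borel" by auto
    have int: "set_integrable lborel B U" if "B \<in> sets borel" for B
      unfolding set_integrable_def using that U by (intro integrable_mult_indicator) auto
    have "set_lebesgue_integral lborel (A \<union> - A) U = set_lebesgue_integral lborel A U + set_lebesgue_integral lborel (- A) U"
      by (intro set_integral_Un int m) auto
    then show ?case using compl total by (simp add: set_lebesgue_integral_def Compl_eq_Diff_UNIV)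
  next
    case (union A)
    have m: "A i \<in> sets borel" for i using union by (auto simp: borel_eq_atMost)
    have "set_integrable lborel (\<Union>i. A i) U"
      unfolding set_integrable_def using m U by (intro integrable_mult_indicator) auto
    then have "set_lebesgue_integral lborel (\<Union>i. A i) U = (\<Sum>i. set_lebesgue_integral lborel (A i) U)"
      using union m by (intro lebesgue_integral_countable_add) (auto simp: disjoint_family_on_def)
    then show ?case using union by simp
  qed
qed

text \<open>The tests are enlarged from polynomials in cos (z - t) to continuous functions of it by
  uniform approximation on [-1, 1], then to indicators of arcs by dominated convergence. Arcs
  starting at 0 determine all half-lines.\<close>

lemma smooth_test_zero:
  fixes u :: "real \<Rightarrow> complex"
  assumes u: "set_integrable lborel {0..2 * pi} u"
    and test: "\<And>\<psi>. smooth \<psi> \<Longrightarrow> periodic_2pi \<psi> \<Longrightarrow> (LINT z:{0..2 * pi}|lborel. u z * complex_of_real (\<psi> z)) = 0"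
  shows "AE z in lborel. z \<in> {0..2 * pi} \<longrightarrow> u z = 0"
proof -
  define U where "U z = indicat_real {0..2 * pi} z *\<^sub>R u z" for z
  have U: "integrable lborel U" using u unfolding U_def[abs_def] set_integrable_def .
  then have Um: "U \<in> borel_measurable borel" by auto
  have prodint: "integrable lborel (\<lambda>z. U z * complex_of_real (g z))"
    if "g \<in> borel_measurable borel" "\<And>z. \<bar>g z\<bar> \<le> M" for g :: "real \<Rightarrow> real" and M
  proof (rule Bochner_Integration.integrable_bound)
    show "integrable lborel (\<lambda>z. U z * of_real M)" using U by simp
    have "norm (U z * complex_of_real (g z)) \<le> norm (U z * complex_of_real M)" for z
      using that(2)[of z] by (auto simp: norm_mult intro!: mult_left_mono)
    then show "AE z in lborel. norm (U z * complex_of_real (g z)) \<le> norm (U z * complex_of_real M)" by simp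
  qed (use Um that(1) in measurable)
  have poly: "(LINT z|lborel. U z * complex_of_real (p (cos (z - t)))) = 0" if "real_polynomial_function p" for p t
    using test[OF trig_poly_smooth[OF trig_poly_of_polynomial[OF that]] trig_poly_periodic[OF trig_poly_of_polynomial[OF that]], of t]
    unfolding U_def set_lebesgue_integral_def by simp
  have cont: "(LINT z|lborel. U z * complex_of_real (G (cos (z - t)))) = 0" if G: "continuous_on UNIV G" for G :: "real \<Rightarrow> real" and t
  proof -
    define I where "I = (LINT z|lborel. norm (U z))"
    have I0: "0 \<le> I" unfolding I_def by simp
    have Gm: "G \<in> borel_measurable borel" using G by (rule borel_measurable_continuous_onI)
    have "bounded (G ` {-1..1})"
      by (intro compact_imp_bounded compact_continuous_image continuous_on_subset[OF G]) auto
    then obtain B where "\<forall>y\<in>{-1..1}. \<bar>G y\<bar> \<le> B" by (auto simp: bounded_iff)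
    then have B: "\<And>y. y \<in> {-1..1} \<Longrightarrow> \<bar>G y\<bar> \<le> B" by blast
    have small: "norm (LINT z|lborel. U z * complex_of_real (G (cos (z - t)))) \<le> \<epsilon> * I" if \<epsilon>: "0 < \<epsilon>" for \<epsilon>
    proof -
      obtain p where p: "real_polynomial_function p" "\<And>y. y \<in> {-1..1} \<Longrightarrow> \<bar>G y - p y\<bar> < \<epsilon>"
        using Stone_Weierstrass_real_polynomial_function[of "{-1..1::real}" G \<epsilon>] continuous_on_subset[OF G] \<epsilon> by auto
      have pc: "continuous_on UNIV p"
        using p(1) by (simp add: continuous_on_polymonial_function real_polynomial_function_eq)
      then have pm: "p \<in> borel_measurable borel" by (rule borel_measurable_continuous_onI)
      have pB: "\<bar>p y\<bar> \<le> B + \<epsilon>" if "y \<in> {-1..1}" for y using B[OF that] p(2)[OF that] by linarith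
      have c: "cos y \<in> {-1..1}" for y :: real by simp
      have i1: "integrable lborel (\<lambda>z. U z * complex_of_real (G (cos (z - t))))"
        by (rule prodint[of _ B]) (use Gm B[OF c] in measurable)
      have i2: "integrable lborel (\<lambda>z. U z * complex_of_real (p (cos (z - t))))"
        by (rule prodint[of _ "B + \<epsilon>"]) (use pm pB[OF c] in measurable)
      have "(LINT z|lborel. U z * complex_of_real (G (cos (z - t))))
          = (LINT z|lborel. U z * complex_of_real (G (cos (z - t))) - U z * complex_of_real (p (cos (z - t))))"
        using poly[OF p(1), of t] i1 i2 by simp
      also have "norm \<dots> \<le> (LINT z|lborel. norm (U z) * \<epsilon>)"
      proof (rule order_trans[OF integral_norm_bound])
        show "(LINT z|lborel. norm (U z * complex_of_real (G (cos (z - t))) - U z * complex_of_real (p (cos (z - t)))))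
           \<le> (LINT z|lborel. norm (U z) * \<epsilon>)"
        proof (rule integral_mono)
          show "norm (U z * complex_of_real (G (cos (z - t))) - U z * complex_of_real (p (cos (z - t)))) \<le> norm (U z) * \<epsilon>" for z
          proof -
            have "U z * complex_of_real (G (cos (z - t))) - U z * complex_of_real (p (cos (z - t)))
               = U z * complex_of_real (G (cos (z - t)) - p (cos (z - t)))" by (simp add: algebra_simps)
            then have "norm (U z * complex_of_real (G (cos (z - t))) - U z * complex_of_real (p (cos (z - t))))
               = norm (U z) * \<bar>G (cos (z - t)) - p (cos (z - t))\<bar>" by (simp add: norm_mult del: of_real_diff)
            then show ?thesis using p(2)[OF c, of "z - t"] by (simp add: mult_left_mono)
          qed
        qed (use U i1 i2 in auto)
      qed
      also have "\<dots> = \<epsilon> * I" by (simp add: I_def)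
      finally show ?thesis .
    qed
    have "norm (LINT z|lborel. U z * complex_of_real (G (cos (z - t)))) \<le> 0"
    proof (rule field_le_epsilon)
      fix e :: real assume e: "0 < e"
      \<comment> \<open>The added 1 covers the case I = 0.\<close>
      have "e / (I + 1) * I \<le> e" using e I0 by (simp add: field_simps)
      then show "norm (LINT z|lborel. U z * complex_of_real (G (cos (z - t)))) \<le> 0 + e"
        using small[of "e / (I + 1)"] e I0 by simp
    qed
    then show ?thesis by simp
  qed
  have arc: "set_lebesgue_integral lborel {0<..<x} U = 0" if x: "0 \<le> x" "x \<le> 2 * pi" for x
  proof -
    \<comment> \<open>Continuous ramps with pointwise limit the indicator of y > cos (x/2); they
      vanish at the threshold itself, matching the open arc.\<close>
    define G where "G n y = max 0 (min 1 (real n * (y - cos (x / 2))))" for n y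
    have Gc: "continuous_on UNIV (G n)" for n unfolding G_def by (intro continuous_intros)
    have Gm: "G n \<in> borel_measurable borel" for n using Gc by (rule borel_measurable_continuous_onI)
    have lim: "(\<lambda>n. G n y) \<longlonglongrightarrow> (if cos (x / 2) < y then 1 else 0)" for y
    proof (cases "cos (x / 2) < y")
      case True
      obtain N where N: "1 / (y - cos (x / 2)) \<le> real N" using real_arch_simple by blast
      have "G n y = 1" if "n \<ge> N" for n
      proof -
        have "1 / (y - cos (x / 2)) \<le> real n" using N that by linarith
        then have "1 \<le> real n * (y - cos (x / 2))" using True by (simp add: divide_le_eq)
        then show ?thesis by (simp add: G_def)
      qed
      then have "eventually (\<lambda>n. G n y = 1) sequentially" by (auto simp: eventually_sequentially)
      then show ?thesis using True by (simp add: tendsto_eventually)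
    next
      case False
      have "real n * (y - cos (x / 2)) \<le> 0" for n
        using False by (intro mult_nonneg_nonpos) auto
      then have "G n y = 0" for n by (metis G_def max.absorb1 min.coboundedI2)
      then show ?thesis using False by simp
    qed
    have "(\<lambda>n. LINT z|lborel. U z * complex_of_real (G n (cos (z - x / 2)))) \<longlonglongrightarrow>
        (LINT z|lborel. U z * complex_of_real (if cos (x / 2) < cos (z - x / 2) then 1 else 0))"
    proof (rule integral_dominated_convergence[where w = "\<lambda>z. norm (U z)"])
      show "AE z in lborel. (\<lambda>n. U z * complex_of_real (G n (cos (z - x / 2)))) \<longlonglongrightarrow>
          U z * complex_of_real (if cos (x / 2) < cos (z - x / 2) then 1 else 0)"
        by (intro AE_I2 tendsto_intros lim)
      show "AE z in lborel. norm (U z * complex_of_real (G n (cos (z - x / 2)))) \<le> norm (U z)" for n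
        by (auto simp: norm_mult G_def intro!: mult_left_le)
    qed (use U Um Gm in \<open>auto intro!: measurable\<close>)
    then have "(LINT z|lborel. U z * complex_of_real (if cos (x / 2) < cos (z - x / 2) then 1 else 0)) = 0"
      using cont[OF Gc] LIMSEQ_unique[OF _ tendsto_const] by auto
    moreover have "U z * complex_of_real (if cos (x / 2) < cos (z - x / 2) then 1 else 0) = indicator {0<..<x} z *\<^sub>R U z" for z
      using arc_iff[OF x, of z] by (auto simp: U_def indicator_def)
    ultimately show ?thesis unfolding set_lebesgue_integral_def by simp
  qed
  have ae: "AE z in lborel. z \<noteq> (a::real)" for a by (rule AE_lborel_singleton)
  \<comment> \<open>U vanishes outside [0, 2 pi], so up to endpoints a half-line acts as an arc
    whose end is clamped to the period.\<close>
  have Ux: "set_lebesgue_integral lborel {..x} U = set_lebesgue_integral lborel {0<..<max 0 (min x (2 * pi))} U" for x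
    unfolding set_lebesgue_integral_def
  proof (rule integral_cong_AE)
    show "AE z in lborel. indicat_real {..x} z *\<^sub>R U z = indicat_real {0<..<max 0 (min x (2 * pi))} z *\<^sub>R U z"
      using ae[of 0] ae[of x] ae[of "2 * pi"] by eventually_elim (auto simp: U_def indicator_def)
  qed (use Um in auto)
  have "AE z in lborel. U z = 0"
  proof (rule AE_zero_of_atMost_integrals[OF U])
    show zero: "set_lebesgue_integral lborel {..x} U = 0" for x
      unfolding Ux by (rule arc) auto
    have "integral\<^sup>L lborel U = set_lebesgue_integral lborel {..2 * pi} U"
      unfolding set_lebesgue_integral_def by (rule Bochner_Integration.integral_cong) (auto simp: U_def indicator_def)
    then show "integral\<^sup>L lborel U = 0" using zero by simp
  qed
  then show ?thesis by eventually_elim (auto simp: U_def)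
qed

text \<open>The exceptional set is covered by countably many translates of its part in one period,
  which is null.\<close>

lemma ae_zero_periodic:
  fixes u :: "real \<Rightarrow> complex"
  assumes m: "u \<in> borel_measurable borel" and per: "periodic_2pi u"
    and ae: "AE z in lborel. z \<in> {0..2 * pi} \<longrightarrow> u z = 0"
  shows "AE z in lborel. u z = 0"
proof -
  let ?N = "{z. u z \<noteq> 0}"
  have N: "?N \<in> sets borel" using m by measurable
  have "?N \<inter> {0..2 * pi} \<in> null_sets lborel"
    using ae N by (intro AE_iff_null_sets[THEN iffD2]) (auto elim: eventually_mono)
  then have "negligible (?N \<inter> {0..2 * pi})"
    using N by (simp add: negligible_iff_null_sets null_sets_completion_iff)
  then have "negligible (\<Union>n::int. (+) (2 * pi * of_int n) ` (?N \<inter> {0..2 * pi}))"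
    by (intro negligible_countable_Union) (auto intro: negligible_translation)
  moreover have "?N \<subseteq> (\<Union>n::int. (+) (2 * pi * of_int n) ` (?N \<inter> {0..2 * pi}))"
  proof
    fix z assume z: "z \<in> ?N"
    obtain n :: int where n: "z - 2 * pi * of_int n \<in> {0..2 * pi}" using shift_to_period by blast
    have "u z = u (z - 2 * pi * of_int n)"
      using periodic_2pi_int[OF per, of "z - 2 * pi * of_int n" n] by simp
    then have "z - 2 * pi * of_int n \<in> ?N \<inter> {0..2 * pi}" using z n by simp
    moreover have "z = 2 * pi * of_int n + (z - 2 * pi * of_int n)" by simp
    ultimately show "z \<in> (\<Union>n::int. (+) (2 * pi * of_int n) ` (?N \<inter> {0..2 * pi}))" by blast
  qed
  ultimately have "negligible ?N" by (rule negligible_subset)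
  then have "?N \<in> null_sets lborel"
    using N by (simp add: negligible_iff_null_sets null_sets_completion_iff)
  then show ?thesis using AE_iff_null_sets[of ?N lborel] N by simp
qed

section \<open>Square integrable functions and their weak derivatives\<close>

lemma L2T_D:
  assumes "f \<in> L2T"
  shows "f \<in> borel_measurable borel" "periodic_2pi f" "set_integrable lborel {0..2 * pi} f"
    "set_integrable lborel {0..2 * pi} (\<lambda>z. (cmod (f z))\<^sup>2)"
proof -
  show m: "f \<in> borel_measurable borel" and "periodic_2pi f"
    and sq: "set_integrable lborel {0..2 * pi} (\<lambda>z. (cmod (f z))\<^sup>2)"
    using assms unfolding L2T_def by auto
  have one: "set_integrable lborel {0..2 * pi} (\<lambda>z. 1 :: real)"
    by (rule borel_integrable_atLeastAtMost') (intro continuous_intros)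
  have "set_integrable lborel {0..2 * pi} (\<lambda>z. 1 + (cmod (f z))\<^sup>2)"
    using set_integral_add(1)[OF one sq] .
  then show "set_integrable lborel {0..2 * pi} f"
  proof (rule set_integrable_bound)
    show "set_borel_measurable lborel {0..2 * pi} f"
      unfolding set_borel_measurable_def using m by measurable
    have "norm (f z) \<le> norm (1 + (cmod (f z))\<^sup>2)" for z
    proof -
      \<comment> \<open>Expanding the square gives |f| <= |f|^2 + 1/4, which is below the integrable
        majorant.\<close>
      have "0 \<le> (cmod (f z) - 1 / 2)\<^sup>2" by simp
      then show ?thesis by (simp add: power2_eq_square algebra_simps)
    qed
    then show "AE z in lborel. z \<in> {0..2 * pi} \<longrightarrow> norm (f z) \<le> norm (1 + (cmod (f z))\<^sup>2)" by simp
  qed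
qed

lemma test_integrable:
  assumes "f \<in> L2T" "continuous_on UNIV \<psi>" "periodic_2pi \<psi>"
  shows "set_integrable lborel {0..2 * pi} (\<lambda>z. f z * complex_of_real (\<psi> z))"
proof -
  have "bounded (\<psi> ` {0..2 * pi})"
    by (intro compact_imp_bounded compact_continuous_image continuous_on_subset[OF assms(2)]) auto
  then obtain B where "\<forall>z\<in>{0..2 * pi}. \<bar>\<psi> z\<bar> \<le> B" by (auto simp: bounded_iff)
  then have B: "\<bar>\<psi> z\<bar> \<le> B" if "z \<in> {0..2 * pi}" for z using that by blast
  have \<psi>m: "\<psi> \<in> borel_measurable borel" using assms(2) by (rule borel_measurable_continuous_onI)
  have "set_integrable lborel {0..2 * pi} (\<lambda>z. f z * complex_of_real B)"
    using L2T_D(3)[OF assms(1)] by simp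
  then show ?thesis
  proof (rule set_integrable_bound)
    show "set_borel_measurable lborel {0..2 * pi} (\<lambda>z. f z * complex_of_real (\<psi> z))"
      unfolding set_borel_measurable_def using L2T_D(1)[OF assms(1)] \<psi>m by measurable
    have "norm (f z * complex_of_real (\<psi> z)) \<le> norm (f z * complex_of_real B)" if "z \<in> {0..2 * pi}" for z
      using B[OF that] by (auto simp: norm_mult intro!: mult_left_mono)
    then show "AE z in lborel. z \<in> {0..2 * pi} \<longrightarrow> norm (f z * complex_of_real (\<psi> z)) \<le> norm (f z * complex_of_real B)"
      by simp
  qed
qed

text \<open>This makes the choice in \<open>weak_deriv\<close> harmless: any representative agrees
  almost everywhere with a classical derivative when there is one.\<close>

lemma has_weak_deriv_unique:
  assumes g: "has_weak_deriv f g" and h: "has_weak_deriv f h" shows "ae_eq g h"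
proof -
  have L: "g \<in> L2T" "h \<in> L2T" using g h by (auto simp: has_weak_deriv_def)
  have "AE z in lborel. z \<in> {0..2 * pi} \<longrightarrow> g z - h z = 0"
  proof (rule smooth_test_zero)
    show "set_integrable lborel {0..2 * pi} (\<lambda>z. g z - h z)"
      by (rule set_integral_diff(1)[OF L2T_D(3)[OF L(1)] L2T_D(3)[OF L(2)]])
    fix \<psi> assume \<psi>: "smooth \<psi>" "periodic_2pi \<psi>"
    have "(LINT z:{0..2 * pi}|lborel. g z * complex_of_real (\<psi> z)) = (LINT z:{0..2 * pi}|lborel. h z * complex_of_real (\<psi> z))"
    proof -
      have "(LINT z:{0..2 * pi}|lborel. f z * complex_of_real (deriv \<psi> z)) = - (LINT z:{0..2 * pi}|lborel. g z * complex_of_real (\<psi> z))"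
        "(LINT z:{0..2 * pi}|lborel. f z * complex_of_real (deriv \<psi> z)) = - (LINT z:{0..2 * pi}|lborel. h z * complex_of_real (\<psi> z))"
        using g h \<psi> unfolding has_weak_deriv_def by blast+
      then show ?thesis by simp
    qed
    then show "(LINT z:{0..2 * pi}|lborel. (g z - h z) * complex_of_real (\<psi> z)) = 0"
      using set_integral_diff(2)[OF test_integrable[OF L(1) smooth_continuous[OF \<psi>(1)] \<psi>(2)]
          test_integrable[OF L(2) smooth_continuous[OF \<psi>(1)] \<psi>(2)]]
      by (simp add: left_diff_distrib)
  qed
  moreover have "(\<lambda>z. g z - h z) \<in> borel_measurable borel" "periodic_2pi (\<lambda>z. g z - h z)"
    using L2T_D(1,2)[OF L(1)] L2T_D(1,2)[OF L(2)] by (auto simp: periodic_2pi_def)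
  ultimately have "AE z in lborel. g z - h z = 0" by (intro ae_zero_periodic)
  then show ?thesis unfolding ae_eq_def by simp
qed

section \<open>Representatives of continuous periodic functions\<close>

definition cper :: "(real \<Rightarrow> complex) \<Rightarrow> bool" where
  "cper g \<longleftrightarrow> continuous_on UNIV g \<and> periodic_2pi g"

text \<open>The weak derivative is a choice up to null sets, so every function built from it is only
  known to be a representative of a continuous one.\<close>

definition rep :: "(real \<Rightarrow> complex) \<Rightarrow> (real \<Rightarrow> complex) \<Rightarrow> bool" where
  "rep f g \<longleftrightarrow> f \<in> borel_measurable borel \<and> periodic_2pi f \<and> ae_eq f g"

lemma rep_refl: "cper g \<Longrightarrow> rep g g"
  by (auto simp: rep_def cper_def ae_eq_def intro: borel_measurable_continuous_onI)

lemma rep_add: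
  assumes "rep f g" "rep f' g'" shows "rep (\<lambda>z. f z + f' z) (\<lambda>z. g z + g' z)"
  unfolding rep_def ae_eq_def
proof (intro conjI)
  have m: "f \<in> borel_measurable borel" "f' \<in> borel_measurable borel" and p: "periodic_2pi f" "periodic_2pi f'"
    and ae: "AE z in lborel. f z = g z" "AE z in lborel. f' z = g' z"
    using assms by (auto simp: rep_def ae_eq_def)
  show "(\<lambda>z. f z + f' z) \<in> borel_measurable borel" using m by measurable
  show "periodic_2pi (\<lambda>z. f z + f' z)" using p by (simp add: periodic_2pi_def)
  show "AE z in lborel. f z + f' z = g z + g' z" using ae by eventually_elim simp
qed

lemma rep_mult:
  assumes "cper p" "rep f g" shows "rep (\<lambda>z. p z * f z) (\<lambda>z. p z * g z)"
  unfolding rep_def ae_eq_def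
proof (intro conjI)
  have "p \<in> borel_measurable borel" using assms(1) unfolding cper_def by (intro borel_measurable_continuous_onI) simp
  moreover have "f \<in> borel_measurable borel" "periodic_2pi f" and ae: "AE z in lborel. f z = g z"
    using assms by (auto simp: rep_def ae_eq_def)
  ultimately show "(\<lambda>z. p z * f z) \<in> borel_measurable borel" "periodic_2pi (\<lambda>z. p z * f z)"
    using assms(1) by (simp_all add: cper_def periodic_2pi_def)
  show "AE z in lborel. p z * f z = p z * g z" using ae by eventually_elim simp
qed

lemma cper_const: "cper (\<lambda>z. a)"
  by (simp add: cper_def periodic_2pi_def)

lemma rep_scale: "rep f g \<Longrightarrow> rep (\<lambda>z. a * f z) (\<lambda>z. a * g z)"
  by (rule rep_mult[OF cper_const])

lemma rep_diff:
  assumes "rep f g" "rep f' g'" shows "rep (\<lambda>z. f z - f' z) (\<lambda>z. g z - g' z)"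
  using rep_add[OF assms(1) rep_scale[OF assms(2), of "- 1"]] by simp

lemma rep_L2T:
  assumes f: "rep f g" and g: "cper g" shows "f \<in> L2T"
proof -
  have m: "f \<in> borel_measurable borel" "periodic_2pi f" "AE z in lborel. f z = g z"
    using f by (auto simp: rep_def ae_eq_def)
  have "set_integrable lborel {0..2 * pi} (\<lambda>z. (cmod (g z))\<^sup>2)"
    using g unfolding cper_def by (intro borel_integrable_atLeastAtMost' continuous_intros) (auto intro: continuous_on_subset)
  moreover have gm: "g \<in> borel_measurable borel"
    using g unfolding cper_def by (intro borel_measurable_continuous_onI) simp
  have "integrable lborel (\<lambda>z. indicat_real {0..2 * pi} z *\<^sub>R (cmod (f z))\<^sup>2) \<longleftrightarrow>
      integrable lborel (\<lambda>z. indicat_real {0..2 * pi} z *\<^sub>R (cmod (g z))\<^sup>2)"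
  proof (rule integrable_cong_AE)
    show "AE z in lborel. indicat_real {0..2 * pi} z *\<^sub>R (cmod (f z))\<^sup>2 = indicat_real {0..2 * pi} z *\<^sub>R (cmod (g z))\<^sup>2"
      using m(3) by eventually_elim simp
  qed (use m(1) gm in measurable)
  ultimately have "set_integrable lborel {0..2 * pi} (\<lambda>z. (cmod (f z))\<^sup>2)"
    unfolding set_integrable_def by blast
  then show ?thesis using m by (simp add: L2T_def)
qed

text \<open>Integration by parts over one period for the continuous g, with boundary terms
  cancelling by periodicity; under the integral f may be exchanged for g.\<close>

lemma rep_has_weak_deriv:
  assumes f: "rep f g" and g: "cper g" "cper g'" and d: "\<And>z. (g has_vector_derivative g' z) (at z)"
  shows "has_weak_deriv f g'"
  unfolding has_weak_deriv_def
proof (intro conjI allI impI)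
  show "f \<in> L2T" by (rule rep_L2T[OF f g(1)])
  show "g' \<in> L2T" by (rule rep_L2T[OF rep_refl[OF g(2)] g(2)])
  fix \<psi> assume \<psi>: "smooth \<psi>" "periodic_2pi \<psi>"
  note \<psi>c = smooth_continuous[OF \<psi>(1)] smooth_continuous[OF smooth_deriv[OF \<psi>(1)]]
  have gc: "continuous_on UNIV g" "continuous_on UNIV g'" using g by (auto simp: cper_def)
  have fm: "f \<in> borel_measurable borel" "AE z in lborel. f z = g z" using f by (auto simp: rep_def ae_eq_def)
  have [measurable]: "deriv \<psi> \<in> borel_measurable borel" "g \<in> borel_measurable borel" "f \<in> borel_measurable borel"
    using \<psi>c gc fm by (auto intro: borel_measurable_continuous_onI)
  have 1: "(LINT z:{0..2 * pi}|lborel. f z * complex_of_real (deriv \<psi> z)) = (LINT z:{0..2 * pi}|lborel. g z * complex_of_real (deriv \<psi> z))"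
  proof (rule set_lebesgue_integral_cong_AE)
    show "AE z\<in>{0..2 * pi} in lborel. f z * complex_of_real (deriv \<psi> z) = g z * complex_of_real (deriv \<psi> z)"
      using fm(2) by eventually_elim simp
  qed measurable
  have c: "continuous_on UNIV (\<lambda>z. g z * complex_of_real (deriv \<psi> z))"
      "continuous_on UNIV (\<lambda>z. g' z * complex_of_real (\<psi> z))"
    by (intro continuous_intros gc \<psi>c)+
  have i: "set_integrable lborel {0..2 * pi} (\<lambda>z. g z * complex_of_real (deriv \<psi> z))"
    "set_integrable lborel {0..2 * pi} (\<lambda>z. g' z * complex_of_real (\<psi> z))"
    by (rule borel_integrable_atLeastAtMost'[OF continuous_on_subset[OF c(1) subset_UNIV]],
        rule borel_integrable_atLeastAtMost'[OF continuous_on_subset[OF c(2) subset_UNIV]])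
  have prod: "((\<lambda>z. g z * complex_of_real (\<psi> z)) has_vector_derivative
      g z * complex_of_real (deriv \<psi> z) + g' z * complex_of_real (\<psi> z)) (at z)" for z
    by (rule has_vector_derivative_mult[OF d])
      (rule has_vector_derivative_of_real[OF smooth_has_deriv[OF \<psi>(1)]])
  have "integral\<^sup>L lborel (\<lambda>z. indicator {0..2 * pi} z *\<^sub>R (g z * complex_of_real (deriv \<psi> z) + g' z * complex_of_real (\<psi> z)))
     = g (2 * pi) * complex_of_real (\<psi> (2 * pi)) - g 0 * complex_of_real (\<psi> 0)"
    by (rule integral_FTC_atLeastAtMost[OF _ has_vector_derivative_at_within[OF prod]
          continuous_on_subset[OF continuous_on_add[OF c] subset_UNIV]]) simp
  also have "\<dots> = 0"
  proof -
    have "g (0 + 2 * pi) = g 0" "\<psi> (0 + 2 * pi) = \<psi> 0"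
      using g(1) \<psi>(2) unfolding cper_def periodic_2pi_def by blast+
    then show ?thesis by simp
  qed
  finally have "(LINT z:{0..2 * pi}|lborel. g z * complex_of_real (deriv \<psi> z) + g' z * complex_of_real (\<psi> z)) = 0"
    unfolding set_lebesgue_integral_def .
  then have "(LINT z:{0..2 * pi}|lborel. g z * complex_of_real (deriv \<psi> z)) + (LINT z:{0..2 * pi}|lborel. g' z * complex_of_real (\<psi> z)) = 0"
    unfolding set_integral_add(2)[OF i] .
  then show "(LINT z:{0..2 * pi}|lborel. f z * complex_of_real (deriv \<psi> z)) = - (LINT z:{0..2 * pi}|lborel. g' z * complex_of_real (\<psi> z))"
    unfolding 1 by (simp add: eq_neg_iff_add_eq_0)
qed

lemma rep_weak_deriv:
  assumes "rep f g" "cper g" "cper g'" "\<And>z. (g has_vector_derivative g' z) (at z)"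
  shows "rep (weak_deriv f) g'"
proof -
  have w: "has_weak_deriv f g'" by (rule rep_has_weak_deriv[OF assms])
  then have w': "has_weak_deriv f (weak_deriv f)" unfolding weak_deriv_def by (rule someI[of "has_weak_deriv f"])
  show ?thesis
    unfolding rep_def
    using has_weak_deriv_unique[OF w' w] w' L2T_D(1,2)[of "weak_deriv f"] by (auto simp: has_weak_deriv_def)
qed

section \<open>The Bloch operators on antiperiodic functions\<close>

text \<open>The phase turns antiperiodic functions into periodic ones. The imaginary part
  \<open>v\<close> is present because the ordinary derivative of e^(-iz/2) u is e^(-iz/2) (u' - i
  u/2): membership in \<open>HT\<close> leaves the real case, although Bloch derivatives stay in
  it.\<close>

definition phased :: "(real \<Rightarrow> real) \<Rightarrow> (real \<Rightarrow> real) \<Rightarrow> real \<Rightarrow> complex" where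
  "phased u v z = cis (- (z / 2)) * (complex_of_real (u z) + \<i> * complex_of_real (v z))"

abbreviation phased_real :: "(real \<Rightarrow> real) \<Rightarrow> real \<Rightarrow> complex" where
  "phased_real u \<equiv> phased u (\<lambda>z. 0)"

lemma antiper_zero: "antiper (\<lambda>z. 0)"
  by (simp add: antiper_def)

lemma phased_cper: assumes "antiper u" "antiper v" shows "cper (phased u v)"
proof -
  have "phased u v (z + 2 * pi) = phased u v z" for z
  proof -
    have "- ((z + 2 * pi) / 2) = - (z / 2) - pi" by (simp add: add_divide_distrib)
    then have "cis (- ((z + 2 * pi) / 2)) = - cis (- (z / 2))"
      by (simp add: cis_divide[symmetric])
    then show ?thesis
      unfolding phased_def antiper_shift[OF assms(1)] antiper_shift[OF assms(2)] by (simp add: algebra_simps)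
  qed
  moreover have "continuous_on UNIV (phased u v)"
    unfolding phased_def[abs_def]
    by (intro continuous_intros antiper_cont[OF assms(1)] antiper_cont[OF assms(2)]) simp
  ultimately show ?thesis by (simp add: cper_def periodic_2pi_def)
qed

lemma phased_deriv:
  assumes "(u has_real_derivative u' z) (at z)" "(v has_real_derivative v' z) (at z)"
  shows "(phased u v has_vector_derivative
     phased (\<lambda>z. 1 * u' z + 1 / 2 * v z) (\<lambda>z. 1 * v' z + (- 1 / 2) * u z) z) (at z)"
proof -
  have c: "((\<lambda>z. cis (- (z / 2))) has_vector_derivative (- 1 / 2) *\<^sub>R (\<i> * cis (- (z / 2)))) (at z)"
  proof -
    have "((\<lambda>z::real. - (z / 2)) has_derivative (\<lambda>t. - (t / 2))) (at z)"
      by (auto intro!: derivative_eq_intros)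
    from has_derivative_cis[OF this] show ?thesis by (simp add: has_vector_derivative_def)
  qed
  have uv: "((\<lambda>z. complex_of_real (u z) + \<i> * complex_of_real (v z)) has_vector_derivative
      complex_of_real (u' z) + \<i> * complex_of_real (v' z)) (at z)"
    by (intro has_vector_derivative_add has_vector_derivative_mult_right has_vector_derivative_of_real assms)
  have "cis (- (z / 2)) * (complex_of_real (u' z) + \<i> * complex_of_real (v' z))
      + (- 1 / 2) *\<^sub>R (\<i> * cis (- (z / 2))) * (complex_of_real (u z) + \<i> * complex_of_real (v z))
    = phased (\<lambda>z. 1 * u' z + 1 / 2 * v z) (\<lambda>z. 1 * v' z + (- 1 / 2) * u z) z"
    by (simp add: phased_def complex_eq_iff) (simp add: algebra_simps diff_divide_distrib)
  with has_vector_derivative_mult[OF c uv] show ?thesis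
    unfolding phased_def[abs_def] by simp
qed

lemma phased_HT:
  "antiper_class m u \<Longrightarrow> antiper_class m v \<Longrightarrow> phased u v \<in> HT m"
proof (induction m arbitrary: u v)
  case 0
  then have "cper (phased u v)" by (simp add: phased_cper)
  then show ?case using rep_L2T[OF rep_refl] by simp
next
  case (Suc m)
  obtain u' where u': "\<And>x. (u has_real_derivative u' x) (at x)" "antiper_class m u'"
    using Suc.prems(1) unfolding antiper_class.simps(2) by blast
  obtain v' where v': "\<And>x. (v has_real_derivative v' x) (at x)" "antiper_class m v'"
    using Suc.prems(2) unfolding antiper_class.simps(2) by blast
  define p where "p = (\<lambda>z. 1 * u' z + 1 / 2 * v z)"
  define q where "q = (\<lambda>z. 1 * v' z + (- 1 / 2) * u z)"
  have pq: "antiper_class m p" "antiper_class m q"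
    unfolding p_def q_def by (intro diff_class_lin u'(2) v'(2) diff_class_Suc_le[OF Suc.prems(1)] diff_class_Suc_le[OF Suc.prems(2)])+
  have c: "cper (phased u v)" "cper (phased p q)"
    by (rule phased_cper[OF diff_class_antiper[OF Suc.prems(1)] diff_class_antiper[OF Suc.prems(2)]],
        rule phased_cper[OF diff_class_antiper[OF pq(1)] diff_class_antiper[OF pq(2)]])
  have "has_weak_deriv (phased u v) (phased p q)"
    by (rule rep_has_weak_deriv[OF rep_refl[OF c(1)] c])
      (unfold p_def q_def, rule phased_deriv[OF u'(1) v'(1)])
  moreover have "phased p q \<in> HT m" by (rule Suc.IH[OF pq])
  ultimately show ?case by auto
qed

text \<open>Differentiating the phase yields -i/2, which cancels i\<xi> = i/2; on w the Bloch
  derivative is d/dz.\<close>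

lemma bloch_deriv_rep:
  assumes f: "rep f (phased_real w)" and w: "antiper w" "antiper w'" "\<And>z. (w has_real_derivative w' z) (at z)"
  shows "rep (bloch_deriv (1 / 2) f) (phased_real w')"
proof -
  let ?g = "phased (\<lambda>z. 1 * w' z + 1 / 2 * 0) (\<lambda>z. 1 * 0 + (- 1 / 2) * w z)"
  have g: "cper ?g" by (intro phased_cper antiper_lin w antiper_zero)
  have "rep (weak_deriv f) ?g"
    by (rule rep_weak_deriv[OF f phased_cper[OF w(1) antiper_zero] g])
      (rule phased_deriv[OF w(3)], simp)
  from rep_add[OF this rep_scale[OF f, of "\<i> * complex_of_real (1 / 2)"]]
  have "rep (\<lambda>z. weak_deriv f z + \<i> * complex_of_real (1 / 2) * f z)
      (\<lambda>z. ?g z + \<i> * complex_of_real (1 / 2) * phased_real w z)" .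
  moreover have "(\<lambda>z. ?g z + \<i> * complex_of_real (1 / 2) * phased_real w z) = phased_real w'"
    by (simp add: phased_def fun_eq_iff algebra_simps)
  moreover have "(\<lambda>z. weak_deriv f z + \<i> * complex_of_real (1 / 2) * f z) = bloch_deriv (1 / 2) f"
    by (simp add: bloch_deriv_def fun_eq_iff)
  ultimately show ?thesis by simp
qed

text \<open>The inner function h comes with its own derivatives as data, because in the application
  they are read off from the kernel equation and not computed from the profile.\<close>

lemma bloch_op_rep:
  assumes w: "antiper w" "antiper w1" "antiper w2"
      "\<And>z. (w has_real_derivative w1 z) (at z)" "\<And>z. (w1 has_real_derivative w2 z) (at z)"
    and h: "antiper h" "antiper h1" "antiper h2"
      "\<And>z. (h has_real_derivative h1 z) (at z)" "\<And>z. (h1 has_real_derivative h2 z) (at z)"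
    and h_eq: "\<And>z. h z = c * w z + \<beta> * k\<^sup>2 * w2 z - 2 * \<eta> z * w z"
    and \<eta>: "continuous_on UNIV \<eta>" "periodic_2pi \<eta>"
  shows "rep (bloch_op \<gamma> \<beta> k c \<eta> (1 / 2) (complex_of_real \<mu>) \<rho> (phased_real w))
     (phased_real (\<lambda>z. \<mu> * w1 z - k\<^sup>2 * h2 z - \<rho>\<^sup>2 * w z - \<gamma> * w z))"
proof -
  let ?\<phi> = "phased_real w"
  have \<phi>: "rep ?\<phi> ?\<phi>" by (intro rep_refl phased_cper w antiper_zero)
  note D1 = bloch_deriv_rep[OF \<phi> w(1,2,4)]
  note D2 = bloch_deriv_rep[OF D1 w(2,3,5)]
  have \<eta>c: "cper (\<lambda>s. 2 * complex_of_real (\<eta> s))"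
    using \<eta> by (auto simp: cper_def periodic_2pi_def intro!: continuous_intros)
  have "rep (\<lambda>s. complex_of_real c * ?\<phi> s + complex_of_real (\<beta> * k\<^sup>2) * bloch_deriv (1 / 2) (bloch_deriv (1 / 2) ?\<phi>) s
      - 2 * complex_of_real (\<eta> s) * ?\<phi> s)
      (\<lambda>s. complex_of_real c * ?\<phi> s + complex_of_real (\<beta> * k\<^sup>2) * phased_real w2 s - 2 * complex_of_real (\<eta> s) * ?\<phi> s)"
    by (intro rep_diff rep_add rep_scale rep_mult[OF \<eta>c] \<phi> D2)
  moreover have "(\<lambda>s. complex_of_real c * ?\<phi> s + complex_of_real (\<beta> * k\<^sup>2) * phased_real w2 s - 2 * complex_of_real (\<eta> s) * ?\<phi> s)
      = phased_real h"
    by (simp add: phased_def h_eq fun_eq_iff algebra_simps)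
  ultimately have inner: "rep (\<lambda>s. complex_of_real c * ?\<phi> s + complex_of_real (\<beta> * k\<^sup>2) * bloch_deriv (1 / 2) (bloch_deriv (1 / 2) ?\<phi>) s
      - 2 * complex_of_real (\<eta> s) * ?\<phi> s) (phased_real h)" by simp
  note I2 = bloch_deriv_rep[OF bloch_deriv_rep[OF inner h(1,2,4)] h(2,3,5)]
  have "rep (bloch_op \<gamma> \<beta> k c \<eta> (1 / 2) (complex_of_real \<mu>) \<rho> ?\<phi>)
    (\<lambda>z. complex_of_real \<mu> * phased_real w1 z - complex_of_real (k\<^sup>2) * phased_real h2 z
       - complex_of_real (\<rho>\<^sup>2) * ?\<phi> z - complex_of_real \<gamma> * ?\<phi> z)"
    unfolding bloch_op_def[abs_def] by (intro rep_diff rep_scale \<phi> D1 I2)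
  moreover have "(\<lambda>z. complex_of_real \<mu> * phased_real w1 z - complex_of_real (k\<^sup>2) * phased_real h2 z
       - complex_of_real (\<rho>\<^sup>2) * ?\<phi> z - complex_of_real \<gamma> * ?\<phi> z)
     = phased_real (\<lambda>z. \<mu> * w1 z - k\<^sup>2 * h2 z - \<rho>\<^sup>2 * w z - \<gamma> * w z)"
    by (simp add: phased_def fun_eq_iff algebra_simps)
  ultimately show ?thesis by simp
qed

lemma cper_ae_zero:
  assumes "cper g" "ae_eq g (\<lambda>z. 0)" shows "g z = 0"
proof (rule ccontr)
  assume "g z \<noteq> 0"
  let ?N = "{z. g z \<noteq> 0}"
  have c: "continuous_on UNIV g" using assms(1) by (simp add: cper_def)
  then have o: "open ?N" by (intro open_Collect_neq continuous_intros)
  then have "?N \<in> null_sets lborel"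
    using assms(2) AE_iff_null_sets[of ?N lborel] unfolding ae_eq_def by simp
  then have "negligible ?N" using o by (simp add: negligible_iff_null_sets null_sets_completion_iff)
  then show False using open_not_negligible[OF o] \<open>g z \<noteq> 0\<close> by blast
qed

text \<open>The kernel element and 0 are two preimages of 0 that differ in L^2. That T maps 0 to 0
  almost everywhere is a separate hypothesis, since an operator built from chosen representatives is
  not linear by its form.\<close>

lemma not_invertible_of_kernel:
  assumes w: "antiper_class 4 w" "w y \<noteq> 0"
    and T: "ae_eq (T (phased_real w)) (\<lambda>z. 0)" "ae_eq (T (phased_real (\<lambda>z. 0))) (\<lambda>z. 0)"
  shows "\<not> invertible_in_L2T (HT 4) T"
proof
  assume inv: "invertible_in_L2T (HT 4) T"
  have z: "antiper_class m (\<lambda>z. 0)" for m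
    by (induction m) (auto simp: antiper_zero intro!: exI[of _ "\<lambda>z. 0"])
  have c: "cper (\<lambda>z. 0)" by (rule cper_const)
  have "(\<lambda>z. 0) \<in> L2T" by (rule rep_L2T[OF rep_refl[OF c] c])
  then obtain \<phi> where \<phi>: "\<And>\<phi>'. \<phi>' \<in> HT 4 \<Longrightarrow> ae_eq (T \<phi>') (\<lambda>z. 0) \<Longrightarrow> ae_eq \<phi>' \<phi>"
    using inv unfolding invertible_in_L2T_def by blast
  have "ae_eq (phased_real w) \<phi>" "ae_eq (phased_real (\<lambda>z. 0)) \<phi>"
    using \<phi>[OF phased_HT[OF w(1) z] T(1)] \<phi>[OF phased_HT[OF z z] T(2)] by auto
  then have "AE z in lborel. phased_real w z = 0"
    unfolding ae_eq_def by eventually_elim (simp add: phased_def)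
  then have "phased_real w y = 0"
    using cper_ae_zero[OF phased_cper[OF diff_class_antiper[OF w(1)] antiper_zero]] unfolding ae_eq_def by blast
  then show False using w(2) by (simp add: phased_def)
qed

lemma bloch_not_invertible:
  assumes w: "antiper_class 4 w" "w y \<noteq> 0"
      "\<And>z. (w has_real_derivative w1 z) (at z)" "\<And>z. (w1 has_real_derivative w2 z) (at z)" "antiper w1" "antiper w2"
    and h: "antiper h" "antiper h1" "antiper h2"
      "\<And>z. (h has_real_derivative h1 z) (at z)" "\<And>z. (h1 has_real_derivative h2 z) (at z)"
    and h_eq: "\<And>z. h z = c * w z + \<beta> * k\<^sup>2 * w2 z - 2 * \<eta> z * w z"
    and \<eta>: "continuous_on UNIV \<eta>" "periodic_2pi \<eta>"
    and kernel: "\<And>z. \<mu> * w1 z - k\<^sup>2 * h2 z - \<rho>\<^sup>2 * w z - \<gamma> * w z = 0"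
  shows "\<not> invertible_in_L2T (HT 4) (bloch_op \<gamma> \<beta> k c \<eta> (1 / 2) (complex_of_real \<mu>) \<rho>)"
proof (rule not_invertible_of_kernel[OF w(1,2)])
  have z: "phased_real (\<lambda>z. 0) = (\<lambda>z. 0)" by (simp add: phased_def fun_eq_iff)
  show "ae_eq (bloch_op \<gamma> \<beta> k c \<eta> (1 / 2) (complex_of_real \<mu>) \<rho> (phased_real w)) (\<lambda>z. 0)"
    using bloch_op_rep[OF diff_class_antiper[OF w(1)] w(5,6,3,4) h h_eq \<eta>, of \<gamma> \<mu> \<rho>] unfolding kernel z rep_def by blast
  show "ae_eq (bloch_op \<gamma> \<beta> k c \<eta> (1 / 2) (complex_of_real \<mu>) \<rho> (phased_real (\<lambda>z. 0))) (\<lambda>z. 0)"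
  proof -
    have "rep (bloch_op \<gamma> \<beta> k c \<eta> (1 / 2) (complex_of_real \<mu>) \<rho> (phased_real (\<lambda>z. 0)))
        (phased_real (\<lambda>z. \<mu> * 0 - k\<^sup>2 * 0 - \<rho>\<^sup>2 * 0 - \<gamma> * 0))"
      by (rule bloch_op_rep[OF antiper_zero antiper_zero antiper_zero DERIV_const DERIV_const
            antiper_zero antiper_zero antiper_zero DERIV_const DERIV_const _ \<eta>]) simp
    then show ?thesis by (simp add: rep_def z)
  qed
qed

section \<open>Instability\<close>

text \<open>For |\<epsilon>| <= 1 all higher powers are dominated by \<epsilon>^2.\<close>

lemma small_amplitude_bounds:
  fixes \<epsilon> C :: real
  assumes \<epsilon>: "\<bar>\<epsilon>\<bar> \<le> 1" and b: "\<bar>x - (y + \<epsilon>\<^sup>2 * p + \<epsilon> ^ 3 * q)\<bar> \<le> C * \<epsilon> ^ 4"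
    and pq: "\<bar>p\<bar> \<le> P" "\<bar>q\<bar> \<le> Q"
  shows "\<bar>x - y\<bar> \<le> (P + Q + \<bar>C\<bar>) * \<epsilon>\<^sup>2"
proof -
  have "\<bar>\<epsilon>\<bar> ^ 3 \<le> \<bar>\<epsilon>\<bar>\<^sup>2" "\<bar>\<epsilon>\<bar> ^ 4 \<le> \<bar>\<epsilon>\<bar>\<^sup>2" using \<epsilon> by (intro power_decreasing; simp)+
  then have pw: "\<bar>\<epsilon> ^ 3\<bar> \<le> \<epsilon>\<^sup>2" "\<epsilon> ^ 4 \<le> \<epsilon>\<^sup>2" by (simp_all add: power_abs)
  have "C * \<epsilon> ^ 4 \<le> \<bar>C\<bar> * \<epsilon>\<^sup>2" using pw(2) by (intro mult_mono) auto
  moreover have "\<bar>\<epsilon>\<^sup>2 * p\<bar> \<le> \<epsilon>\<^sup>2 * P" using pq(1) by (simp add: abs_mult mult_left_mono)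
  moreover have "\<bar>\<epsilon> ^ 3 * q\<bar> \<le> \<epsilon>\<^sup>2 * Q"
    unfolding abs_mult using pw(1) pq(2) by (intro mult_mono) auto
  ultimately have "\<bar>x - y\<bar> \<le> \<epsilon>\<^sup>2 * P + \<epsilon>\<^sup>2 * Q + \<bar>C\<bar> * \<epsilon>\<^sup>2" using b by linarith
  then show ?thesis by (simp add: algebra_simps)
qed

lemma instability_of_small_wave:
  fixes \<gamma> \<beta> k s d c \<mu> :: real
  assumes pos: "0 < \<beta>" "0 < k" and s: "s\<^sup>2 = 3 / 4 + \<gamma> / (\<beta> * k ^ 4)"
    and c: "c = c0 \<gamma> \<beta> k + d" and \<rho>: "\<rho>\<^sup>2 = 3 * (\<beta> * k ^ 4) / 16 - 3 * \<gamma> / 4" "0 < \<rho>"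
    and \<eta>: "smooth \<eta>" "periodic_2pi \<eta>" and \<mu>: "0 < \<mu>" and w: "antiper w" "w y \<noteq> 0"
    and eq: "\<And>z. \<beta> * k ^ 4 * (w z + (1 / 4 + s\<^sup>2) * anti_int (anti_int w) z + s\<^sup>2 / 4 * anti_int (anti_int (anti_int (anti_int w))) z)
       = - k\<^sup>2 * d * anti_int (anti_int w) z + 2 * k\<^sup>2 * anti_int (anti_int (\<lambda>t. \<eta> t * w t)) z + \<mu> * anti_int (anti_int (anti_int w)) z"
  shows "nonperiodic_instability \<gamma> \<beta> k c \<eta> \<rho>"
proof -
  have b: "\<beta> * k ^ 4 \<noteq> 0" using pos by simp
  obtain w1 w2 where reg: "antiper_class 4 w" and w1: "\<And>z. (w has_real_derivative w1 z) (at z)"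
    and w2: "\<And>z. (w1 has_real_derivative w2 z) (at z)"
    and eq2: "\<And>z. \<beta> * k ^ 4 * (w2 z + (1 / 4 + s\<^sup>2) * w z + s\<^sup>2 / 4 * anti_int (anti_int w) z)
       = - k\<^sup>2 * d * w z + 2 * k\<^sup>2 * (\<eta> z * w z) + \<mu> * anti_int w z"
    using integrated_equation_regularity[OF w(1) \<eta> b eq] by blast
  have "antiper_class (Suc (Suc (Suc (Suc 0)))) w" using reg by (simp add: numeral_eq_Suc)
  then obtain v1 v2 where v: "\<And>z. (w has_real_derivative v1 z) (at z)" "antiper v1"
    "\<And>z. (v1 has_real_derivative v2 z) (at z)" "antiper v2" by auto
  have v1: "v1 = w1" using DERIV_unique[OF v(1) w1] by blast
  have v2: "v2 = w2" using DERIV_unique[OF v(3)[unfolded v1] w2] by blast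
  have ap: "antiper w1" "antiper w2" using v(2,4) unfolding v1 v2 .
  \<comment> \<open>This identity and the next ones match b (q^2 - 1/4) (q^2 - s^2) with the symbol
    b q^4 - k^2 c0 q^2 + \<rho>^2 + \<gamma>.\<close>
  have bs: "\<beta> * k ^ 4 * s\<^sup>2 = 3 * (\<beta> * k ^ 4) / 4 + \<gamma>"
    unfolding s using b by (simp add: distrib_left)
  then have r: "\<beta> * k ^ 4 * s\<^sup>2 / 4 = \<rho>\<^sup>2 + \<gamma>" unfolding \<rho>(1) by simp
  have kc: "k\<^sup>2 * c0 \<gamma> \<beta> k = \<gamma> + \<beta> * k ^ 4"
    using pos by (simp add: c0_def distrib_left power2_eq_square power4_eq_xxxx)
  have coef: "\<beta> * k ^ 4 / 4 + \<beta> * k ^ 4 * s\<^sup>2 = k\<^sup>2 * c0 \<gamma> \<beta> k"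
    unfolding kc bs by simp
  \<comment> \<open>By the twice integrated equation, c w + \<beta> k^2 w'' - 2 \<eta> w equals this
    combination of antiderivatives. Its second derivative involves only w and w', and the kernel
    equation becomes an identity.\<close>
  define h where "h z = (\<mu> / k\<^sup>2) * anti_int w z + (- (\<rho>\<^sup>2 + \<gamma>) / k\<^sup>2) * anti_int (anti_int w) z" for z
  define h1 where "h1 z = (\<mu> / k\<^sup>2) * w z + (- (\<rho>\<^sup>2 + \<gamma>) / k\<^sup>2) * anti_int w z" for z
  define h2 where "h2 z = (\<mu> / k\<^sup>2) * w1 z + (- (\<rho>\<^sup>2 + \<gamma>) / k\<^sup>2) * w z" for z
  have h_ap: "antiper h" "antiper h1" "antiper h2"
    unfolding h_def h1_def h2_def by (intro antiper_lin anti_int_antiper w(1) ap)+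
  have h_d: "(h has_real_derivative h1 z) (at z)" "(h1 has_real_derivative h2 z) (at z)" for z
    unfolding h_def[abs_def] h1_def[abs_def] h2_def
    by (intro DERIV_add DERIV_cmult anti_int_deriv anti_int_antiper w(1) w1)+
  have h_eq: "h z = c * w z + \<beta> * k\<^sup>2 * w2 z - 2 * \<eta> z * w z" for z
  proof -
    have "\<beta> * k ^ 4 * w2 z + (\<beta> * k ^ 4 / 4 + \<beta> * k ^ 4 * s\<^sup>2) * w z + (\<beta> * k ^ 4 * s\<^sup>2 / 4) * anti_int (anti_int w) z
       = - k\<^sup>2 * d * w z + 2 * k\<^sup>2 * (\<eta> z * w z) + \<mu> * anti_int w z"
      using eq2[of z] by (simp add: algebra_simps)
    then have "\<beta> * k ^ 4 * w2 z + (k\<^sup>2 * c0 \<gamma> \<beta> k) * w z + (\<rho>\<^sup>2 + \<gamma>) * anti_int (anti_int w) z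
       = - k\<^sup>2 * d * w z + 2 * k\<^sup>2 * (\<eta> z * w z) + \<mu> * anti_int w z"
      unfolding coef r .
    then have "k\<^sup>2 * (c * w z + \<beta> * k\<^sup>2 * w2 z - 2 * \<eta> z * w z) = \<mu> * anti_int w z - (\<rho>\<^sup>2 + \<gamma>) * anti_int (anti_int w) z"
      unfolding c by (simp add: algebra_simps power2_eq_square power4_eq_xxxx)
    also have "\<dots> = k\<^sup>2 * h z" using pos by (simp add: h_def distrib_left) (simp add: algebra_simps)
    finally show ?thesis using pos by simp
  qed
  have "\<not> invertible_in_L2T (HT 4) (bloch_op \<gamma> \<beta> k c \<eta> (1 / 2) (complex_of_real \<mu>) \<rho>)"
  proof (rule bloch_not_invertible[OF reg w(2) w1 w2 ap h_ap h_d h_eq smooth_continuous[OF \<eta>(1)] \<eta>(2)])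
    show "\<mu> * w1 z - k\<^sup>2 * h2 z - \<rho>\<^sup>2 * w z - \<gamma> * w z = 0" for z
      using pos by (simp add: h2_def distrib_left) (simp add: algebra_simps)
  qed
  then show ?thesis
    unfolding nonperiodic_instability_def using \<rho>(2) \<mu>
    by (intro conjI exI[of _ "1 / 2 :: real"] exI[of _ "complex_of_real \<mu>"]) auto
qed

theorem theorem1p2:
  fixes \<gamma> \<beta> k :: real
    and \<eta> :: "real \<Rightarrow> real \<Rightarrow> real \<Rightarrow> real"
    and c :: "real \<Rightarrow> real \<Rightarrow> real"
  assumes "\<gamma> > 0" and "\<beta> > 0"
    and "k > \<bar>4 * \<gamma> / \<beta>\<bar> powr (1/4)"
    and "RMKP_wave_family \<gamma> \<beta> \<eta> c"
  shows "\<exists>\<rho>0>0. \<exists>\<epsilon>0>0. \<forall>\<epsilon>. 0 < \<bar>\<epsilon>\<bar> \<and> \<bar>\<epsilon>\<bar> < \<epsilon>0 \<longrightarrow>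
           (\<exists>\<rho>. \<bar>\<rho>\<bar> \<ge> \<rho>0 \<and> nonperiodic_instability \<gamma> \<beta> k (c \<epsilon> k) (\<eta> \<epsilon> k) \<rho>)"
proof -
  have k: "0 < k" using assms(3) by (meson order_le_less_trans powr_ge_zero)
  define b where "b = \<beta> * k ^ 4"
  have b: "0 < b" using assms(2) k by (simp add: b_def)
  have k4: "4 * \<gamma> < b"
  proof -
    have "4 * \<gamma> / \<beta> = ((4 * \<gamma> / \<beta>) powr (1 / 4)) powr 4" using assms(1,2) by (simp add: powr_powr)
    also have "\<dots> < k powr 4" using assms(1-3) by (intro powr_less_mono2) auto
    also have "\<dots> = k ^ 4" using k by simp
    finally show ?thesis using assms(2) by (simp add: b_def divide_less_eq mult.commute)
  qed
  \<comment> \<open>Every resonant wave number lies below the threshold, since \<gamma>/(\<beta>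
    n^2) <= 4 \<gamma>/\<beta>.\<close>
  have nonres: "nonresonant \<gamma> \<beta> k"
    unfolding nonresonant_def
  proof (intro allI impI)
    fix n :: nat assume n: "2 \<le> n"
    have "\<gamma> / (\<beta> * (real n)\<^sup>2) \<le> \<gamma> / (\<beta> * 1)"
      using n assms(1,2) by (intro divide_left_mono mult_left_mono) auto
    also have "\<dots> \<le> \<bar>4 * \<gamma> / \<beta>\<bar>" using assms(1,2) by (simp add: divide_right_mono)
    finally have "(\<gamma> / (\<beta> * (real n)\<^sup>2)) powr (1 / 4) \<le> \<bar>4 * \<gamma> / \<beta>\<bar> powr (1 / 4)"
      using assms(1,2) by (intro powr_mono2) auto
    then show "k \<noteq> (\<gamma> / (\<beta> * (real n)\<^sup>2)) powr (1 / 4)" using assms(3) by linarith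
  qed
  note family = assms(4)[unfolded RMKP_wave_family_def, THEN spec, THEN mp, OF k, THEN mp, OF nonres]
  obtain \<delta>\<^sub>1 where \<delta>1: "0 < \<delta>\<^sub>1" and wave: "\<And>\<epsilon>. \<bar>\<epsilon>\<bar> < \<delta>\<^sub>1 \<Longrightarrow> periodic_2pi (\<eta> \<epsilon> k) \<and> smooth (\<eta> \<epsilon> k)"
  proof -
    from conjunct1[OF family] obtain \<delta> where "\<delta> > 0"
      and at_k: "\<forall>\<epsilon> \<kappa>. \<bar>\<epsilon>\<bar> < \<delta> \<longrightarrow> \<bar>\<kappa> - k\<bar> < \<delta> \<longrightarrow> periodic_2pi (\<eta> \<epsilon> \<kappa>) \<and> smooth (\<eta> \<epsilon> \<kappa>)"
      by blast
    have "periodic_2pi (\<eta> \<epsilon> k) \<and> smooth (\<eta> \<epsilon> k)" if "\<bar>\<epsilon>\<bar> < \<delta>" for \<epsilon>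
      using at_k[rule_format, OF that, of k] \<open>\<delta> > 0\<close> by simp
    then show ?thesis using that[OF \<open>\<delta> > 0\<close>] by blast
  qed
  from conjunct2[OF conjunct2[OF conjunct2[OF family]]] obtain C \<delta>\<^sub>2 where \<delta>2: "0 < \<delta>\<^sub>2" and expansion: "\<forall>\<epsilon>. \<bar>\<epsilon>\<bar> < \<delta>\<^sub>2 \<longrightarrow>
            (\<forall>z. \<bar>\<eta> \<epsilon> k z - (\<epsilon> * cos z + \<epsilon>\<^sup>2 * eta2 \<gamma> \<beta> k * cos (2 * z)
                              + \<epsilon> ^ 3 * eta3 \<gamma> \<beta> k * cos (3 * z))\<bar> \<le> C * \<epsilon> ^ 4) \<and>
            \<bar>c \<epsilon> k - (c0 \<gamma> \<beta> k + \<epsilon>\<^sup>2 * c2 \<gamma> \<beta> k)\<bar> \<le> C * \<epsilon> ^ 4"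
    by blast
  define C\<^sub>1 where "C\<^sub>1 = \<bar>eta2 \<gamma> \<beta> k\<bar> + \<bar>eta3 \<gamma> \<beta> k\<bar> + \<bar>C\<bar>"
  have C1: "0 \<le> C\<^sub>1" by (simp add: C\<^sub>1_def)
  have small_\<eta>: "\<bar>\<eta> \<epsilon> k z - \<epsilon> * cos z\<bar> \<le> C\<^sub>1 * \<epsilon>\<^sup>2" and small_c: "\<bar>c \<epsilon> k - c0 \<gamma> \<beta> k\<bar> \<le> C\<^sub>1 * \<epsilon>\<^sup>2"
    if "\<bar>\<epsilon>\<bar> < \<delta>\<^sub>2" "\<bar>\<epsilon>\<bar> \<le> 1" for \<epsilon> z
  proof -
    have e: "\<bar>\<eta> \<epsilon> k z - (\<epsilon> * cos z + \<epsilon>\<^sup>2 * (eta2 \<gamma> \<beta> k * cos (2 * z)) + \<epsilon> ^ 3 * (eta3 \<gamma> \<beta> k * cos (3 * z)))\<bar> \<le> C * \<epsilon> ^ 4"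
      "\<bar>c \<epsilon> k - (c0 \<gamma> \<beta> k + \<epsilon>\<^sup>2 * eta2 \<gamma> \<beta> k + \<epsilon> ^ 3 * 0)\<bar> \<le> C * \<epsilon> ^ 4"
      using expansion that(1) by (simp_all add: mult.assoc c2_def)
    show "\<bar>\<eta> \<epsilon> k z - \<epsilon> * cos z\<bar> \<le> C\<^sub>1 * \<epsilon>\<^sup>2"
      unfolding C\<^sub>1_def by (rule small_amplitude_bounds[OF that(2) e(1)]) (simp_all add: abs_mult_le_one)
    show "\<bar>c \<epsilon> k - c0 \<gamma> \<beta> k\<bar> \<le> C\<^sub>1 * \<epsilon>\<^sup>2"
      unfolding C\<^sub>1_def by (rule small_amplitude_bounds[OF that(2) e(2)]) simp_all
  qed
  define s where "s = sqrt (3 / 4 + \<gamma> / b)"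
  have s2: "s\<^sup>2 = 3 / 4 + \<gamma> / b" using assms(1) b by (simp add: s_def)
  have "\<gamma> / b < 1 / 4" "0 < \<gamma> / b" using k4 b assms(1) by (simp_all add: divide_less_eq)
  then have "s\<^sup>2 < 1" "1 / 4 < s\<^sup>2" unfolding s2 by linarith+
  then have "s\<^sup>2 < 1\<^sup>2" "(1 / 2)\<^sup>2 < s\<^sup>2" by (simp_all add: power_divide)
  moreover have "0 \<le> s" using assms(1) b by (simp add: s_def)
  ultimately have "s < 1" "1 / 2 < s" using power2_less_imp_less by fastforce+
  \<comment> \<open>s pi lies strictly between pi/2 and pi, so the denominator of the Green's
    function is nonzero.\<close>
  have "cos (s * pi) < cos (pi / 2)"
    using \<open>s < 1\<close> \<open>1 / 2 < s\<close> mult_right_mono[of s 1 pi] mult_strict_right_mono[of "1 / 2" s pi]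
    by (intro cos_monotone_0_pi) auto
  then have s: "s \<noteq> 0" "cos (s * pi) \<noteq> 0" using \<open>1 / 2 < s\<close> by auto
  obtain \<epsilon>\<^sub>0 where \<epsilon>0: "0 < \<epsilon>\<^sub>0" and kernel:
    "\<And>\<epsilon> d \<eta>. 0 < \<bar>\<epsilon>\<bar> \<Longrightarrow> \<bar>\<epsilon>\<bar> < \<epsilon>\<^sub>0 \<Longrightarrow> continuous_on UNIV \<eta> \<Longrightarrow> periodic_2pi \<eta> \<Longrightarrow>
       (\<And>z. \<bar>\<eta> z - \<epsilon> * cos z\<bar> \<le> C\<^sub>1 * \<epsilon>\<^sup>2) \<Longrightarrow> \<bar>d\<bar> \<le> C\<^sub>1 * \<epsilon>\<^sup>2 \<Longrightarrow>
       \<exists>\<mu>>0. \<exists>w. antiper w \<and> (\<exists>z. w z \<noteq> 0) \<and>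
         (\<forall>z. b * (w z + (1 / 4 + s\<^sup>2) * anti_int (anti_int w) z + s\<^sup>2 / 4 * anti_int (anti_int (anti_int (anti_int w))) z)
            = - k\<^sup>2 * d * anti_int (anti_int w) z + 2 * k\<^sup>2 * anti_int (anti_int (\<lambda>t. \<eta> t * w t)) z + \<mu> * anti_int (anti_int (anti_int w)) z)"
    using bifurcating_kernel[OF b k C1 s] by blast
  \<comment> \<open>Does not depend on \<epsilon>, so the same number serves as the lower bound
    \<open>\<rho>0\<close>.\<close>
  define \<rho> where "\<rho> = sqrt (3 * b / 16 - 3 * \<gamma> / 4)"
  have \<rho>: "0 < \<rho>" "\<rho>\<^sup>2 = 3 * b / 16 - 3 * \<gamma> / 4" using k4 by (simp_all add: \<rho>_def)
  have "nonperiodic_instability \<gamma> \<beta> k (c \<epsilon> k) (\<eta> \<epsilon> k) \<rho>"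
    if \<epsilon>: "0 < \<bar>\<epsilon>\<bar>" "\<bar>\<epsilon>\<bar> < min (min \<epsilon>\<^sub>0 1) (min \<delta>\<^sub>1 \<delta>\<^sub>2)" for \<epsilon>
  proof -
    have lt: "\<bar>\<epsilon>\<bar> < \<epsilon>\<^sub>0" "\<bar>\<epsilon>\<bar> \<le> 1" "\<bar>\<epsilon>\<bar> < \<delta>\<^sub>1" "\<bar>\<epsilon>\<bar> < \<delta>\<^sub>2" using \<epsilon>(2) by auto
    have \<eta>: "periodic_2pi (\<eta> \<epsilon> k)" "smooth (\<eta> \<epsilon> k)" using wave[OF lt(3)] by auto
    obtain \<mu> w y where \<mu>: "0 < \<mu>" "antiper w" "w y \<noteq> 0"
      "\<And>z. b * (w z + (1 / 4 + s\<^sup>2) * anti_int (anti_int w) z + s\<^sup>2 / 4 * anti_int (anti_int (anti_int (anti_int w))) z)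
         = - k\<^sup>2 * (c \<epsilon> k - c0 \<gamma> \<beta> k) * anti_int (anti_int w) z + 2 * k\<^sup>2 * anti_int (anti_int (\<lambda>t. \<eta> \<epsilon> k t * w t)) z + \<mu> * anti_int (anti_int (anti_int w)) z"
      using kernel[OF \<epsilon>(1) lt(1) smooth_continuous[OF \<eta>(2)] \<eta>(1) small_\<eta>[OF lt(4,2)] small_c[OF lt(4,2)]] by blast
    show ?thesis
      by (rule instability_of_small_wave[OF assms(2) k s2[unfolded b_def] _ \<rho>(2,1)[unfolded b_def] \<eta>(2,1) \<mu>(1-3) \<mu>(4)[unfolded b_def]])
        simp
  qed
  moreover have "0 < min (min \<epsilon>\<^sub>0 1) (min \<delta>\<^sub>1 \<delta>\<^sub>2)" using \<epsilon>0 \<delta>1 \<delta>2 by simp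
  moreover have "\<rho> \<le> \<bar>\<rho>\<bar>" by simp
  ultimately show ?thesis using \<rho>(1) by blast
qed

end
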